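(* Let $(S,\nu)$ be a space of homogeneous type and $(\Omega,\mu)$ a $\sigma$-finite measurable space. Let $X$ be a normed lattice of measurable functions on $(S\times\Omega,\nu\times\mu)$ such that its order dual $X'$ is norming for $X$. Suppose that both $X$ and $X'$ are $A_\infty$-regular. Then both $X$ and $X'$ are $A_1$-regular.
   Context: A normed lattice of measurable functions $X$ is a normed space of measurable functions such that $g\in X$, $|f|\le|g|$ a.e. implies $f\in X$ and $\|f\|_X\le\|g\|_X$; lattices are assumed to have full support (there is no set of positive measure on which all functions of $X$ vanish). The order dual $X'$ is the lattice of all measurable $g$ with $\|g\|_{X'}=\sup\{\int|fg|:f\in X,\|f\|_X\le1\}<\infty$. A lattice $Y$ is norming for $X$ if $fg\in L_1$ for all $f\in X$, $g\in Y$ and $\|f\|_X=\sup_{g\in Y,\|g\|_Y=1}\int|fg|$ for all $f\in X$. $Mf(x,\omega)=\sup_{B\ni x}\frac1{\nu(B)}\int_B|f(\cdot,\omega)|\,d\nu$, the supremum being over balls $B\subset S$ containing $x$. For a weight (a nonnegative a.e. finite measurable function) $w$ on $S\times\Omega$ and $p>1$, $$[w]_{A_p}=\operatorname*{ess\,sup}_{\omega}\sup_B\Big(\frac1{\nu(B)}\int_Bw(\cdot,\omega)\Big)\Big(\frac1{\nu(B)}\int_Bw^{-\frac1{p-1}}(\cdot,\omega)\Big)^{p-1},$$ supremum over balls $B\subset S$, with $0\cdot\infty=0$; $[w]_{A_1}$ is the least $C$ with $Mw\le Cw$ a.e. A quasi-normed lattice $X$ is $A_p$-regular with constants $(C,m)$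 if every $f\in X$ admits a majorant $w\in X$, $w\ge|f|$, with $\|w\|_X\le m\|f\|_X$ and $[w]_{A_p}\le C$; $X$ is $A_p$-regular if this holds with some constants. $X$ is $A_\infty$-regular if and only if it is $A_p$-regular with some $p<\infty$.
   Formalization: The normed lattice X is additionally assumed complete (a Banach lattice), for both conclusions; without completeness the claim that X is A_1-regular fails, e.g. for {f : |f| ≤ c|x|^{1/2}} with the L_2 norm on the torus, though the claim for X' does not need it. *)

theory Defs
  imports "HOL-Analysis.Analysis"
begin

section \<open>Spaces of homogeneous type\<close>

definition qball :: "('s \<Rightarrow> 's \<Rightarrow> real) \<Rightarrow> 's measure \<Rightarrow> 's \<Rightarrow> real \<Rightarrow> 's set" where
  "qball d \<nu> x r = {y \<in> space \<nu>. d x y < r}"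

definition qballs :: "('s \<Rightarrow> 's \<Rightarrow> real) \<Rightarrow> 's measure \<Rightarrow> 's set set" where
  "qballs d \<nu> = {qball d \<nu> x r |x r. x \<in> space \<nu> \<and> r > 0}"

definition quasi_metric_on :: "'s set \<Rightarrow> ('s \<Rightarrow> 's \<Rightarrow> real) \<Rightarrow> bool" where
  "quasi_metric_on S d \<longleftrightarrow>
     (\<forall>x\<in>S. \<forall>y\<in>S. d x y \<ge> 0 \<and> (d x y = 0 \<longleftrightarrow> x = y) \<and> d x y = d y x) \<and>
     (\<exists>K. \<forall>x\<in>S. \<forall>y\<in>S. \<forall>z\<in>S. d x z \<le> K * (d x y + d y z))"

definition qopens :: "('s \<Rightarrow> 's \<Rightarrow> real) \<Rightarrow> 's measure \<Rightarrow> 's set set" where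
  "qopens d \<nu> = {U. U \<subseteq> space \<nu> \<and> (\<forall>x\<in>U. \<exists>r>0. qball d \<nu> x r \<subseteq> U)}"

text \<open>
  Balls of a quasi-metric need not be open, so their measurability is a separate requirement.
  The third condition (Borel regularity) says that \<open>\<nu>\<close> is a Borel measure up to null sets: it
  holds trivially if \<^term>\<open>sets \<nu>\<close> is exactly the Borel sigma-algebra, and it also admits
  completed Borel measures.
\<close>

definition homogeneous_type_space :: "('s \<Rightarrow> 's \<Rightarrow> real) \<Rightarrow> 's measure \<Rightarrow> bool" where
  "homogeneous_type_space d \<nu> \<longleftrightarrow>
     quasi_metric_on (space \<nu>) d \<and>
     qopens d \<nu> \<subseteq> sets \<nu> \<and>
     (\<forall>A\<in>sets \<nu>. \<exists>B\<in>sigma_sets (space \<nu>) (qopens d \<nu>). A \<subseteq> B \<and> emeasure \<nu> B = emeasure \<nu> A) \<and>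
     (\<forall>B\<in>qballs d \<nu>. B \<in> sets \<nu> \<and> 0 < emeasure \<nu> B \<and> emeasure \<nu> B < \<infinity>) \<and>
     (\<exists>C::real. \<forall>x\<in>space \<nu>. \<forall>r>0.
        emeasure \<nu> (qball d \<nu> x (2 * r)) \<le> ennreal C * emeasure \<nu> (qball d \<nu> x r))"


section \<open>Normed lattices of measurable functions\<close>

text \<open>
  A lattice is a set \<open>X\<close> of measurable functions on \<open>M\<close> with a norm \<open>N\<close>, whose values outside
  \<open>X\<close> are irrelevant. Functions are not passed to classes modulo a.e. equality; instead
  \<open>N f = 0\<close> means \<open>f = 0\<close> a.e., and \<open>X\<close> is saturated under a.e. equality by the ideal property.
\<close>

definition normed_lattice :: "'a measure \<Rightarrow> ('a \<Rightarrow> real) set \<Rightarrow> (('a \<Rightarrow> real) \<Rightarrow> real) \<Rightarrow> bool" where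
  "normed_lattice M X N \<longleftrightarrow>
     X \<subseteq> borel_measurable M \<and>
     (\<lambda>z. 0) \<in> X \<and>
     (\<forall>f\<in>X. \<forall>g\<in>X. (\<lambda>z. f z + g z) \<in> X \<and> N (\<lambda>z. f z + g z) \<le> N f + N g) \<and>
     (\<forall>f\<in>X. \<forall>c::real. (\<lambda>z. c * f z) \<in> X \<and> N (\<lambda>z. c * f z) = \<bar>c\<bar> * N f) \<and>
     (\<forall>f\<in>X. N f \<ge> 0 \<and> (N f = 0 \<longleftrightarrow> (AE z in M. f z = 0))) \<and>
     (\<forall>g\<in>X. \<forall>f\<in>borel_measurable M. (AE z in M. \<bar>f z\<bar> \<le> \<bar>g z\<bar>) \<longrightarrow> f \<in> X \<and> N f \<le> N g) \<and>
     (\<forall>A\<in>sets M. emeasure M A > 0 \<longrightarrow> (\<exists>f\<in>X. \<not> (AE z in M. z \<in> A \<longrightarrow> f z = 0)))"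

text \<open>
  \<open>X\<close> is a Banach lattice. Without this, a lattice such as
  \<open>{f. \<exists>c. \<bar>f\<bar> \<le> c * u}\<close> with the L2 norm on the torus, where \<open>u x = \<bar>x\<bar> powr (1/2)\<close>, is A2-regular
  with order dual L2, which is norming and A1-regular, but \<open>u\<close> has no A1 majorant in it.
\<close>

definition norm_complete :: "('a \<Rightarrow> real) set \<Rightarrow> (('a \<Rightarrow> real) \<Rightarrow> real) \<Rightarrow> bool" where
  "norm_complete X N \<longleftrightarrow>
     (\<forall>F :: nat \<Rightarrow> 'a \<Rightarrow> real.
        (\<forall>n. F n \<in> X) \<longrightarrow>
        (\<forall>e>0. \<exists>k. \<forall>m\<ge>k. \<forall>n\<ge>k. N (\<lambda>z. F m z - F n z) < e) \<longrightarrow>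
        (\<exists>f\<in>X. (\<lambda>n. N (\<lambda>z. F n z - f z)) \<longlonglongrightarrow> 0))"

definition dual_enorm ::
  "'a measure \<Rightarrow> ('a \<Rightarrow> real) set \<Rightarrow> (('a \<Rightarrow> real) \<Rightarrow> real) \<Rightarrow> ('a \<Rightarrow> real) \<Rightarrow> ennreal" where
  "dual_enorm M X N g = (SUP f\<in>{f \<in> X. N f \<le> 1}. \<integral>\<^sup>+z. ennreal \<bar>f z * g z\<bar> \<partial>M)"

definition order_dual ::
  "'a measure \<Rightarrow> ('a \<Rightarrow> real) set \<Rightarrow> (('a \<Rightarrow> real) \<Rightarrow> real) \<Rightarrow> ('a \<Rightarrow> real) set" where
  "order_dual M X N = {g \<in> borel_measurable M. dual_enorm M X N g < \<infinity>}"

definition dual_norm ::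
  "'a measure \<Rightarrow> ('a \<Rightarrow> real) set \<Rightarrow> (('a \<Rightarrow> real) \<Rightarrow> real) \<Rightarrow> ('a \<Rightarrow> real) \<Rightarrow> real" where
  "dual_norm M X N g = enn2real (dual_enorm M X N g)"

definition norming ::
  "'a measure \<Rightarrow> ('a \<Rightarrow> real) set \<Rightarrow> (('a \<Rightarrow> real) \<Rightarrow> real) \<Rightarrow>
   ('a \<Rightarrow> real) set \<Rightarrow> (('a \<Rightarrow> real) \<Rightarrow> real) \<Rightarrow> bool" where
  "norming M Y N\<^sub>Y X N\<^sub>X \<longleftrightarrow>
     (\<forall>f\<in>X. \<forall>g\<in>Y. integrable M (\<lambda>z. f z * g z)) \<and>
     (\<forall>f\<in>X. ennreal (N\<^sub>X f) = (SUP g\<in>{g \<in> Y. N\<^sub>Y g = 1}. \<integral>\<^sup>+z. ennreal \<bar>f z * g z\<bar> \<partial>M))"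


section \<open>Maximal function and Muckenhoupt constants\<close>

text \<open>
  Real powers with values in \<open>[0,\<infinity>]\<close>, so that \<open>0\<close> to a negative power is \<open>\<infinity>\<close>
  (whereas \<open>0 powr a = 0\<close> for reals). Multiplication on \<^typ>\<open>ennreal\<close> satisfies \<open>0 * \<infinity> = 0\<close>.
\<close>

definition epowr :: "ennreal \<Rightarrow> real \<Rightarrow> ennreal" where
  "epowr x a =
     (if a = 0 then 1
      else if x = 0 then (if a > 0 then 0 else \<infinity>)
      else if x = \<infinity> then (if a > 0 then \<infinity> else 0)
      else ennreal (enn2real x powr a))"

definition average :: "'s measure \<Rightarrow> 's set \<Rightarrow> ('s \<Rightarrow> ennreal) \<Rightarrow> ennreal" where
  "average \<nu> B f = (\<integral>\<^sup>+x\<in>B. f x \<partial>\<nu>) / emeasure \<nu> B"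

definition maximal_function ::
  "('s \<Rightarrow> 's \<Rightarrow> real) \<Rightarrow> 's measure \<Rightarrow> ('s \<times> 'o \<Rightarrow> real) \<Rightarrow> 's \<times> 'o \<Rightarrow> ennreal" where
  "maximal_function d \<nu> f = (\<lambda>(x, \<omega>).
     SUP B\<in>{B \<in> qballs d \<nu>. x \<in> B}. average \<nu> B (\<lambda>y. ennreal \<bar>f (y, \<omega>)\<bar>))"

definition A1_const ::
  "('s \<Rightarrow> 's \<Rightarrow> real) \<Rightarrow> 's measure \<Rightarrow> 'o measure \<Rightarrow> ('s \<times> 'o \<Rightarrow> real) \<Rightarrow> ennreal" where
  "A1_const d \<nu> \<mu> w =
     Inf {C. AE z in \<nu> \<Otimes>\<^sub>M \<mu>. maximal_function d \<nu> w z \<le> C * ennreal (w z)}"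

text \<open>
  The essential supremum over \<open>\<omega>\<close> is written out as the least a.e. upper bound, which needs
  no measurability in \<open>\<omega>\<close> of the supremum over the (in general uncountable) family of balls.
\<close>

definition Ap_const ::
  "('s \<Rightarrow> 's \<Rightarrow> real) \<Rightarrow> 's measure \<Rightarrow> 'o measure \<Rightarrow> real \<Rightarrow> ('s \<times> 'o \<Rightarrow> real) \<Rightarrow> ennreal" where
  "Ap_const d \<nu> \<mu> p w =
     (if p = 1 then A1_const d \<nu> \<mu> w
      else Inf {C. AE \<omega> in \<mu>.
        (SUP B\<in>qballs d \<nu>.
           average \<nu> B (\<lambda>x. ennreal (w (x, \<omega>))) *
           epowr (average \<nu> B (\<lambda>x. epowr (ennreal (w (x, \<omega>))) (- 1 / (p - 1)))) (p - 1)) \<le> C})"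

definition Ap_regular_with ::
  "('s \<Rightarrow> 's \<Rightarrow> real) \<Rightarrow> 's measure \<Rightarrow> 'o measure \<Rightarrow> real \<Rightarrow> real \<Rightarrow> real \<Rightarrow>
   ('s \<times> 'o \<Rightarrow> real) set \<Rightarrow> (('s \<times> 'o \<Rightarrow> real) \<Rightarrow> real) \<Rightarrow> bool" where
  "Ap_regular_with d \<nu> \<mu> p C m X N \<longleftrightarrow>
     (\<forall>f\<in>X. \<exists>w\<in>X. (AE z in \<nu> \<Otimes>\<^sub>M \<mu>. \<bar>f z\<bar> \<le> w z) \<and> N w \<le> m * N f \<and>
        Ap_const d \<nu> \<mu> p w \<le> ennreal C)"

definition Ap_regular ::
  "('s \<Rightarrow> 's \<Rightarrow> real) \<Rightarrow> 's measure \<Rightarrow> 'o measure \<Rightarrow> real \<Rightarrow>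
   ('s \<times> 'o \<Rightarrow> real) set \<Rightarrow> (('s \<times> 'o \<Rightarrow> real) \<Rightarrow> real) \<Rightarrow> bool" where
  "Ap_regular d \<nu> \<mu> p X N \<longleftrightarrow> (\<exists>C m. Ap_regular_with d \<nu> \<mu> p C m X N)"

definition Ainf_regular ::
  "('s \<Rightarrow> 's \<Rightarrow> real) \<Rightarrow> 's measure \<Rightarrow> 'o measure \<Rightarrow>
   ('s \<times> 'o \<Rightarrow> real) set \<Rightarrow> (('s \<times> 'o \<Rightarrow> real) \<Rightarrow> real) \<Rightarrow> bool" where
  "Ainf_regular d \<nu> \<mu> X N \<longleftrightarrow> (\<exists>p\<ge>1. Ap_regular d \<nu> \<mu> p X N)"

end

theory Submission
  imports Defs
begin

text \<open>
  Let \<open>w \<in> X\<close> and \<open>v \<in> X'\<close> have Muckenhoupt sections. Since \<open>w\<close> is comparable with its average on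
  most of every ball, \<open>{M w > \<lambda>}\<close> is covered by balls at least half of which lie in \<open>{w \<ge> c\<lambda>}\<close>, and a Vitali
  covering gives \<open>\<integral> M w v \<le> C \<integral> w v\<close>. By duality \<open>M\<close> maps \<open>X'\<close> into itself boundedly, and
  the iteration of Rubio de Francia produces \<open>A\<^sub>1\<close> majorants in \<open>X'\<close>.

  For \<open>X\<close> this only shows that \<open>M w\<close> belongs to the second dual. To see that \<open>M w \<in> X\<close>, fix
  a height \<open>\<lambda>\<close> and a small \<open>a\<close>. By the density theorem almost every point with \<open>M w > \<lambda>\<close> and
  \<open>w < t a \<lambda>\<close> lies in a ball of average below \<open>a \<lambda>\<close>; doubling this ball, the average must pass the value
  \<open>a \<lambda>\<close>, so that the point lies in a ball on a fixed part of which \<open>w\<close> is comparable with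
  \<open>a \<lambda>\<close> and \<open>M w \<ge> \<lambda> / A\<close>. For geometrically decreasing \<open>a\<close> these parts are disjoint, hence
  \<open>\<integral> (M w - \<tau>\<^sub>n w)\<^sup>+ v \<le> (C / n) \<integral> w v\<close>. So \<open>min (M w) (\<tau>\<^sub>n w) \<in> X\<close> is a Cauchy sequence, and
  its limit majorizes \<open>M w\<close>.
\<close>

section \<open>Coverings in doubling quasi-metric spaces\<close>

text \<open>Apart from measurability and finiteness, the estimates see a weight only through the
  modulus in \<open>Ainf_weight\<close>, which depends on p and on the constant but not on the
  weight. Hence the constants are uniform over all majorants that regularity provides. Both covering
  estimates compare level sets at each height separately and are then integrated over the height, so
  no interpolation intervenes. The obstacle is that X need not have the Fatou property: an
  increasing sequence bounded in norm may have its supremum outside X. The order dual always has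
  this property, by monotone convergence and full support, so a bound for M is enough there. In X a
  rate of convergence has to take its place. Balls of a quasi-metric need not be open and suprema
  over all balls need not be measurable; therefore the maximal function and the coverings use a
  countable family of balls.\<close>

locale doubling_space =
  fixes d :: "'s \<Rightarrow> 's \<Rightarrow> real" and \<nu> :: "'s measure" and K Cd :: real
  assumes d_nonneg: "\<And>x y. x \<in> space \<nu> \<Longrightarrow> y \<in> space \<nu> \<Longrightarrow> 0 \<le> d x y"
    and d_refl: "\<And>x. x \<in> space \<nu> \<Longrightarrow> d x x = 0"
    and d_sym: "\<And>x y. x \<in> space \<nu> \<Longrightarrow> y \<in> space \<nu> \<Longrightarrow> d x y = d y x"
    and d_tri: "\<And>x y z. x \<in> space \<nu> \<Longrightarrow> y \<in> space \<nu> \<Longrightarrow> z \<in> space \<nu> \<Longrightarrow> d x z \<le> K * (d x y + d y z)"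
    and K_ge_1: "1 \<le> K" and Cd_ge_1: "1 \<le> Cd"
    and qopens_sets: "qopens d \<nu> \<subseteq> sets \<nu>"
    and borel_regular: "\<And>A. A \<in> sets \<nu> \<Longrightarrow>
          \<exists>B\<in>sigma_sets (space \<nu>) (qopens d \<nu>). A \<subseteq> B \<and> emeasure \<nu> B = emeasure \<nu> A"
    and ball_sets: "\<And>x r. x \<in> space \<nu> \<Longrightarrow> 0 < r \<Longrightarrow> qball d \<nu> x r \<in> sets \<nu>"
    and ball_pos: "\<And>x r. x \<in> space \<nu> \<Longrightarrow> 0 < r \<Longrightarrow> 0 < emeasure \<nu> (qball d \<nu> x r)"
    and ball_finite: "\<And>x r. x \<in> space \<nu> \<Longrightarrow> 0 < r \<Longrightarrow> emeasure \<nu> (qball d \<nu> x r) < \<infinity>"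
    and doubling: "\<And>x r. x \<in> space \<nu> \<Longrightarrow> 0 < r \<Longrightarrow>
          emeasure \<nu> (qball d \<nu> x (2 * r)) \<le> ennreal Cd * emeasure \<nu> (qball d \<nu> x r)"

lemma homogeneous_type_space_doubling:
  assumes "homogeneous_type_space d \<nu>"
  obtains K Cd where "doubling_space d \<nu> K Cd"
proof -
  note hts = assms[unfolded homogeneous_type_space_def]
  note qmo = hts[THEN conjunct1]
  note opn = hts[THEN conjunct2, THEN conjunct1]
  note reg = hts[THEN conjunct2, THEN conjunct2, THEN conjunct1]
  note bls = hts[THEN conjunct2, THEN conjunct2, THEN conjunct2, THEN conjunct1]
  note dbl0 = hts[THEN conjunct2, THEN conjunct2, THEN conjunct2, THEN conjunct2]
  from qmo obtain K0 where
    K0: "\<forall>x\<in>space \<nu>. \<forall>y\<in>space \<nu>. \<forall>z\<in>space \<nu>. d x z \<le> K0 * (d x y + d y z)" and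
    qm: "\<forall>x\<in>space \<nu>. \<forall>y\<in>space \<nu>. d x y \<ge> 0 \<and> (d x y = 0 \<longleftrightarrow> x = y) \<and> d x y = d y x"
    by (auto simp only: quasi_metric_on_def)
  from dbl0 obtain C0 where
    C0: "\<forall>x\<in>space \<nu>. \<forall>r>0. emeasure \<nu> (qball d \<nu> x (2 * r)) \<le> ennreal C0 * emeasure \<nu> (qball d \<nu> x r)"
    by blast
  have tri: "d x z \<le> max K0 1 * (d x y + d y z)"
    if "x \<in> space \<nu>" "y \<in> space \<nu>" "z \<in> space \<nu>" for x y z
  proof -
    have "d x z \<le> K0 * (d x y + d y z)" using K0 that by blast
    also have "\<dots> \<le> max K0 1 * (d x y + d y z)" using qm that by (intro mult_right_mono) auto
    finally show ?thesis .
  qed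
  have dbl: "emeasure \<nu> (qball d \<nu> x (2 * r)) \<le> ennreal (max C0 1) * emeasure \<nu> (qball d \<nu> x r)"
    if "x \<in> space \<nu>" "0 < r" for x r
  proof -
    have "emeasure \<nu> (qball d \<nu> x (2 * r)) \<le> ennreal C0 * emeasure \<nu> (qball d \<nu> x r)"
      using C0 that by blast
    also have "\<dots> \<le> ennreal (max C0 1) * emeasure \<nu> (qball d \<nu> x r)"
      by (intro mult_right_mono ennreal_leI) auto
    finally show ?thesis .
  qed
  have q: "qball d \<nu> x r \<in> qballs d \<nu>" if "x \<in> space \<nu>" "0 < r" for x r
    using that unfolding qballs_def by blast
  have "doubling_space d \<nu> (max K0 1) (max C0 1)"
  proof
    fix x r assume "x \<in> space \<nu>" "(0::real) < r"
    then show "qball d \<nu> x r \<in> sets \<nu>" "0 < emeasure \<nu> (qball d \<nu> x r)"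
      "emeasure \<nu> (qball d \<nu> x r) < \<infinity>"
      using q bls by blast+
  next
    fix A assume "A \<in> sets \<nu>"
    then show "\<exists>B\<in>sigma_sets (space \<nu>) (qopens d \<nu>). A \<subseteq> B \<and> emeasure \<nu> B = emeasure \<nu> A"
      using reg by simp
  qed (use qm in simp, use qm in simp, use qm in simp, rule tri, assumption+, simp, simp, rule opn, rule dbl)
  then show thesis using that by blast
qed

context doubling_space
begin

abbreviation Bl :: "'s \<Rightarrow> real \<Rightarrow> 's set" where "Bl x r \<equiv> qball d \<nu> x r"
abbreviation Sp :: "'s set" ("\<S>") where "\<S> \<equiv> space \<nu>"
abbreviation opens :: "'s set set" where "opens \<equiv> qopens d \<nu>"
abbreviation balls :: "('s \<times> real) set \<Rightarrow> 's set" where "balls P \<equiv> (\<Union>(y, r)\<in>P. Bl y r)"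
abbreviation vol :: "'s set \<Rightarrow> ennreal" where "vol \<equiv> emeasure \<nu>"
abbreviation wvol :: "('s \<Rightarrow> ennreal) \<Rightarrow> 's set \<Rightarrow> ennreal" where "wvol V \<equiv> emeasure (density \<nu> V)"
abbreviation avg :: "'s \<Rightarrow> real \<Rightarrow> ('s \<Rightarrow> ennreal) \<Rightarrow> ennreal" where "avg x r \<equiv> average \<nu> (Bl x r)"

text \<open>K (1 + 2 K) is the dilation factor that \<open>engulf\<close> produces. It is rounded up
  to a power of two so that \<open>doubling_pow\<close> bounds the measure of a dilate and dyadic
  radii stay dyadic.\<close>

definition engulf_exp :: nat where "engulf_exp = (SOME n. K * (1 + 2 * K) \<le> 2 ^ n)"

lemma engulf_exp: "K * (1 + 2 * K) \<le> 2 ^ engulf_exp"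
proof -
  obtain n :: nat where "K * (1 + 2 * K) < 2 ^ n"
    using real_arch_pow[of 2 "K * (1 + 2 * K)"] by auto
  then show ?thesis unfolding engulf_exp_def by (intro someI_ex[of "\<lambda>n. K * (1 + 2 * K) \<le> 2 ^ n"] exI[of _ n]) simp
qed

lemma Bl_iff: "y \<in> Bl x r \<longleftrightarrow> y \<in> \<S> \<and> d x y < r"
  by (auto simp: qball_def)

lemma center_Bl: "x \<in> \<S> \<Longrightarrow> 0 < r \<Longrightarrow> x \<in> Bl x r"
  by (simp add: Bl_iff d_refl)

lemma Bl_mono: "r \<le> s \<Longrightarrow> Bl x r \<subseteq> Bl x s"
  by (auto simp: Bl_iff)

lemma Bl_qballs: "x \<in> \<S> \<Longrightarrow> 0 < r \<Longrightarrow> Bl x r \<in> qballs d \<nu>"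
  unfolding qballs_def by blast

text \<open>Chain the quasi-triangle inequality through a common point u of the two balls: u is
  within 2 K s of every point of the smaller ball and within s of y. The resulting factor replaces
  the 3 of the metric case.\<close>

lemma engulf:
  assumes x: "x \<in> \<S>" and y: "y \<in> \<S>" and meet: "Bl x r \<inter> Bl y s \<noteq> {}" and "r \<le> s"
  shows "Bl x r \<subseteq> Bl y (2 ^ engulf_exp * s)"
proof
  fix z assume z: "z \<in> Bl x r"
  obtain u where u: "u \<in> Bl x r" "u \<in> Bl y s" using meet by blast
  have zs: "z \<in> \<S>" and us: "u \<in> \<S>" using z u by (auto simp: Bl_iff)
  have s: "0 < s" using u(2) d_nonneg[OF y us] by (auto simp: Bl_iff)
  have "d u z \<le> K * (d u x + d x z)" using d_tri us x zs by blast
  also have "\<dots> \<le> K * (2 * s)"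
    using K_ge_1 z u d_sym[OF us x] \<open>r \<le> s\<close> by (intro mult_left_mono) (auto simp: Bl_iff)
  finally have uz: "d u z \<le> K * (2 * s)" .
  have "d y z \<le> K * (d y u + d u z)" using d_tri us y zs by blast
  also have "\<dots> < K * (s + K * (2 * s))"
    using K_ge_1 u uz by (intro mult_strict_left_mono) (auto simp: Bl_iff)
  also have "\<dots> = K * (1 + 2 * K) * s" by (simp add: algebra_simps)
  also have "\<dots> \<le> 2 ^ engulf_exp * s" using engulf_exp s by (intro mult_right_mono) auto
  finally show "z \<in> Bl y (2 ^ engulf_exp * s)" using zs by (simp add: Bl_iff)
qed

lemma doubling_pow:
  assumes "x \<in> \<S>" "0 < r"
  shows "vol (Bl x (2 ^ n * r)) \<le> ennreal (Cd ^ n) * vol (Bl x r)"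
proof (induction n)
  case (Suc n)
  have "vol (Bl x (2 ^ Suc n * r)) = vol (Bl x (2 * (2 ^ n * r)))"
    by (simp add: mult.assoc)
  also have "\<dots> \<le> ennreal Cd * vol (Bl x (2 ^ n * r))"
    using assms by (intro doubling) auto
  also have "\<dots> \<le> ennreal Cd * (ennreal (Cd ^ n) * vol (Bl x r))"
    using Suc by (intro mult_left_mono) auto
  also have "\<dots> = ennreal (Cd ^ Suc n) * vol (Bl x r)"
    using Cd_ge_1 by (simp add: ennreal_mult' mult.assoc)
  finally show ?case .
qed simp

text \<open>Greedy selection, written as an induction on subfamilies: keep a ball of largest radius,
  discard every ball that meets it, and recurse on the rest.\<close>

lemma finite_Vitali:
  assumes "finite P" "P \<subseteq> \<S> \<times> {0<..}"
  shows "\<exists>P'\<subseteq>P. disjoint_family_on (\<lambda>(x, r). Bl x r) P' \<and>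
     (\<forall>(x, r)\<in>P. \<exists>(y, s)\<in>P'. r \<le> s \<and> Bl x r \<inter> Bl y s \<noteq> {})"
  using assms
proof (induction P rule: finite_psubset_induct)
  case (psubset P)
  show ?case
  proof (cases "P = {}")
    case False
    have "Max (snd ` P) \<in> snd ` P" using psubset False by (intro Max_in) auto
    then obtain p where p: "p \<in> P" "snd p = Max (snd ` P)" by auto
    then obtain x0 r0 where [simp]: "p = (x0, r0)" by (cases p)
    have max: "r \<le> r0" if "(x, r) \<in> P" for x r
    proof -
      have "r \<in> snd ` P" using that by force
      then have "r \<le> Max (snd ` P)" using psubset(1) by (intro Max_ge) auto
      then show ?thesis using p by simp
    qed
    define R where "R = {(x, r) \<in> P. Bl x r \<inter> Bl x0 r0 = {}}"
    have "Bl x0 r0 \<noteq> {}" using center_Bl[of x0 r0] p psubset.prems by auto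
    then have "R \<subset> P" using p unfolding R_def by auto
    moreover have "R \<subseteq> \<S> \<times> {0<..}" using psubset.prems R_def by auto
    ultimately obtain P' where P': "P' \<subseteq> R" "disjoint_family_on (\<lambda>(x, r). Bl x r) P'"
      "\<forall>(x, r)\<in>R. \<exists>(y, s)\<in>P'. r \<le> s \<and> Bl x r \<inter> Bl y s \<noteq> {}"
      using psubset.IH by meson
    have "disjoint_family_on (\<lambda>(x, r). Bl x r) (insert p P')"
      using P'(1,2) unfolding disjoint_family_on_def R_def by fastforce
    moreover have "\<exists>(y, s)\<in>insert p P'. r \<le> s \<and> Bl x r \<inter> Bl y s \<noteq> {}" if "(x, r) \<in> P" for x r
    proof (cases "(x, r) \<in> R")
      case True then show ?thesis using P'(3) by blast
    next
      case False
      then have "Bl x r \<inter> Bl x0 r0 \<noteq> {}" using that by (auto simp: R_def)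
      then show ?thesis using max[OF that] by auto
    qed
    moreover have "insert p P' \<subseteq> P" using p P' by (auto simp: R_def)
    ultimately show ?thesis by (intro exI[of _ "insert p P'"]) auto
  qed (simp add: disjoint_family_on_def)
qed

text \<open>The hypothesis charges the M-measure of a dilate to the M'-measure of the original ball,
  and the disjointness of the selected balls lets these charges add up. Finite subfamilies come
  first, since they have a largest radius; continuity from below gives the countable union.\<close>

lemma Vitali_measure:
  assumes P: "countable P" "P \<subseteq> \<S> \<times> {0<..}"
    and sM: "sets M = sets \<nu>" and sM': "sets M' = sets \<nu>"
    and le: "\<And>x r. (x, r) \<in> P \<Longrightarrow> emeasure M (Bl x (2 ^ engulf_exp * r)) \<le> C * emeasure M' (Bl x r)"
  shows "emeasure M (\<Union>(x, r)\<in>P. Bl x r) \<le> C * emeasure M' (\<Union>(x, r)\<in>P. Bl x r)"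
proof -
  define f where "f = (\<lambda>(x, r). Bl x r)"
  have fs: "f p \<in> sets \<nu>" if "p \<in> P" for p
    using that P(2) ball_sets by (auto simp: f_def)
  have US: "(\<Union>p\<in>P. f p) \<in> sets \<nu>" using fs P by (intro sets.countable_UN'') auto
  have fin: "emeasure M (\<Union>p\<in>F. f p) \<le> C * emeasure M' (\<Union>p\<in>P. f p)" if F: "finite F" "F \<subseteq> P" for F
  proof -
    obtain P' where P': "P' \<subseteq> F" "disjoint_family_on f P'"
      "\<forall>(x, r)\<in>F. \<exists>(y, s)\<in>P'. r \<le> s \<and> Bl x r \<inter> Bl y s \<noteq> {}"
      using finite_Vitali[of F] F P(2) unfolding f_def by fastforce
    have finP': "finite P'" using P' F finite_subset by blast
    have star: "Bl (fst p) (2 ^ engulf_exp * snd p) \<in> sets \<nu>" if "p \<in> P'" for p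
    proof -
      have "p \<in> \<S> \<times> {0<..}" using that P' F P(2) by blast
      then show ?thesis by (intro ball_sets) auto
    qed
    have cover: "(\<Union>p\<in>F. f p) \<subseteq> (\<Union>p\<in>P'. Bl (fst p) (2 ^ engulf_exp * snd p))"
    proof
      fix z assume "z \<in> (\<Union>p\<in>F. f p)"
      then obtain x r where xr: "(x, r) \<in> F" "z \<in> Bl x r" by (auto simp: f_def)
      then obtain y s where ys: "(y, s) \<in> P'" "r \<le> s" "Bl x r \<inter> Bl y s \<noteq> {}" using P'(3) by blast
      have "Bl x r \<subseteq> Bl y (2 ^ engulf_exp * s)"
        using ys xr P' F P(2) by (intro engulf) auto
      then show "z \<in> (\<Union>p\<in>P'. Bl (fst p) (2 ^ engulf_exp * snd p))" using xr ys by force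
    qed
    have "emeasure M (\<Union>p\<in>F. f p) \<le> emeasure M (\<Union>p\<in>P'. Bl (fst p) (2 ^ engulf_exp * snd p))"
      using cover star finP' sM by (intro emeasure_mono) auto
    also have "\<dots> \<le> (\<Sum>p\<in>P'. emeasure M (Bl (fst p) (2 ^ engulf_exp * snd p)))"
      using star finP' sM by (intro emeasure_subadditive_finite) auto
    also have "\<dots> \<le> (\<Sum>p\<in>P'. C * emeasure M' (f p))"
      using P' F by (intro sum_mono) (auto simp: f_def split: prod.splits intro!: le)
    also have "\<dots> = C * (\<Sum>p\<in>P'. emeasure M' (f p))" by (simp add: sum_distrib_left)
    also have "(\<Sum>p\<in>P'. emeasure M' (f p)) = emeasure M' (\<Union>p\<in>P'. f p)"
      using fs P' F sM' finP' by (intro sum_emeasure) auto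
    also have "\<dots> \<le> emeasure M' (\<Union>p\<in>P. f p)"
      using P' F US sM' by (intro emeasure_mono) auto
    finally show ?thesis by (simp add: mult_left_mono)
  qed
  have "emeasure M (\<Union>p\<in>P. f p) \<le> C * emeasure M' (\<Union>p\<in>P. f p)"
  proof (cases "P = {}")
    case False
    define A where "A n = (\<Union>i\<le>n. f (from_nat_into P i))" for n
    have rng: "range (from_nat_into P) = P" using False P by (simp add: range_from_nat_into)
    have "(\<Union>p\<in>P. f p) = (\<Union>n. A n)" by (subst rng[symmetric]) (auto simp: A_def)
    also have "emeasure M \<dots> = (SUP n. emeasure M (A n))"
    proof (rule SUP_emeasure_incseq[symmetric])
      have "from_nat_into P i \<in> P" for i using rng by blast
      then show "range A \<subseteq> sets M" unfolding A_def sM by (blast intro: fs sets.finite_UN)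
      show "incseq A" unfolding incseq_def A_def by (auto intro: order_trans)
    qed
    also have "\<dots> \<le> C * emeasure M' (\<Union>p\<in>P. f p)"
    proof (intro SUP_least)
      fix n
      have "A n = (\<Union>p\<in>from_nat_into P ` {..n}. f p)" by (simp add: A_def)
      also have "emeasure M \<dots> \<le> C * emeasure M' (\<Union>p\<in>P. f p)" using rng by (intro fin) auto
      finally show "emeasure M (A n) \<le> C * emeasure M' (\<Union>p\<in>P. f p)" .
    qed
    finally show ?thesis .
  qed simp
  then show ?thesis by (simp add: f_def)
qed

section \<open>Sigma-finiteness and separability\<close>

lemma Bl_exhaust:
  assumes "x0 \<in> \<S>"
  shows "(\<Union>n. Bl x0 (real (Suc n))) = \<S>"
proof -
  have "\<exists>n. d x0 x < real (Suc n)" for x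
    using reals_Archimedean2[of "d x0 x"] by (metis less_trans lessI of_nat_less_iff)
  then show ?thesis by (auto simp: Bl_iff)
qed

lemma sigma_finite_nu: "sigma_finite_measure \<nu>"
proof (cases "\<S> = {}")
  case True
  then show ?thesis by (intro sigma_finite_measure.intro exI[of _ "{}"]) auto
next
  case False
  then obtain x0 where x0: "x0 \<in> \<S>" by blast
  show ?thesis
    using Bl_exhaust[OF x0] ball_sets[OF x0] ball_finite[OF x0]
    by (intro sigma_finite_measure.intro exI[of _ "range (\<lambda>n. Bl x0 (real (Suc n)))"])
      (auto simp: less_top[symmetric])
qed

text \<open>A packing argument: small balls about separated points are disjoint and lie in one fixed
  ball, and by doubling each of them carries a fixed fraction of its measure.\<close>

lemma separated_card_bound:
  assumes x0: "x0 \<in> \<S>" and "0 < R" "0 < r"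
  shows "\<exists>b::nat. \<forall>T\<subseteq>Bl x0 R. finite T \<longrightarrow> (\<forall>x\<in>T. \<forall>y\<in>T. x \<noteq> y \<longrightarrow> r \<le> d x y) \<longrightarrow> card T \<le> b"
proof -
  \<comment> \<open>2 K q <= r makes the q-balls about r-separated points disjoint; q <= R lets a
    dilate of \<open>Bl x0 R\<close> engulf them.\<close>
  define q where "q = min R (r / (2 * K))"
  have q: "0 < q" "q \<le> R" "2 * K * q \<le> r" using assms K_ge_1 by (auto simp: q_def min_def field_simps)
  \<comment> \<open>After j doublings the radius q exceeds 2 ^ \<open>engulf_exp\<close> * R, so the
    ball about each point then contains \<open>Bl x0 R\<close>.\<close>
  obtain j :: nat where j: "2 ^ engulf_exp * R / q < 2 ^ j" using real_arch_pow[of 2] by auto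
  define m where "m = measure \<nu> (Bl x0 R)"
  define m' where "m' = measure \<nu> (Bl x0 (2 ^ engulf_exp * R))"
  have m: "ennreal m = vol (Bl x0 R)"
    using ball_finite[OF x0, of R] assms by (simp add: m_def emeasure_eq_ennreal_measure less_top)
  have m': "ennreal m' = vol (Bl x0 (2 ^ engulf_exp * R))"
    using ball_finite[OF x0, of "2^engulf_exp * R"] assms by (simp add: m'_def emeasure_eq_ennreal_measure less_top)
  have mpos: "0 < m" using m ball_pos[OF x0, of R] assms
    by (metis ennreal_eq_0_iff linorder_not_less order_less_irrefl)
  have m'nn: "0 \<le> m'" by (simp add: m'_def)
  have main: "real (card T) \<le> Cd ^ j * m' / m"
    if T: "T \<subseteq> Bl x0 R" "finite T" "\<forall>x\<in>T. \<forall>y\<in>T. x \<noteq> y \<longrightarrow> r \<le> d x y" for T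
  proof -
    have Ts: "x \<in> \<S>" "d x0 x < R" if "x \<in> T" for x using that T by (auto simp: Bl_iff)
    have disj: "disjoint_family_on (\<lambda>x. Bl x q) T"
      unfolding disjoint_family_on_def
    proof (intro ballI impI)
      fix x y assume xy: "x \<in> T" "y \<in> T" "x \<noteq> y"
      show "Bl x q \<inter> Bl y q = {}"
      proof (rule ccontr)
        assume "Bl x q \<inter> Bl y q \<noteq> {}"
        then obtain z where z: "z \<in> \<S>" "d x z < q" "d y z < q" by (auto simp: Bl_iff)
        have "d x y \<le> K * (d x z + d z y)" using d_tri Ts xy z by blast
        also have "\<dots> < K * (q + q)" using K_ge_1 z d_sym[of z y] Ts xy by (intro mult_strict_left_mono) auto
        also have "\<dots> \<le> r" using q by simp
        finally show False using T(3) xy by fastforce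
      qed
    qed
    have sub: "Bl x q \<subseteq> Bl x0 (2 ^ engulf_exp * R)" if "x \<in> T" for x
    proof (rule engulf)
      have "x \<in> Bl x q \<inter> Bl x0 R" using Ts[OF that] q d_refl[of x] by (auto simp: Bl_iff)
      then show "Bl x q \<inter> Bl x0 R \<noteq> {}" by blast
    qed (use Ts[OF that] x0 q in auto)
    have low: "ennreal m \<le> ennreal (Cd ^ j) * vol (Bl x q)" if x: "x \<in> T" for x
    proof -
      have "Bl x0 R \<subseteq> Bl x (2 ^ engulf_exp * R)"
      proof (rule engulf)
        have "x \<in> Bl x0 R \<inter> Bl x R" using Ts[OF x] assms d_refl[of x] by (auto simp: Bl_iff)
        then show "Bl x0 R \<inter> Bl x R \<noteq> {}" by blast
      qed (use Ts[OF x] x0 in auto)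
      also have "\<dots> \<subseteq> Bl x (2 ^ j * q)" using j q by (intro Bl_mono) (simp add: field_simps)
      finally have "vol (Bl x0 R) \<le> vol (Bl x (2 ^ j * q))"
        using Ts[OF x] q by (intro emeasure_mono ball_sets) auto
      then show ?thesis using doubling_pow[of x q j] Ts[OF x] q m by auto
    qed
    have "ennreal (real (card T) * m) = (\<Sum>x\<in>T. ennreal m)"
      using mpos by (simp add: ennreal_mult ennreal_of_nat_eq_real_of_nat)
    also have "\<dots> \<le> (\<Sum>x\<in>T. ennreal (Cd ^ j) * vol (Bl x q))" using low by (intro sum_mono)
    also have "\<dots> = ennreal (Cd ^ j) * (\<Sum>x\<in>T. vol (Bl x q))" by (simp add: sum_distrib_left)
    also have "(\<Sum>x\<in>T. vol (Bl x q)) = vol (\<Union>x\<in>T. Bl x q)"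
      using T disj Ts q ball_sets by (intro sum_emeasure) auto
    also have "\<dots> \<le> ennreal m'"
      unfolding m' using sub x0 assms by (intro emeasure_mono ball_sets) auto
    finally have "ennreal (real (card T) * m) \<le> ennreal (Cd ^ j * m')"
      using Cd_ge_1 m'nn by (simp add: ennreal_mult mult_left_mono)
    then show ?thesis using mpos m'nn Cd_ge_1 by (simp add: field_simps)
  qed
  show ?thesis
  proof (intro exI[of _ "nat \<lceil>Cd ^ j * m' / m\<rceil>"] allI impI)
    fix T assume "T \<subseteq> Bl x0 R" "finite T" "\<forall>x\<in>T. \<forall>y\<in>T. x \<noteq> y \<longrightarrow> r \<le> d x y"
    then have "real (card T) \<le> Cd ^ j * m' / m" by (rule main)
    then show "card T \<le> nat \<lceil>Cd ^ j * m' / m\<rceil>" by linarith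
  qed
qed

text \<open>A separated set of maximal cardinality is a net, since a point far from it could be
  added; the packing bound makes the maximum exist.\<close>

lemma finite_net:
  assumes x0: "x0 \<in> \<S>" and "0 < R" "0 < r"
  shows "\<exists>T\<subseteq>Bl x0 R. finite T \<and> (\<forall>x\<in>Bl x0 R. \<exists>y\<in>T. d x y < r)"
proof -
  define good where "good = {T. T \<subseteq> Bl x0 R \<and> finite T \<and> (\<forall>x\<in>T. \<forall>y\<in>T. x \<noteq> y \<longrightarrow> r \<le> d x y)}"
  obtain b :: nat where "\<forall>T\<subseteq>Bl x0 R. finite T \<longrightarrow> (\<forall>x\<in>T. \<forall>y\<in>T. x \<noteq> y \<longrightarrow> r \<le> d x y) \<longrightarrow> card T \<le> b"
    using separated_card_bound[OF assms] by (elim exE)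
  then have b: "\<forall>T\<in>good. card T \<le> b" by (simp add: good_def)
  have "{} \<in> good" by (simp add: good_def)
  then obtain T where T: "T \<in> good" "\<forall>T'\<in>good. card T' \<le> card T"
    using ex_has_greatest_nat[of "\<lambda>T. T \<in> good" "{}" card "Suc b"] b by (auto simp: less_Suc_eq_le)
  have "\<exists>y\<in>T. d x y < r" if x: "x \<in> Bl x0 R" for x
  proof (rule ccontr)
    assume "\<not> (\<exists>y\<in>T. d x y < r)"
    then have far: "\<forall>y\<in>T. r \<le> d x y" by auto
    have "x \<notin> T" using far d_refl[of x] x \<open>0 < r\<close> by (auto simp: Bl_iff)
    moreover have "insert x T \<in> good"
    proof -
      have "r \<le> d y x" if "y \<in> T" for y
      proof -
        have "y \<in> \<S>" using that T(1) by (auto simp: good_def Bl_iff)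
        then show ?thesis using far that d_sym[of x y] x by (auto simp: Bl_iff)
      qed
      then show ?thesis using T(1) far x by (auto simp: good_def)
    qed
    ultimately have "card (insert x T) \<le> card T" using T by blast
    then show False using \<open>x \<notin> T\<close> T(1) by (simp add: good_def)
  qed
  then show ?thesis using T(1) by (auto simp: good_def)
qed

lemma countable_dense:
  "\<exists>D. countable D \<and> D \<subseteq> \<S> \<and> (\<forall>x\<in>\<S>. \<forall>r>0. \<exists>y\<in>D. d x y < r)"
proof (cases "\<S> = {}")
  case False
  then obtain x0 where x0: "x0 \<in> \<S>" by blast
  have "\<forall>n m::nat. \<exists>T\<subseteq>Bl x0 (Suc n). finite T \<and> (\<forall>x\<in>Bl x0 (Suc n). \<exists>y\<in>T. d x y < 1 / Suc m)"
    using finite_net[OF x0] by simp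
  then obtain T where T: "\<And>n m. T n m \<subseteq> Bl x0 (Suc n)" "\<And>n m. finite (T n m)"
    "\<And>n m x. x \<in> Bl x0 (Suc n) \<Longrightarrow> \<exists>y\<in>T n m. d x y < 1 / Suc m"
    by metis
  have near: "\<exists>y\<in>(\<Union>n m. T n m). d x y < r" if "x \<in> \<S>" "0 < r" for x r
  proof -
    have "x \<in> (\<Union>n. Bl x0 (Suc n))" unfolding Bl_exhaust[OF x0] by fact
    then obtain n where n: "x \<in> Bl x0 (Suc n)" by (elim UN_E)
    obtain m where m: "1 / Suc m < r" using \<open>0 < r\<close> by (elim nat_approx_posE)
    obtain y where "y \<in> T n m" "d x y < 1 / Suc m" using T(3)[OF n, of m] by (elim bexE)
    then show ?thesis using m by (intro bexI[of _ y]) auto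
  qed
  have "countable (T n m)" for n m using T(2) by (rule countable_finite)
  then have cnt: "countable (\<Union>n m. T n m)" by blast
  have sub: "(\<Union>n m. T n m) \<subseteq> \<S>" using T(1) by (auto simp: Bl_iff subset_iff)
  show ?thesis
    by (intro exI[of _ "\<Union>n m. T n m"] conjI ballI allI impI cnt sub near)
qed auto

end


section \<open>Borel regularity and the density theorem\<close>

context doubling_space
begin

text \<open>Since balls need not be open, taking this interior is the way to obtain open sets from
  balls and from distance neighbourhoods.\<close>

definition qinterior :: "'s set \<Rightarrow> 's set" where
  "qinterior A = {x \<in> \<S>. \<exists>r>0. Bl x r \<subseteq> A}"

lemma Bl_subset_Bl:
  assumes "x \<in> \<S>" "y \<in> Bl x r" "K * (r + s) \<le> t"
  shows "Bl y s \<subseteq> Bl x t"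
proof
  fix z assume z: "z \<in> Bl y s"
  have "d x z \<le> K * (d x y + d y z)" using d_tri assms z by (auto simp: Bl_iff)
  also have "\<dots> < K * (r + s)"
    using K_ge_1 assms z by (intro mult_strict_left_mono add_strict_mono) (auto simp: Bl_iff)
  finally show "z \<in> Bl x t" using assms z by (auto simp: Bl_iff)
qed

text \<open>This uses the quasi-triangle inequality: if \<open>Bl x r\<close> lies in A and s = r /
  (2 K), then the s-balls about all points of \<open>Bl x s\<close> still lie in
  \<open>Bl x r\<close>.\<close>

lemma qinterior_qopens: "qinterior A \<in> opens"
proof -
  have "\<exists>r>0. Bl x r \<subseteq> qinterior A" if x: "x \<in> qinterior A" for x
  proof -
    obtain r where r: "0 < r" "Bl x r \<subseteq> A" and xs: "x \<in> \<S>"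
      using x by (auto simp: qinterior_def)
    define s where "s = r / (2 * K)"
    have s: "0 < s" "K * (s + s) \<le> r" using r K_ge_1 by (auto simp: s_def field_simps)
    have "y \<in> qinterior A" if y: "y \<in> Bl x s" for y
    proof -
      have "Bl y s \<subseteq> A" using Bl_subset_Bl[OF xs y s(2)] r(2) by (rule subset_trans)
      then show ?thesis using y s(1) by (auto simp: qinterior_def Bl_iff)
    qed
    then show ?thesis using s(1) by (intro exI[of _ s]) auto
  qed
  then show ?thesis by (simp add: qopens_def qinterior_def)
qed

lemma qinterior_subset: "qinterior A \<subseteq> A"
  using center_Bl by (fastforce simp: qinterior_def)

lemma qopensD:
  assumes "U \<in> opens" "x \<in> U"
  obtains r where "0 < r" "Bl x r \<subseteq> U"
proof -
  have "\<exists>r>0. Bl x r \<subseteq> U" using assms by (simp add: qopens_def)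
  then show thesis using that by blast
qed

lemma qopens_subset: "U \<in> opens \<Longrightarrow> U \<subseteq> \<S>"
  by (simp add: qopens_def)

lemma qclosed_sets:
  assumes "\<S> - F \<in> opens" "F \<subseteq> \<S>"
  shows "F \<in> sets \<nu>"
proof -
  have "\<S> - (\<S> - F) \<in> sets \<nu>" using assms qopens_sets by blast
  then show ?thesis using assms(2) by (simp add: double_diff)
qed

lemma qopens_UN:
  assumes "\<And>i. i \<in> J \<Longrightarrow> U i \<in> opens"
  shows "(\<Union>i\<in>J. U i) \<in> opens"
proof -
  have "\<exists>r>0. Bl x r \<subseteq> (\<Union>i\<in>J. U i)" if i: "i \<in> J" "x \<in> U i" for x i
  proof -
    obtain r where "0 < r" "Bl x r \<subseteq> U i" using assms[OF i(1)] i(2) by (rule qopensD)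
    then show ?thesis using i(1) by blast
  qed
  moreover have "(\<Union>i\<in>J. U i) \<subseteq> \<S>" using assms qopens_subset by blast
  ultimately show ?thesis by (auto simp: qopens_def)
qed

lemma qopens_Int:
  assumes "U \<in> opens" "V \<in> opens"
  shows "U \<inter> V \<in> opens"
proof -
  have "\<exists>r>0. Bl x r \<subseteq> U \<inter> V" if x: "x \<in> U" "x \<in> V" for x
  proof -
    obtain r where r: "0 < r" "Bl x r \<subseteq> U" using assms(1) x(1) by (rule qopensD)
    obtain s where s: "0 < s" "Bl x s \<subseteq> V" using assms(2) x(2) by (rule qopensD)
    note rs = r s
    have "Bl x (min r s) \<subseteq> U \<inter> V"
      using rs(2,4) Bl_mono[of "min r s" r x] Bl_mono[of "min r s" s x] by auto
    then show ?thesis using rs by (intro exI[of _ "min r s"]) auto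
  qed
  then show ?thesis using assms by (auto simp: qopens_def)
qed

text \<open>The points at distance at least 1 / (n + 1) from the complement of U need not form a
  closed set, because d need not be continuous. Removing the interior of the neighbourhood of the
  complement repairs this, and that interior still contains the complement.\<close>

lemma closed_approximation:
  assumes U: "U \<in> opens"
  obtains F :: "nat \<Rightarrow> 's set" where "incseq F" "(\<Union>n. F n) = U" "\<And>n. \<S> - F n \<in> opens"
proof -
  define V where "V n = qinterior {x \<in> \<S>. \<exists>y\<in>\<S> - U. d x y < 1 / real (Suc n)}" for n
  have Us: "U \<subseteq> \<S>" using U by (auto simp: qopens_def)
  have sub: "\<S> - U \<subseteq> V n" for n
  proof
    fix y assume y: "y \<in> \<S> - U"
    have "Bl y (1 / real (Suc n)) \<subseteq> {x \<in> \<S>. \<exists>y\<in>\<S> - U. d x y < 1 / real (Suc n)}"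
    proof
      fix x assume x: "x \<in> Bl y (1 / real (Suc n))"
      then have "x \<in> \<S>" "d x y < 1 / real (Suc n)" using d_sym[of x y] y by (auto simp: Bl_iff)
      then show "x \<in> {x \<in> \<S>. \<exists>y\<in>\<S> - U. d x y < 1 / real (Suc n)}" using y by blast
    qed
    moreover have "0 < 1 / real (Suc n)" by simp
    ultimately show "y \<in> V n" using y unfolding V_def qinterior_def by blast
  qed
  have VS: "V n \<subseteq> \<S>" for n by (auto simp: V_def qinterior_def)
  have inc: "incseq (\<lambda>n. \<S> - V n)"
  proof (rule incseq_SucI)
    fix n
    have "1 / real (Suc (Suc n)) \<le> 1 / real (Suc n)" by (simp add: field_simps)
    then have "{x \<in> \<S>. \<exists>y\<in>\<S> - U. d x y < 1 / real (Suc (Suc n))}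
        \<subseteq> {x \<in> \<S>. \<exists>y\<in>\<S> - U. d x y < 1 / real (Suc n)}"
      by (fastforce intro: less_le_trans)
    then have "V (Suc n) \<subseteq> V n" unfolding V_def qinterior_def by (smt (verit) Collect_mono subset_trans)
    then show "\<S> - V n \<subseteq> \<S> - V (Suc n)" by blast
  qed
  have "x \<in> (\<Union>n. \<S> - V n)" if x: "x \<in> U" for x
  proof -
    obtain r where r: "0 < r" "Bl x r \<subseteq> U" using U x by (rule qopensD)
    obtain n where n: "1 / real (Suc n) < r" using r(1) by (elim nat_approx_posE)
    have "x \<notin> V n"
    proof
      assume "x \<in> V n"
      then have "x \<in> {x \<in> \<S>. \<exists>y\<in>\<S> - U. d x y < 1 / real (Suc n)}"
        unfolding V_def using qinterior_subset by blast
      then obtain y where "y \<in> \<S> - U" "d x y < 1 / real (Suc n)" by blast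
      then have "y \<in> Bl x r" using n by (auto simp: Bl_iff)
      then show False using r \<open>y \<in> \<S> - U\<close> by blast
    qed
    then show ?thesis using x Us by blast
  qed
  then have "(\<Union>n. \<S> - V n) = U" using sub by blast
  moreover have "\<S> - (\<S> - V n) \<in> opens" for n
    using VS[of n] qinterior_qopens by (simp add: double_diff V_def)
  ultimately show thesis using inc that[of "\<lambda>n. \<S> - V n"] by blast
qed

lemma space_qopens: "\<S> \<in> opens"
  by (auto simp: qopens_def Bl_iff intro!: exI[of _ 1])

text \<open>Approximation from both sides is the form that survives complements, where the open and
  the closed set exchange roles. For an open set the inner approximation comes from
  \<open>closed_approximation\<close> and continuity of the finite measure.\<close>

lemma borel_two_sided_regular:
  assumes m: "finite_measure m" and sm: "sets m = sets \<nu>"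
    and B: "B \<in> sigma_sets (\<S>) (opens)" and "0 < (e::real)"
  shows "\<exists>U\<in>opens. \<exists>F. \<S> - F \<in> opens \<and> F \<subseteq> B \<and> B \<subseteq> U \<and> F \<subseteq> \<S> \<and>
           measure m (U - F) \<le> e"
  using B \<open>0 < e\<close>
proof (induction B arbitrary: e rule: sigma_sets.induct)
  case (Basic U)
  interpret m: finite_measure m by (rule m)
  obtain F :: "nat \<Rightarrow> 's set" where F: "incseq F" "(\<Union>n. F n) = U" "\<And>n. \<S> - F n \<in> opens"
    using closed_approximation Basic by blast
  have Us: "U \<subseteq> \<S>" using Basic by (auto simp: qopens_def)
  have Fs: "F n \<subseteq> \<S>" for n using F(2) Us by blast
  have Fm: "F n \<in> sets m" for n unfolding sm using F(3) Fs by (rule qclosed_sets)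
  have "(\<lambda>n. measure m (F n)) \<longlonglongrightarrow> measure m (\<Union>n. F n)"
    using Fm F(1) by (intro m.finite_Lim_measure_incseq) auto
  then have "\<forall>\<^sub>F n in sequentially. measure m U - e < measure m (F n)"
    using F(2) Basic(2) by (intro order_tendstoD) auto
  then obtain n where n: "measure m U - e < measure m (F n)"
    by (auto simp: eventually_sequentially)
  have Um: "U \<in> sets m" using Basic(1) qopens_sets sm by blast
  have "measure m (U - F n) = measure m U - measure m (F n)"
    using Fm Um F(2) by (intro m.finite_measure_Diff) auto
  then have "measure m (U - F n) \<le> e" using n by simp
  moreover have "F n \<subseteq> U" using F(2) by blast
  ultimately show ?case using F(3)[of n] Fs[of n] Basic by blast
next
  case Empty
  have "{} \<in> opens" by (auto simp: qopens_def)
  then show ?case using space_qopens Empty by (intro bexI[of _ "{}"] exI[of _ "{}"]) auto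
next
  case (Compl B)
  obtain U F where UF: "U \<in> opens" "\<S> - F \<in> opens" "F \<subseteq> B" "B \<subseteq> U"
    "F \<subseteq> \<S>" "measure m (U - F) \<le> e"
    using Compl.IH[OF Compl.prems] by blast
  have "U \<subseteq> \<S>" using UF(1) by (auto simp: qopens_def)
  then have "(\<S> - F) - (\<S> - U) = U - F" "\<S> - (\<S> - U) = U" by blast+
  then show ?case
    using UF by (intro bexI[of _ "\<S> - F"] exI[of _ "\<S> - U"] conjI) auto
next
  case (Union B)
  interpret m: finite_measure m by (rule m)
  \<comment> \<open>These errors sum to e / 2. The other half pays for replacing the countable union
    of closed sets, which need not be closed, by a finite one.\<close>
  define \<delta> where "\<delta> i = e / 2 * (1 / 2) ^ Suc i" for i
  have \<delta>: "0 < \<delta> i" for i using Union.prems by (simp add: \<delta>_def)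
  have "\<forall>i. \<exists>U F. U \<in> opens \<and> \<S> - F \<in> opens \<and> F \<subseteq> B i \<and> B i \<subseteq> U \<and>
    F \<subseteq> \<S> \<and> measure m (U - F) \<le> \<delta> i"
    using Union.IH[OF \<delta>] by blast
  then obtain U F where UF: "\<And>i. U i \<in> opens" "\<And>i. \<S> - F i \<in> opens"
    "\<And>i. F i \<subseteq> B i" "\<And>i. B i \<subseteq> U i" "\<And>i. F i \<subseteq> \<S>" "\<And>i. measure m (U i - F i) \<le> \<delta> i"
    by metis
  have Um: "U i \<in> sets m" for i using UF(1) qopens_sets sm by blast
  have Fm: "F i \<in> sets m" for i unfolding sm using UF(2,5) by (rule qclosed_sets)
  have \<delta>_sums: "\<delta> sums (e / 2)"
    using sums_mult[OF power_half_series, of "e / 2"] by (simp add: \<delta>_def[abs_def])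
  have "measure m ((\<Union>i. U i) - (\<Union>i. F i)) \<le> measure m (\<Union>i. U i - F i)"
    using Um Fm by (intro m.finite_measure_mono) auto
  also have "\<dots> \<le> (\<Sum>i. measure m (U i - F i))"
    using Um Fm UF(6) \<delta>_sums
    by (intro m.finite_measure_subadditive_countably) (auto intro!: summable_comparison_test'[OF sums_summable[OF \<delta>_sums]])
  also have "\<dots> \<le> e / 2"
    using UF(6) \<delta>_sums
    by (subst sums_unique[OF \<delta>_sums], intro suminf_le)
       (auto simp: sums_iff intro!: summable_comparison_test'[OF sums_summable[OF \<delta>_sums]])
  finally have half: "measure m ((\<Union>i. U i) - (\<Union>i. F i)) \<le> e / 2" .
  define G where "G n = (\<Union>i\<le>n. F i)" for n
  have Gm: "G n \<in> sets m" for n using Fm by (auto simp: G_def)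
  have UUm: "(\<Union>i. U i) \<in> sets m" using Um by auto
  have UG: "(\<Union>n. G n) = (\<Union>i. F i)" by (auto simp: G_def)
  have "(\<lambda>n. measure m (G n)) \<longlonglongrightarrow> measure m (\<Union>n. G n)"
    using Gm by (intro m.finite_Lim_measure_incseq) (auto simp: incseq_def G_def intro: order_trans)
  then have "\<forall>\<^sub>F n in sequentially. measure m (\<Union>n. G n) - e / 2 < measure m (G n)"
    using Union.prems by (intro order_tendstoD) auto
  then obtain n where n: "measure m (\<Union>i. F i) - e / 2 < measure m (G n)"
    unfolding UG by (auto simp: eventually_sequentially)
  have FU: "(\<Union>i. F i) \<subseteq> (\<Union>i. U i)" using UF(3,4) by blast
  have "measure m ((\<Union>i. U i) - G n) = measure m (\<Union>i. U i) - measure m (G n)"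
  proof (intro m.finite_measure_Diff Gm UUm)
    have "G n \<subseteq> (\<Union>i. F i)" by (auto simp: G_def)
    then show "G n \<subseteq> (\<Union>i. U i)" using FU by (rule subset_trans)
  qed
  also have "\<dots> \<le> measure m (\<Union>i. U i) - measure m (\<Union>i. F i) + e / 2" using n by simp
  also have "\<dots> = measure m ((\<Union>i. U i) - (\<Union>i. F i)) + e / 2"
    using Fm UUm FU by (subst m.finite_measure_Diff) auto
  also have "\<dots> \<le> e" using half by simp
  finally have small: "measure m ((\<Union>i. U i) - G n) \<le> e" .
  have "(\<Inter>i\<in>{..n}. \<S> - F i) \<in> opens"
  proof (induction n)
    case (Suc n)
    then show ?case using qopens_Int[OF UF(2)[of "Suc n"] Suc] by (simp add: atMost_Suc)
  qed (use UF(2) in simp)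
  moreover have "\<S> - G n = (\<Inter>i\<in>{..n}. \<S> - F i)" by (auto simp: G_def)
  ultimately have c: "\<S> - G n \<in> opens" by simp
  have "G n \<subseteq> (\<Union>i. B i)" "(\<Union>i. B i) \<subseteq> (\<Union>i. U i)" "G n \<subseteq> \<S>"
    using UF(3,4,5) unfolding G_def by blast+
  moreover have "(\<Union>i. U i) \<in> opens" using UF(1) by (rule qopens_UN)
  ultimately show ?case using c small by blast
qed

text \<open>Restricting \<nu> to an open V of finite measure makes two-sided regularity applicable;
  \<open>borel_regular\<close> first replaces G by a Borel set of the same measure.\<close>

lemma outer_regular:
  assumes G: "G \<in> sets \<nu>" "G \<subseteq> Bl x0 R" and x0: "x0 \<in> \<S>" and "0 < R" "0 < (e::real)"
  shows "\<exists>U\<in>opens. G \<subseteq> U \<and> vol U \<le> vol G + ennreal e"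
proof -
  \<comment> \<open>The interior of the enlarged ball is open, has finite measure and still contains
    \<open>Bl x0 R\<close>.\<close>
  define V where "V = qinterior (Bl x0 (K * (R + R)))"
  have V: "V \<in> opens" unfolding V_def by (rule qinterior_qopens)
  then have Vs: "V \<in> sets \<nu>" using qopens_sets by blast
  have "Bl x0 R \<subseteq> V"
  proof
    fix y assume y: "y \<in> Bl x0 R"
    have "Bl y R \<subseteq> Bl x0 (K * (R + R))" using x0 y by (rule Bl_subset_Bl) simp
    then show "y \<in> V" using y \<open>0 < R\<close> by (auto simp: V_def qinterior_def Bl_iff)
  qed
  then have GV: "G \<subseteq> V" using G by blast
  have "vol V \<le> vol (Bl x0 (K * (R + R)))"
    using x0 \<open>0 < R\<close> K_ge_1 unfolding V_def by (intro emeasure_mono qinterior_subset ball_sets) auto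
  also have "\<dots> < \<infinity>" using x0 \<open>0 < R\<close> K_ge_1 by (intro ball_finite) auto
  finally have Vfin: "vol V < \<infinity>" .
  define m where "m = density \<nu> (indicator V)"
  have sm: "sets m = sets \<nu>" by (simp add: m_def)
  have em: "emeasure m A = vol (V \<inter> A)" if "A \<in> sets \<nu>" for A
    using that Vs unfolding m_def by (simp add: emeasure_density indicator_inter_arith[symmetric])
  have "finite_measure m"
    using Vfin Vs em[of "\<S>"] by (intro finite_measureI) (simp add: m_def Int_absorb2 sets.sets_into_space less_top)
  then interpret m: finite_measure m .
  obtain B where B: "B \<in> sigma_sets (\<S>) (opens)" "G \<subseteq> B" "vol B = vol G"
    using borel_regular[OF G(1)] by blast
  obtain U F where UF: "U \<in> opens" "\<S> - F \<in> opens" "F \<subseteq> B" "B \<subseteq> U"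
    "F \<subseteq> \<S>" "measure m (U - F) \<le> e"
    using borel_two_sided_regular[OF \<open>finite_measure m\<close> sm B(1) \<open>0 < e\<close>] by blast
  have Us: "U \<in> sets \<nu>" using UF(1) qopens_sets by blast
  have Fs: "F \<in> sets \<nu>" using UF(2,5) by (rule qclosed_sets)
  have Bs: "B \<in> sets \<nu>" using B(1) qopens_sets sets.sigma_sets_subset by blast
  have "vol (U \<inter> V) = emeasure m U" using em[OF Us] by (simp add: Int_commute)
  also have "\<dots> \<le> emeasure m (B \<union> (U - F))"
    using Bs Us Fs UF(3,4) sm by (intro emeasure_mono) auto
  also have "\<dots> \<le> emeasure m B + emeasure m (U - F)"
    using Bs Us Fs sm by (intro emeasure_subadditive) auto
  also have "\<dots> \<le> vol B + ennreal e"
  proof (intro add_mono)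
    show "emeasure m B \<le> vol B" using em[OF Bs] Bs by (auto intro!: emeasure_mono)
    show "emeasure m (U - F) \<le> ennreal e"
      using UF(6) by (simp add: m.emeasure_eq_measure ennreal_leI)
  qed
  finally have "vol (U \<inter> V) \<le> vol G + ennreal e" using B(3) by simp
  moreover have "U \<inter> V \<in> opens" using UF(1) V by (rule qopens_Int)
  moreover have "G \<subseteq> U \<inter> V" using GV B(2) UF(4) by blast
  ultimately show ?thesis by (intro bexI[of _ "U \<inter> V"] conjI)
qed

end

section \<open>A countable family of balls and the density theorem\<close>

locale dyadic_space = doubling_space d \<nu> K Cd
  for d :: "'s \<Rightarrow> 's \<Rightarrow> real" and \<nu> :: "'s measure" and K Cd :: real +
  fixes D :: "'s set"
  assumes countable_D: "countable D" and D_space: "D \<subseteq> \<S>"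
    and D_dense: "\<And>x r. x \<in> \<S> \<Longrightarrow> 0 < r \<Longrightarrow> \<exists>y\<in>D. d x y < r"
begin

text \<open>This is not a dyadic grid: balls of one radius may overlap. Countability keeps suprema
  and unions measurable, and dyadic radii make the family closed under doubling.\<close>

definition I :: "('s \<times> real) set" where "I = D \<times> range (\<lambda>k::int. 2 powi k)"

lemma countable_I: "countable I"
  unfolding I_def by (intro countable_SIGMA countable_D) simp

lemma I_space: "(y, r) \<in> I \<Longrightarrow> y \<in> \<S> \<and> 0 < r"
  using D_space by (auto simp: I_def)

lemma I_subset: "I \<subseteq> \<S> \<times> {0<..}"
  using I_space by auto

lemma I_double: "(y, r) \<in> I \<Longrightarrow> (y, 2 ^ n * r) \<in> I"
proof -
  assume "(y, r) \<in> I"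
  then obtain k :: int where "y \<in> D" "r = 2 powi k" by (auto simp: I_def)
  then have "2 ^ n * r = 2 powi (int n + k)" by (simp add: power_int_add)
  then show ?thesis using \<open>y \<in> D\<close> by (auto simp: I_def)
qed

lemma I_sets: "(y, r) \<in> I \<Longrightarrow> Bl y r \<in> sets \<nu>"
  using I_space ball_sets by blast

lemma small_radius:
  assumes "0 < (s::real)"
  obtains k :: int where "2 powi k < s"
proof -
  obtain n :: nat where n: "(1 / 2 :: real) ^ n < s" using assms real_arch_pow_inv[of s "1/2"] by auto
  have "(2::real) powi (- int n) = (1 / 2) ^ n"
    by (simp add: power_int_minus power_one_over inverse_eq_divide)
  then show thesis using n that[of "- int n"] by simp
qed

text \<open>\<open>Cd ^ engulf_exp\<close> is the price of one dilation in the Vitali covering; the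
  2 leaves the contraction factor 1 / 2 in \<open>null_of_small_density\<close>.\<close>

definition \<eta>\<^sub>0 :: real where "\<eta>\<^sub>0 = 1 / (2 * Cd ^ engulf_exp)"

lemma \<eta>\<^sub>0_pos: "0 < \<eta>\<^sub>0"
  using Cd_ge_1 by (simp add: \<eta>\<^sub>0_def)

text \<open>Choose an open U containing G with measure at most |G| + e and cover G by small balls
  inside U. Sparseness on the dilates and Vitali give |G| <= |U| / 2, hence |G| <= e.\<close>

lemma null_of_small_density:
  assumes G: "G \<in> sets \<nu>" "G \<subseteq> Bl x0 \<rho>" and x0: "x0 \<in> \<S>" and "0 < \<rho>" "0 < R"
    and sparse: "\<And>y r. (y, r) \<in> I \<Longrightarrow> r < R \<Longrightarrow> Bl y r \<inter> G \<noteq> {} \<Longrightarrow>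
        vol (G \<inter> Bl y r) \<le> ennreal \<eta>\<^sub>0 * vol (Bl y r)"
  shows "vol G = 0"
proof -
  define g where "g = measure \<nu> G"
  have "vol G \<le> vol (Bl x0 \<rho>)" using G x0 \<open>0 < \<rho>\<close> by (intro emeasure_mono ball_sets)
  then have "vol G < \<infinity>" using ball_finite[OF x0 \<open>0 < \<rho>\<close>] by (rule le_less_trans)
  then have g: "vol G = ennreal g" by (simp add: g_def emeasure_eq_ennreal_measure less_top)
  have "g \<le> 0 + e" if e: "0 < e" for e
  proof -
    obtain U where U: "U \<in> opens" "G \<subseteq> U" "vol U \<le> vol G + ennreal e"
      using outer_regular[OF G x0 \<open>0 < \<rho>\<close> e] by blast
    have Us: "U \<in> sets \<nu>" using U(1) qopens_sets by blast
    define P where "P = {(y, r) \<in> I. Bl y r \<subseteq> U \<and> 2 ^ engulf_exp * r < R \<and> Bl y r \<inter> G \<noteq> {}}"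
    have PI: "P \<subseteq> I" by (auto simp: P_def)
    have cover: "G \<subseteq> balls P"
    proof
      fix x assume x: "x \<in> G"
      then have xs: "x \<in> \<S>" using G(1) sets.sets_into_space by blast
      obtain t where t: "0 < t" "Bl x t \<subseteq> U" using U(1) subsetD[OF U(2) x] by (rule qopensD)
      \<comment> \<open>The radius is so small that a ball through x stays in U and its dilate still
        has radius below R.\<close>
      obtain k :: int where k: "2 powi k < min t R / 2 ^ engulf_exp"
        using small_radius[of "min t R / 2 ^ engulf_exp"] t \<open>0 < R\<close> by auto
      define r where "r = (2::real) powi k"
      have r: "0 < r" "2 ^ engulf_exp * r < t" "2 ^ engulf_exp * r < R"
        using k by (auto simp: r_def field_simps)
      obtain y where y: "y \<in> D" "d x y < r" using D_dense[OF xs r(1)] by blast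
      have ys: "y \<in> \<S>" using y D_space by blast
      have yI: "(y, r) \<in> I" using y by (auto simp: I_def r_def)
      have xB: "x \<in> Bl y r" using y xs d_sym[OF xs ys] by (simp add: Bl_iff)
      have "Bl y r \<inter> Bl x r \<noteq> {}" using xB center_Bl[OF xs r(1)] by blast
      then have "Bl y r \<subseteq> Bl x (2 ^ engulf_exp * r)" using engulf[OF ys xs] by simp
      also have "\<dots> \<subseteq> Bl x t" using r by (intro Bl_mono) simp
      finally have "(y, r) \<in> P" using yI t r xB x by (auto simp: P_def)
      then show "x \<in> balls P" using xB by blast
    qed
    define M where "M = density \<nu> (indicator G)"
    have em: "emeasure M A = vol (G \<inter> A)" if "A \<in> sets \<nu>" for A
      using that G(1) unfolding M_def by (simp add: emeasure_density indicator_inter_arith[symmetric])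
    have le: "emeasure M (Bl y (2 ^ engulf_exp * r)) \<le> ennreal (1 / 2) * vol (Bl y r)"
      if p: "(y, r) \<in> P" for y r
    proof -
      have yI: "(y, r) \<in> I" and R: "2 ^ engulf_exp * r < R" and meet: "Bl y r \<inter> G \<noteq> {}"
        using p by (auto simp: P_def)
      have y: "y \<in> \<S>" "0 < r" using I_space[OF yI] by auto
      have "r \<le> 2 ^ engulf_exp * r" using y by simp
      then have "Bl y r \<subseteq> Bl y (2 ^ engulf_exp * r)" by (rule Bl_mono)
      then have "Bl y (2 ^ engulf_exp * r) \<inter> G \<noteq> {}" using meet by blast
      then have "vol (G \<inter> Bl y (2 ^ engulf_exp * r)) \<le> ennreal \<eta>\<^sub>0 * vol (Bl y (2 ^ engulf_exp * r))"
        using sparse[OF I_double[OF yI] R] by blast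
      also have "\<dots> \<le> ennreal \<eta>\<^sub>0 * (ennreal (Cd ^ engulf_exp) * vol (Bl y r))"
        by (intro mult_left_mono doubling_pow y) simp
      also have "\<dots> = ennreal (\<eta>\<^sub>0 * Cd ^ engulf_exp) * vol (Bl y r)"
        using \<eta>\<^sub>0_pos Cd_ge_1 by (simp add: ennreal_mult mult.assoc)
      also have "\<eta>\<^sub>0 * Cd ^ engulf_exp = 1 / 2" using Cd_ge_1 by (simp add: \<eta>\<^sub>0_def)
      finally show ?thesis using y by (simp add: em ball_sets)
    qed
    have US: "balls P \<in> sets \<nu>"
      using countable_subset[OF PI countable_I] PI I_sets
      by (intro sets.countable_UN'') (auto split: prod.splits)
    have "vol G = emeasure M (balls P)"
      using cover em[OF US] by (simp add: Int_absorb2)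
    also have "\<dots> \<le> ennreal (1 / 2) * vol (balls P)"
      using countable_subset[OF PI countable_I] PI I_subset le
      by (intro Vitali_measure) (auto simp: M_def)
    also have "\<dots> \<le> ennreal (1 / 2) * vol U"
      using Us by (intro mult_left_mono emeasure_mono) (auto simp: P_def)
    also have "\<dots> \<le> ennreal (1 / 2) * (ennreal g + ennreal e)"
      using U(3) g by (intro mult_left_mono) auto
    also have "\<dots> = ennreal (1 / 2) * ennreal (g + e)" using e by (simp add: g_def)
    also have "\<dots> = ennreal (1 / 2 * (g + e))"
      using e by (intro ennreal_mult[symmetric]) (auto simp: g_def)
    finally have "g \<le> 1 / 2 * (g + e)"
      unfolding g by (subst (asm) ennreal_le_iff) (use e in \<open>auto simp: g_def\<close>)
    then show ?thesis by simp
  qed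
  then have "g \<le> 0" by (rule field_le_epsilon)
  then show ?thesis using g by (simp add: ennreal_neg)
qed

text \<open>The points of F in no ball of radius below 1 / (n + 1) with density at least
  \<open>\<eta>\<^sub>0\<close> form a set to which \<open>null_of_small_density\<close> applies,
  after cutting it into bounded pieces. A fixed density instead of density 1 suffices to compare an
  average with the values of a weight.\<close>

lemma density:
  assumes F: "F \<in> sets \<nu>"
  shows "AE x in \<nu>. x \<in> F \<longrightarrow> (\<forall>R>0. \<exists>y r. (y, r) \<in> I \<and> x \<in> Bl y r \<and> r < R \<and>
            ennreal \<eta>\<^sub>0 * vol (Bl y r) \<le> vol (F \<inter> Bl y r))"
proof (cases "\<S> = {}")
  case True
  then show ?thesis by (intro AE_I2) simp
next
  case False
  then obtain x0 where x0: "x0 \<in> \<S>" by blast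
  define P where "P n = {(y, r) \<in> I. r < 1 / real (Suc n) \<and>
    ennreal \<eta>\<^sub>0 * vol (Bl y r) \<le> vol (F \<inter> Bl y r)}" for n
  define G where "G n = F - (\<Union>(y, r)\<in>P n. Bl y r)" for n
  have Gs: "G n \<in> sets \<nu>" for n
  proof -
    have "P n \<subseteq> I" by (auto simp: P_def)
    then have "(\<Union>(y, r)\<in>P n. Bl y r) \<in> sets \<nu>"
      using countable_subset[OF _ countable_I, of "P n"] I_sets
      by (intro sets.countable_UN'') (auto split: prod.splits)
    then show ?thesis using F by (auto simp: G_def)
  qed
  have null: "vol (G n \<inter> Bl x0 (real (Suc i))) = 0" for n i
  proof (rule null_of_small_density[where R = "1 / real (Suc n)", OF _ _ x0])
    fix y r assume yr: "(y, r) \<in> I" "r < 1 / real (Suc n)"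
      and "Bl y r \<inter> (G n \<inter> Bl x0 (real (Suc i))) \<noteq> {}"
    then obtain x where x: "x \<in> Bl y r" "x \<in> G n" by blast
    then have "(y, r) \<notin> P n" by (auto simp: G_def)
    then have "vol (F \<inter> Bl y r) \<le> ennreal \<eta>\<^sub>0 * vol (Bl y r)"
      using yr by (auto simp: P_def)
    moreover have "vol (G n \<inter> Bl x0 (real (Suc i)) \<inter> Bl y r) \<le> vol (F \<inter> Bl y r)"
      using F I_sets[OF yr(1)] by (intro emeasure_mono) (auto simp: G_def)
    ultimately show "vol (G n \<inter> Bl x0 (real (Suc i)) \<inter> Bl y r) \<le> ennreal \<eta>\<^sub>0 * vol (Bl y r)"
      by simp
  qed (use Gs x0 ball_sets in auto)
  have "AE x in \<nu>. \<forall>n i. x \<notin> G n \<inter> Bl x0 (real (Suc i))"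
  proof (unfold AE_all_countable, intro allI AE_not_in null_setsI null)
    fix n i show "G n \<inter> Bl x0 (real (Suc i)) \<in> sets \<nu>" using Gs x0 by (intro sets.Int ball_sets) auto
  qed
  then show ?thesis
  proof (rule AE_mp, intro AE_I2 impI allI)
    fix x R assume x: "x \<in> \<S>" "\<forall>n i. x \<notin> G n \<inter> Bl x0 (real (Suc i))" "x \<in> F" and R: "(0::real) < R"
    obtain i where "x \<in> Bl x0 (real (Suc i))" using x(1) unfolding Bl_exhaust[OF x0, symmetric] by blast
    then have xG: "x \<notin> G n" for n using x(2) by blast
    obtain n where n: "1 / real (Suc n) < R" using R by (elim nat_approx_posE)
    obtain y r where "(y, r) \<in> P n" "x \<in> Bl y r" using xG[of n] x(3) by (auto simp: G_def)
    then show "\<exists>y r. (y, r) \<in> I \<and> x \<in> Bl y r \<and> r < R \<and>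
            ennreal \<eta>\<^sub>0 * vol (Bl y r) \<le> vol (F \<inter> Bl y r)"
      using n by (intro exI[of _ y] exI[of _ r]) (auto simp: P_def)
  qed
qed

end


section \<open>Weights\<close>

text \<open>A quantitative A-infinity condition: only on a fraction \<eta> of a ball may W fall
  below \<phi>(\<eta>) times its average. Recording the modulus \<phi> treats the classes A1 and Ap
  alike and makes the condition uniform over families of weights.\<close>

definition Ainf_weight ::
  "('s \<Rightarrow> 's \<Rightarrow> real) \<Rightarrow> 's measure \<Rightarrow> (real \<Rightarrow> real) \<Rightarrow> ('s \<Rightarrow> ennreal) \<Rightarrow> bool" where
  "Ainf_weight d \<nu> \<phi> W \<longleftrightarrow> W \<in> borel_measurable \<nu> \<and>
     (\<forall>\<eta>>0. \<forall>B\<in>qballs d \<nu>.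
        emeasure \<nu> {x \<in> B. W x < ennreal (\<phi> \<eta>) * average \<nu> B W} \<le> ennreal \<eta> * emeasure \<nu> B)"

lemma Ainf_weightD:
  assumes "Ainf_weight d \<nu> \<phi> W" "0 < \<eta>" "B \<in> qballs d \<nu>"
  shows "emeasure \<nu> {x \<in> B. W x < ennreal (\<phi> \<eta>) * average \<nu> B W} \<le> ennreal \<eta> * emeasure \<nu> B"
  using assms by (simp add: Ainf_weight_def)

lemma emeasure_lborel_Ioi: "emeasure lborel {0::real<..} = \<infinity>"
proof -
  have "ennreal (real n) \<le> emeasure lborel {0::real<..}" for n
  proof -
    have "emeasure lborel {0<..<real n} \<le> emeasure lborel {0::real<..}" by (intro emeasure_mono) auto
    then show ?thesis by simp
  qed
  then have "(SUP n. ennreal (real n)) \<le> emeasure lborel {0::real<..}" by (intro SUP_least)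
  then show ?thesis
    by (simp add: ennreal_of_nat_eq_real_of_nat[symmetric] ennreal_SUP_of_nat_eq_top top_unique)
qed

text \<open>The pointwise form of the layer-cake formula. The value \<infinity> is included because
  maximal functions may take it.\<close>

lemma emeasure_below: "emeasure lborel {l::real. 0 < l \<and> ennreal l < a} = a"
proof (cases a)
  case (real r)
  then have "{l::real. 0 < l \<and> ennreal l < a} = {0<..<r}" by (auto simp: ennreal_less_iff)
  then show ?thesis using real by simp
next
  case top
  then have "{l::real. 0 < l \<and> ennreal l < a} = {0<..}" by auto
  then show ?thesis using top emeasure_lborel_Ioi by simp
qed

lemma emeasure_below_le: "emeasure lborel {l::real. 0 < l \<and> ennreal l \<le> a} = a"
proof (cases a)
  case (real r)
  then have "{l::real. 0 < l \<and> ennreal l \<le> a} = {0<..r}" by (auto simp: ennreal_le_iff)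
  then show ?thesis using real by simp
next
  case top
  then have "{l::real. 0 < l \<and> ennreal l \<le> a} = {0<..}" by auto
  then show ?thesis using top emeasure_lborel_Ioi by simp
qed

lemma ennreal_mult_le_iff_le_inverse:
  assumes "0 < c"
  shows "ennreal c * x \<le> y \<longleftrightarrow> x \<le> ennreal (1 / c) * y"
proof
  assume "ennreal c * x \<le> y"
  then have "ennreal (1 / c) * (ennreal c * x) \<le> ennreal (1 / c) * y" by (rule mult_left_mono) simp
  then show "x \<le> ennreal (1 / c) * y"
    using assms by (simp add: mult.assoc[symmetric] ennreal_mult'[symmetric])
next
  assume "x \<le> ennreal (1 / c) * y"
  then have "ennreal c * x \<le> ennreal c * (ennreal (1 / c) * y)" by (rule mult_left_mono) simp
  then show "ennreal c * x \<le> y"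
    using assms by (simp add: mult.assoc[symmetric] ennreal_mult'[symmetric])
qed

section \<open>Weighted measures of parts of balls, and integration over levels\<close>

context doubling_space
begin

lemma average_mult:
  assumes "x \<in> \<S>" "0 < r"
  shows "avg x r W * vol (Bl x r) = (\<integral>\<^sup>+y\<in>Bl x r. W y \<partial>\<nu>)"
  using ball_pos[OF assms] ball_finite[OF assms]
  by (simp add: average_def ennreal_divide_times less_top)

lemma ball_measure:
  assumes "x \<in> \<S>" "0 < r"
  obtains b where "0 < b" "vol (Bl x r) = ennreal b"
proof -
  have e: "vol (Bl x r) = ennreal (measure \<nu> (Bl x r))"
    using ball_finite[OF assms] by (simp add: emeasure_eq_ennreal_measure less_top)
  then have "0 < measure \<nu> (Bl x r)" using ball_pos[OF assms] by (metis ennreal_less_zero_iff)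
  then show thesis using e that by blast
qed

text \<open>Remove from E the points where V is below \<phi>(\<theta> / 2) times its average, at
  most a fraction \<theta> / 2 of the ball. At least a fraction \<theta> / 2 remains, and V is
  bounded below on it.\<close>

lemma Ainf_weight_ball:
  assumes V: "Ainf_weight d \<nu> \<phi> V" and x: "x \<in> \<S>" "0 < r" and E: "E \<in> sets \<nu>"
    and "0 < \<theta>" and pos: "0 < \<phi> (\<theta> / 2)"
    and large: "ennreal \<theta> * vol (Bl x r) \<le> vol (E \<inter> Bl x r)"
  shows "wvol V (Bl x r)
     \<le> ennreal (2 / (\<theta> * \<phi> (\<theta> / 2))) * wvol V (E \<inter> Bl x r)"
proof -
  have Vm [measurable]: "V \<in> borel_measurable \<nu>" using V by (simp add: Ainf_weight_def)
  have Bs [measurable]: "Bl x r \<in> sets \<nu>" using x by (rule ball_sets)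
  note [measurable] = E
  obtain b where b: "0 < b" "vol (Bl x r) = ennreal b" using x by (rule ball_measure)
  define a where "a = avg x r V"
  define H where "H = {y \<in> Bl x r. V y < ennreal (\<phi> (\<theta> / 2)) * a}"
  have "H = {y \<in> \<S>. V y < ennreal (\<phi> (\<theta> / 2)) * a} \<inter> Bl x r" by (auto simp: H_def Bl_iff)
  then have Hm [measurable]: "H \<in> sets \<nu>" by simp
  have H: "vol H \<le> ennreal (\<theta> / 2) * ennreal b"
    using Ainf_weightD[OF V _ Bl_qballs[OF x], of "\<theta> / 2"] \<open>0 < \<theta>\<close> b(2)
    unfolding H_def a_def by (simp only: half_gt_zero_iff)
  have "ennreal (\<theta> * b) \<le> vol (E \<inter> Bl x r)"
    using large b \<open>0 < \<theta>\<close> by (simp add: ennreal_mult)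
  also have "\<dots> \<le> vol ((E \<inter> Bl x r - H) \<union> H)" by (intro emeasure_mono) auto
  also have "\<dots> \<le> vol (E \<inter> Bl x r - H) + vol H"
    by (rule emeasure_subadditive) auto
  also have "\<dots> \<le> vol (E \<inter> Bl x r - H) + ennreal (\<theta> * b / 2)"
    using H b \<open>0 < \<theta>\<close> by (intro add_left_mono) (simp add: ennreal_mult[symmetric])
  also have "ennreal (\<theta> * b) = ennreal (\<theta> * b / 2) + ennreal (\<theta> * b / 2)"
    using b \<open>0 < \<theta>\<close> by (subst ennreal_plus[symmetric]) auto
  finally have D: "ennreal (\<theta> * b / 2) \<le> vol (E \<inter> Bl x r - H)"
    by (simp add: add.commute ennreal_add_left_cancel_le)
  have "ennreal (\<theta> * \<phi> (\<theta> / 2) / 2) * wvol V (Bl x r)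
      = ennreal (\<theta> * \<phi> (\<theta> / 2) / 2) * (a * ennreal b)"
    using average_mult[OF x, of V] b(2) by (simp add: emeasure_density a_def)
  also have "\<dots> = ennreal (\<phi> (\<theta> / 2)) * a * ennreal (\<theta> * b / 2)"
  proof -
    have e: "ennreal (\<theta> * \<phi> (\<theta> / 2) / 2) * ennreal b = ennreal (\<phi> (\<theta> / 2)) * ennreal (\<theta> * b / 2)"
      using b pos \<open>0 < \<theta>\<close> by (simp add: ennreal_mult[symmetric] mult_ac)
    show ?thesis by (metis e mult.assoc mult.commute)
  qed
  also have "\<dots> \<le> ennreal (\<phi> (\<theta> / 2)) * a * vol (E \<inter> Bl x r - H)"
    using D by (intro mult_left_mono) auto
  also have "\<dots> = (\<integral>\<^sup>+y. ennreal (\<phi> (\<theta> / 2)) * a * indicator (E \<inter> Bl x r - H) y \<partial>\<nu>)"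
    by (subst nn_integral_cmult_indicator) auto
  also have "\<dots> \<le> (\<integral>\<^sup>+y. V y * indicator (E \<inter> Bl x r) y \<partial>\<nu>)"
    by (intro nn_integral_mono) (auto simp: H_def split: split_indicator)
  also have "\<dots> = wvol V (E \<inter> Bl x r)" by (simp add: emeasure_density)
  finally have "ennreal (\<theta> * \<phi> (\<theta> / 2) / 2) * wvol V (Bl x r)
      \<le> wvol V (E \<inter> Bl x r)" .
  then show ?thesis
    using pos \<open>0 < \<theta>\<close> by (subst (asm) ennreal_mult_le_iff_le_inverse) auto
qed

text \<open>Turns inequalities between weighted measures of level sets into one between integrals.
  General regions T and T' are allowed because in the decay estimate the levels belonging to a point
  form an interval that need not start at 0.\<close>

lemma Fubini_sections:
  fixes T T' :: "('s \<times> real) set"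
  assumes [measurable]: "V \<in> borel_measurable \<nu>"
    and [measurable]: "T \<in> sets (\<nu> \<Otimes>\<^sub>M lborel)" "T' \<in> sets (\<nu> \<Otimes>\<^sub>M lborel)"
    and le: "\<And>l. wvol V {x \<in> \<S>. (x, l) \<in> T}
       \<le> C * wvol V {x \<in> \<S>. (x, l) \<in> T'}"
  shows "(\<integral>\<^sup>+x. V x * emeasure lborel {l. (x, l) \<in> T} \<partial>\<nu>)
       \<le> C * (\<integral>\<^sup>+x. V x * emeasure lborel {l. (x, l) \<in> T'} \<partial>\<nu>)"
proof -
  interpret \<nu>: sigma_finite_measure \<nu> by (rule sigma_finite_nu)
  interpret pair_sigma_finite \<nu> lborel by unfold_locales
  have sw: "(\<integral>\<^sup>+x. V x * emeasure lborel {l. (x, l) \<in> U} \<partial>\<nu>)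
      = (\<integral>\<^sup>+l. wvol V {x \<in> \<S>. (x, l) \<in> U} \<partial>lborel)"
    if [measurable]: "U \<in> sets (\<nu> \<Otimes>\<^sub>M lborel)" for U :: "('s \<times> real) set"
  proof -
    have "(\<integral>\<^sup>+x. V x * emeasure lborel {l. (x, l) \<in> U} \<partial>\<nu>)
        = (\<integral>\<^sup>+x. (\<integral>\<^sup>+l. V x * indicator U (x, l) \<partial>lborel) \<partial>\<nu>)"
    proof (intro nn_integral_cong)
      fix x assume x: "x \<in> \<S>"
      have s: "{l. (x, l) \<in> U} \<in> sets lborel" using sets_Pair1[OF that, of x] by (simp add: vimage_def)
      have "(\<integral>\<^sup>+l. V x * indicator U (x, l) \<partial>lborel) = (\<integral>\<^sup>+l. V x * indicator {l. (x, l) \<in> U} l \<partial>lborel)"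
        by (intro nn_integral_cong) (auto split: split_indicator)
      then show "V x * emeasure lborel {l. (x, l) \<in> U} = (\<integral>\<^sup>+l. V x * indicator U (x, l) \<partial>lborel)"
        using s by (simp add: nn_integral_cmult_indicator)
    qed
    also have "\<dots> = (\<integral>\<^sup>+l. (\<integral>\<^sup>+x. V x * indicator U (x, l) \<partial>\<nu>) \<partial>lborel)"
      by (rule Fubini'[symmetric]) measurable
    also have "\<dots> = (\<integral>\<^sup>+l. wvol V {x \<in> \<S>. (x, l) \<in> U} \<partial>lborel)"
    proof (intro nn_integral_cong)
      fix l :: real
      have "{x \<in> \<S>. (x, l) \<in> U} = (\<lambda>x. (x, l)) -` U" using sets.sets_into_space[OF that]
        by (auto simp: space_pair_measure)
      then have s: "{x \<in> \<S>. (x, l) \<in> U} \<in> sets \<nu>" using sets_Pair2[OF that, of l] by simp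
      show "(\<integral>\<^sup>+x. V x * indicator U (x, l) \<partial>\<nu>) = wvol V {x \<in> \<S>. (x, l) \<in> U}"
        unfolding emeasure_density[OF assms(1) s]
        by (intro nn_integral_cong) (auto split: split_indicator)
    qed
    finally show ?thesis .
  qed
  have m: "(\<lambda>l. wvol V {x \<in> \<S>. (x, l) \<in> T'}) \<in> borel_measurable lborel"
  proof -
    have "(\<lambda>l. (\<integral>\<^sup>+x. V x * indicator T' (x, l) \<partial>\<nu>)) \<in> borel_measurable lborel" by measurable
    moreover have "(\<integral>\<^sup>+x. V x * indicator T' (x, l) \<partial>\<nu>) = wvol V {x \<in> \<S>. (x, l) \<in> T'}" for l
    proof -
      have "{x \<in> \<S>. (x, l) \<in> T'} = (\<lambda>x. (x, l)) -` T'" using sets.sets_into_space[OF assms(3)]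
        by (auto simp: space_pair_measure)
      then have s: "{x \<in> \<S>. (x, l) \<in> T'} \<in> sets \<nu>" using sets_Pair2[OF assms(3), of l] by simp
      show ?thesis unfolding emeasure_density[OF assms(1) s]
        by (intro nn_integral_cong) (auto split: split_indicator)
    qed
    ultimately show ?thesis by simp
  qed
  have "(\<integral>\<^sup>+l. wvol V {x \<in> \<S>. (x, l) \<in> T} \<partial>lborel)
      \<le> (\<integral>\<^sup>+l. C * wvol V {x \<in> \<S>. (x, l) \<in> T'} \<partial>lborel)"
    by (intro nn_integral_mono le)
  also have "\<dots> = C * (\<integral>\<^sup>+l. wvol V {x \<in> \<S>. (x, l) \<in> T'} \<partial>lborel)"
    using m by (rule nn_integral_cmult)
  finally show ?thesis unfolding sw[OF assms(2)] sw[OF assms(3)] .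
qed

end

section \<open>The countable maximal function and its weighted integral bound\<close>

context dyadic_space
begin

text \<open>As a countable supremum of multiples of indicators this is measurable for every W;
  \<open>average_le_mxf_ball\<close> relates it to all balls.\<close>

definition mxf :: "('s \<Rightarrow> ennreal) \<Rightarrow> 's \<Rightarrow> ennreal" where
  "mxf W x = (SUP (y, r)\<in>I. indicator (Bl y r) x * avg y r W)"

lemma mxf_measurable [measurable]: "mxf W \<in> borel_measurable \<nu>"
  unfolding mxf_def[abs_def] using countable_I I_sets
  by (intro borel_measurable_SUP) (auto split: prod.splits)

lemma average_le_mxf:
  assumes "(y, r) \<in> I" "x \<in> Bl y r"
  shows "avg y r W \<le> mxf W x"
proof -
  have "indicator (Bl y r) x * avg y r W \<le> mxf W x"
    unfolding mxf_def using assms by (intro SUP_upper2[of "(y, r)"]) auto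
  then show ?thesis using assms by simp
qed

lemma less_mxfE:
  assumes "l < mxf W x"
  obtains y r where "(y, r) \<in> I" "x \<in> Bl y r" "l < avg y r W"
proof -
  obtain y r where "(y, r) \<in> I" "l < indicator (Bl y r) x * avg y r W"
    using assms unfolding mxf_def less_SUP_iff by auto
  then show thesis using that[of y r] by (auto split: split_indicator_asm)
qed

text \<open>A fraction \<theta> of a ball is at least a fraction
  \<open>\<theta> / Cd ^ engulf_exp\<close> of its dilate; the rest is the constant of
  \<open>Ainf_weight_ball\<close> for that fraction.\<close>

definition cover_const :: "(real \<Rightarrow> real) \<Rightarrow> real \<Rightarrow> real" where
  "cover_const \<phi> \<theta> = 2 / (\<theta> / Cd ^ engulf_exp * \<phi> (\<theta> / Cd ^ engulf_exp / 2))"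

text \<open>Apply Vitali with the measure V d\<nu> on the dilates and V d\<nu> restricted to E on
  the selected balls. The A-infinity condition on V bounds a whole dilate by the part of E inside
  the original ball.\<close>

lemma weighted_cover:
  assumes V: "Ainf_weight d \<nu> \<phi> V" and pos: "\<And>\<eta>. 0 < \<eta> \<Longrightarrow> 0 < \<phi> \<eta>" and \<theta>: "0 < \<theta>"
    and P: "P \<subseteq> I" and E: "E \<in> sets \<nu>"
    and large: "\<And>y r. (y, r) \<in> P \<Longrightarrow> ennreal \<theta> * vol (Bl y r) \<le> vol (E \<inter> Bl y r)"
  shows "wvol V (balls P)
     \<le> ennreal (cover_const \<phi> \<theta>) * wvol V E"
proof -
  have Vm [measurable]: "V \<in> borel_measurable \<nu>" using V by (simp add: Ainf_weight_def)
  note [measurable] = E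
  define M' where "M' = density \<nu> (\<lambda>x. V x * indicator E x)"
  have em: "emeasure M' A = wvol V (E \<inter> A)" if "A \<in> sets \<nu>" for A
    using that unfolding M'_def
    by (simp add: emeasure_density) (auto intro!: nn_integral_cong split: split_indicator)
  define \<theta>' where "\<theta>' = \<theta> / Cd ^ engulf_exp"
  have \<theta>': "0 < \<theta>'" using \<theta> Cd_ge_1 by (simp add: \<theta>'_def)
  have le: "wvol V (Bl y (2 ^ engulf_exp * r)) \<le> ennreal (cover_const \<phi> \<theta>) * emeasure M' (Bl y r)"
    if p: "(y, r) \<in> P" for y r
  proof -
    have yr: "y \<in> \<S>" "0 < r" using p P I_space by auto
    have yr': "0 < 2 ^ engulf_exp * r" using yr by simp
    have "r \<le> 2 ^ engulf_exp * r" using yr by simp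
    then have sub: "Bl y r \<subseteq> Bl y (2 ^ engulf_exp * r)" by (rule Bl_mono)
    have "ennreal \<theta>' * vol (Bl y (2 ^ engulf_exp * r))
        \<le> ennreal \<theta>' * (ennreal (Cd ^ engulf_exp) * vol (Bl y r))"
      by (intro mult_left_mono doubling_pow yr) simp
    also have "\<dots> = ennreal \<theta> * vol (Bl y r)"
      using \<theta>' Cd_ge_1 by (simp add: mult.assoc[symmetric] ennreal_mult[symmetric]) (simp add: \<theta>'_def)
    also have "\<dots> \<le> vol (E \<inter> Bl y r)" using large[OF p] .
    also have "\<dots> = vol (E \<inter> Bl y r \<inter> Bl y (2 ^ engulf_exp * r))"
      using sub by (simp add: Int_absorb2 Int_assoc)
    finally have "wvol V (Bl y (2 ^ engulf_exp * r))
      \<le> ennreal (2 / (\<theta>' * \<phi> (\<theta>' / 2))) * wvol V (E \<inter> Bl y r \<inter> Bl y (2 ^ engulf_exp * r))"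
      using pos \<theta>' E ball_sets[OF yr] by (intro Ainf_weight_ball[OF V yr(1) yr']) auto
    then show ?thesis
      using sub ball_sets[OF yr] by (simp add: Int_absorb2 Int_assoc em cover_const_def \<theta>'_def)
  qed
  have cP: "countable P" using P countable_I by (rule countable_subset)
  have US: "balls P \<in> sets \<nu>"
    using cP P I_sets by (intro sets.countable_UN'') (auto split: prod.splits)
  have "wvol V (balls P)
     \<le> ennreal (cover_const \<phi> \<theta>) * emeasure M' (balls P)"
    using P I_subset le by (intro Vitali_measure cP) (auto simp: M'_def)
  also have "\<dots> \<le> ennreal (cover_const \<phi> \<theta>) * wvol V E"
    unfolding em[OF US] by (intro mult_left_mono emeasure_mono) auto
  finally show ?thesis .
qed

text \<open>On at least half of every ball with average above l one has W >= \<phi>(1 / 2) l, so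
  this level set of W can serve as the set E of \<open>weighted_cover\<close>.\<close>

lemma mxf_level:
  assumes W: "Ainf_weight d \<nu> \<phi> W" and V: "Ainf_weight d \<nu> \<psi> V"
    and \<phi>: "\<And>\<eta>. 0 < \<eta> \<Longrightarrow> 0 < \<phi> \<eta>" and \<psi>: "\<And>\<eta>. 0 < \<eta> \<Longrightarrow> 0 < \<psi> \<eta>"
  shows "wvol V {x \<in> \<S>. l < mxf W x}
     \<le> ennreal (cover_const \<psi> (1 / 2)) * wvol V {x \<in> \<S>. ennreal (\<phi> (1 / 2)) * l \<le> W x}"
proof -
  have Wm [measurable]: "W \<in> borel_measurable \<nu>" using W by (simp add: Ainf_weight_def)
  define E where "E = {x \<in> \<S>. ennreal (\<phi> (1 / 2)) * l \<le> W x}"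
  have Es: "E \<in> sets \<nu>" unfolding E_def by measurable
  define P where "P = {(y, r) \<in> I. l < avg y r W}"
  have PI: "P \<subseteq> I" by (auto simp: P_def)
  have large: "ennreal (1 / 2) * vol (Bl y r) \<le> vol (E \<inter> Bl y r)" if p: "(y, r) \<in> P" for y r
  proof -
    have yr: "y \<in> \<S>" "0 < r" using p PI I_space by auto
    have Bs: "Bl y r \<in> sets \<nu>" using yr by (rule ball_sets)
    define a where "a = avg y r W"
    have a: "l < a" using p by (simp add: P_def a_def)
    obtain b where b: "0 < b" "vol (Bl y r) = ennreal b" using yr by (rule ball_measure)
    define H where "H = {x \<in> Bl y r. W x < ennreal (\<phi> (1 / 2)) * a}"
    have "H = {x \<in> \<S>. W x < ennreal (\<phi> (1 / 2)) * a} \<inter> Bl y r" by (auto simp: H_def Bl_iff)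
    then have Hs: "H \<in> sets \<nu>" using Bs by simp
    have H: "vol H \<le> ennreal (1 / 2) * ennreal b"
      using Ainf_weightD[OF W _ Bl_qballs[OF yr], of "1 / 2"] b(2)
      unfolding H_def a_def by (simp only: half_gt_zero_iff zero_less_one)
    have half: "ennreal (1 / 2) * ennreal b = ennreal (b / 2)"
      using b by (subst ennreal_mult[symmetric]) auto
    have "Bl y r \<subseteq> (E \<inter> Bl y r) \<union> H"
    proof
      fix x assume x: "x \<in> Bl y r"
      have "ennreal (\<phi> (1 / 2)) * l \<le> ennreal (\<phi> (1 / 2)) * a" using a by (intro mult_left_mono) auto
      then show "x \<in> (E \<inter> Bl y r) \<union> H" using x by (auto simp: E_def H_def Bl_iff)
    qed
    then have "ennreal b \<le> vol ((E \<inter> Bl y r) \<union> H)"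
      unfolding b(2)[symmetric] using Es Bs Hs by (intro emeasure_mono) auto
    also have "\<dots> \<le> vol (E \<inter> Bl y r) + vol H"
      using Es Bs Hs by (intro emeasure_subadditive) auto
    also have "\<dots> \<le> vol (E \<inter> Bl y r) + ennreal (b / 2)"
      using H unfolding half by (rule add_left_mono)
    also have "ennreal b = ennreal (b / 2) + ennreal (b / 2)"
      using b by (subst ennreal_plus[symmetric]) auto
    finally have "ennreal (b / 2) \<le> vol (E \<inter> Bl y r)"
      by (simp add: add.commute ennreal_add_left_cancel_le)
    then show ?thesis unfolding b(2) half .
  qed
  have cP: "countable P" using PI countable_I by (rule countable_subset)
  have US: "balls P \<in> sets \<nu>"
    using cP PI I_sets by (intro sets.countable_UN'') (auto split: prod.splits)
  have "{x \<in> \<S>. l < mxf W x} \<subseteq> balls P"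
    by (auto simp: P_def elim!: less_mxfE)
  then have "wvol V {x \<in> \<S>. l < mxf W x} \<le> wvol V (balls P)"
    using US by (intro emeasure_mono) auto
  also have "\<dots> \<le> ennreal (cover_const \<psi> (1 / 2)) * wvol V E"
    by (rule weighted_cover[OF V \<psi> _ PI Es large]) simp_all
  finally show ?thesis by (simp add: E_def)
qed

text \<open>A level set of the maximal function is controlled by the level set of W at a
  proportional height, so integrating over the height costs only the factor 1 / \<phi>(1 /
  2).\<close>

lemma mxf_weighted_bound:
  assumes W: "Ainf_weight d \<nu> \<phi> W" and V: "Ainf_weight d \<nu> \<psi> V"
    and \<phi>: "\<And>\<eta>. 0 < \<eta> \<Longrightarrow> 0 < \<phi> \<eta>" and \<psi>: "\<And>\<eta>. 0 < \<eta> \<Longrightarrow> 0 < \<psi> \<eta>"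
  shows "(\<integral>\<^sup>+x. V x * mxf W x \<partial>\<nu>)
     \<le> ennreal (cover_const \<psi> (1 / 2) / \<phi> (1 / 2)) * (\<integral>\<^sup>+x. V x * W x \<partial>\<nu>)"
proof -
  have [measurable]: "W \<in> borel_measurable \<nu>" "V \<in> borel_measurable \<nu>"
    using W V by (auto simp: Ainf_weight_def)
  have c: "0 < \<phi> (1 / 2)" "0 < \<psi> (1 / 2 / Cd ^ engulf_exp / 2)" using \<phi> \<psi> Cd_ge_1 by auto
  then have cc: "0 \<le> cover_const \<psi> (1 / 2)" using Cd_ge_1 by (simp add: cover_const_def)
  define T where "T = {z \<in> space (\<nu> \<Otimes>\<^sub>M lborel). 0 < snd z \<and> ennreal (snd z) < mxf W (fst z)}"
  define T' where "T' = {z \<in> space (\<nu> \<Otimes>\<^sub>M lborel). 0 < snd z \<and> ennreal (\<phi> (1 / 2)) * ennreal (snd z) \<le> W (fst z)}"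
  have "(\<integral>\<^sup>+x. V x * emeasure lborel {l. (x, l) \<in> T} \<partial>\<nu>)
       \<le> ennreal (cover_const \<psi> (1 / 2)) * (\<integral>\<^sup>+x. V x * emeasure lborel {l. (x, l) \<in> T'} \<partial>\<nu>)"
  proof (rule Fubini_sections)
    show "T \<in> sets (\<nu> \<Otimes>\<^sub>M lborel)" "T' \<in> sets (\<nu> \<Otimes>\<^sub>M lborel)" unfolding T_def T'_def by measurable
    fix l
    show "wvol V {x \<in> \<S>. (x, l) \<in> T}
       \<le> ennreal (cover_const \<psi> (1 / 2)) * wvol V {x \<in> \<S>. (x, l) \<in> T'}"
    proof (cases "0 < l")
      case True
      then have "{x \<in> \<S>. (x, l) \<in> T} = {x \<in> \<S>. ennreal l < mxf W x}"
        "{x \<in> \<S>. (x, l) \<in> T'} = {x \<in> \<S>. ennreal (\<phi> (1 / 2)) * ennreal l \<le> W x}"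
        by (auto simp: T_def T'_def space_pair_measure)
      then show ?thesis using mxf_level[OF W V \<phi> \<psi>, of "ennreal l"] by simp
    next
      case False
      then have "{x \<in> \<S>. (x, l) \<in> T} = {}" by (auto simp: T_def)
      then show ?thesis by (simp only: emeasure_empty zero_le)
    qed
  qed simp
  also have "(\<integral>\<^sup>+x. V x * emeasure lborel {l. (x, l) \<in> T} \<partial>\<nu>) = (\<integral>\<^sup>+x. V x * mxf W x \<partial>\<nu>)"
    by (intro nn_integral_cong) (simp add: T_def space_pair_measure emeasure_below)
  also have "(\<integral>\<^sup>+x. V x * emeasure lborel {l. (x, l) \<in> T'} \<partial>\<nu>)
      = (\<integral>\<^sup>+x. ennreal (1 / \<phi> (1 / 2)) * (V x * W x) \<partial>\<nu>)"
  proof (intro nn_integral_cong)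
    fix x assume "x \<in> \<S>"
    then have "{l. (x, l) \<in> T'} = {l. 0 < l \<and> ennreal l \<le> ennreal (1 / \<phi> (1 / 2)) * W x}"
      unfolding T'_def ennreal_mult_le_iff_le_inverse[OF c(1)] by (simp add: space_pair_measure)
    then show "V x * emeasure lborel {l. (x, l) \<in> T'} = ennreal (1 / \<phi> (1 / 2)) * (V x * W x)"
      by (simp add: emeasure_below_le mult_ac)
  qed
  also have "\<dots> = ennreal (1 / \<phi> (1 / 2)) * (\<integral>\<^sup>+x. V x * W x \<partial>\<nu>)"
    by (intro nn_integral_cmult) measurable
  finally show ?thesis using cc c by (simp add: mult.assoc[symmetric] ennreal_mult[symmetric])
qed

end


section \<open>Balls of intermediate average and the decay at one level\<close>

context dyadic_space
begin

text \<open>The exponent is doubled because \<open>average_dilate\<close> engulfs twice.\<close>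

definition engulf_const :: real where "engulf_const = Cd ^ (2 * engulf_exp)"

lemma engulf_const_ge_1: "1 \<le> engulf_const"
  using Cd_ge_1 by (simp add: engulf_const_def)

text \<open>Moves a large average from a big ball through x to a concentric dilate of a small ball
  through x. A passage value can then be sought along the doublings of a ball with fixed
  centre.\<close>

lemma average_dilate:
  assumes yr: "(y, r) \<in> I" "(y0, r0) \<in> I" and "r \<le> r0" and x: "x \<in> Bl y r" "x \<in> Bl y0 r0"
  obtains J where "2 ^ J * r = 2 ^ engulf_exp * r0"
    "avg y0 r0 W \<le> ennreal engulf_const * avg y (2 ^ J * r) W"
proof -
  obtain i j :: int where ij: "r = 2 powi i" "r0 = 2 powi j" using yr by (auto simp: I_def)
  have "i \<le> j"
  proof (rule ccontr)
    assume "\<not> i \<le> j"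
    then have "r0 < r" unfolding ij by (intro power_int_strict_increasing) auto
    then show False using \<open>r \<le> r0\<close> by simp
  qed
  \<comment> \<open>Both radii are powers of two, so the radius of the engulfing ball is reached
    exactly by doubling r.\<close>
  define J where "J = nat (j - i) + engulf_exp"
  have J: "2 ^ J * r = 2 ^ engulf_exp * r0"
  proof -
    have "(2::real) ^ nat (j - i) * 2 powi i = 2 powi j"
      using \<open>i \<le> j\<close> by (simp add: power_int_add[symmetric] flip: power_int_of_nat)
    then show ?thesis by (simp add: J_def ij power_add mult_ac)
  qed
  have y: "y \<in> \<S>" "0 < r" and y0: "y0 \<in> \<S>" "0 < r0" using yr I_space by auto
  have xs: "x \<in> \<S>" using x by (simp add: Bl_iff)
  define R where "R = 2 ^ engulf_exp * r0"
  have R: "0 < R" "r0 \<le> R" using y0 by (auto simp: R_def)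
  have sub1: "Bl y0 r0 \<subseteq> Bl y R"
  proof -
    have "x \<in> Bl y0 r0 \<inter> Bl y r0" using x Bl_mono[OF \<open>r \<le> r0\<close>, of y] by blast
    then have "Bl y0 r0 \<inter> Bl y r0 \<noteq> {}" by blast
    then show ?thesis unfolding R_def using engulf[OF y0(1) y(1), of r0 r0] by simp
  qed
  have sub2: "Bl y R \<subseteq> Bl y0 (2 ^ engulf_exp * R)"
  proof -
    have "x \<in> Bl y R \<inter> Bl y0 R"
      using x sub1 Bl_mono[OF R(2), of y0] by blast
    then have "Bl y R \<inter> Bl y0 R \<noteq> {}" by blast
    then show ?thesis using engulf[OF y(1) y0(1), of R R] by simp
  qed
  have "2 ^ engulf_exp * R = 2 ^ (2 * engulf_exp) * r0" by (simp add: R_def power_mult power2_eq_square mult_2 power_add)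
  then have "Bl y R \<subseteq> Bl y0 (2 ^ (2 * engulf_exp) * r0)" using sub2 by simp
  moreover have "Bl y0 (2 ^ (2 * engulf_exp) * r0) \<in> sets \<nu>" using y0 by (intro ball_sets) auto
  ultimately have "vol (Bl y R) \<le> vol (Bl y0 (2 ^ (2 * engulf_exp) * r0))" by (rule emeasure_mono)
  also have "\<dots> \<le> ennreal engulf_const * vol (Bl y0 r0)"
    unfolding engulf_const_def by (rule doubling_pow[OF y0])
  finally have m: "vol (Bl y R) \<le> ennreal engulf_const * vol (Bl y0 r0)" .
  obtain b where b: "0 < b" "vol (Bl y0 r0) = ennreal b" using y0 by (rule ball_measure)
  have "avg y0 r0 W * ennreal b \<le> avg y R W * vol (Bl y R)"
    unfolding average_mult[OF y(1) R(1)] b(2)[symmetric] average_mult[OF y0]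
    using sub1 by (intro nn_integral_mono) (auto split: split_indicator)
  also have "\<dots> \<le> avg y R W * (ennreal engulf_const * ennreal b)"
    using m b(2) by (intro mult_left_mono) auto
  also have "\<dots> = ennreal engulf_const * avg y R W * ennreal b" by (simp add: mult_ac)
  finally have "ennreal b * avg y0 r0 W \<le> ennreal b * (ennreal engulf_const * avg y R W)"
    by (simp add: mult_ac)
  then have "avg y0 r0 W \<le> ennreal engulf_const * avg y R W"
    using b(1) by (subst (asm) ennreal_mult_le_iff_le_inverse)
      (auto simp: mult.assoc[symmetric] ennreal_mult[symmetric])
  then show thesis using that J unfolding R_def by metis
qed

text \<open>Stop just before the average first reaches s. On this ball the average is below s, so W
  >= 2 s holds on at most half of it. On its double the average is at least s, and the A-infinity
  condition there confines W < c s to a quarter of the smaller ball. A quarter remains.\<close>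

lemma intermediate_ball:
  assumes W: "Ainf_weight d \<nu> \<phi> W" and \<phi>: "\<And>\<eta>. 0 < \<eta> \<Longrightarrow> 0 < \<phi> \<eta>"
    and c: "c \<le> \<phi> (1 / (4 * Cd))" "0 < c"
    and yr: "(y, r) \<in> I" and low: "avg y r W < ennreal s" and s: "0 < s"
    and high: "ennreal s \<le> avg y (2 ^ J * r) W"
  obtains i where "i \<le> J"
    "ennreal (1 / 4) * vol (Bl y (2 ^ i * r))
       \<le> vol ({x \<in> \<S>. ennreal (c * s) \<le> W x \<and> W x < ennreal (2 * s)} \<inter> Bl y (2 ^ i * r))"
proof -
  have Wm [measurable]: "W \<in> borel_measurable \<nu>" using W by (simp add: Ainf_weight_def)
  define Q where "Q j \<longleftrightarrow> ennreal s \<le> avg y (2 ^ j * r) W" for j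
  define j where "j = (LEAST j. Q j)"
  have Qj: "Q j" unfolding j_def using high by (intro LeastI[of Q J]) (simp add: Q_def)
  have jJ: "j \<le> J" unfolding j_def using high by (intro Least_le) (simp add: Q_def)
  have "\<not> Q 0" using low by (simp add: Q_def)
  then obtain i where i: "j = Suc i" using Qj by (cases j) auto
  have nQi: "\<not> Q i" using not_less_Least[of i Q] i by (simp add: j_def)
  have y: "y \<in> \<S>" "0 < r" using I_space[OF yr] by auto
  define B where "B = Bl y (2 ^ i * r)"
  define B2 where "B2 = Bl y (2 ^ j * r)"
  have r': "0 < 2 ^ i * r" "0 < 2 ^ j * r" using y by auto
  have Bs [measurable]: "B \<in> sets \<nu>" and B2s [measurable]: "B2 \<in> sets \<nu>"
    unfolding B_def B2_def using y(1) r' by (auto intro: ball_sets)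
  have BB2: "B \<subseteq> B2" unfolding B_def B2_def using y i by (intro Bl_mono) auto
  obtain b where b: "0 < b" "vol B = ennreal b" unfolding B_def using y(1) r'(1) by (rule ball_measure)
  define H1 where "H1 = {x \<in> B2. W x < ennreal (\<phi> (1 / (4 * Cd))) * average \<nu> B2 W}"
  define H2 where "H2 = {x \<in> B. ennreal (2 * s) \<le> W x}"
  have "H1 = {x \<in> \<S>. W x < ennreal (\<phi> (1 / (4 * Cd))) * average \<nu> B2 W} \<inter> B2"
    using sets.sets_into_space[OF B2s] by (auto simp: H1_def)
  then have H1s [measurable]: "H1 \<in> sets \<nu>" by simp
  have "H2 = {x \<in> \<S>. ennreal (2 * s) \<le> W x} \<inter> B"
    using sets.sets_into_space[OF Bs] by (auto simp: H2_def)
  then have H2s [measurable]: "H2 \<in> sets \<nu>" by simp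
  \<comment> \<open>The double has at most Cd times the measure of B, so a fraction 1 / (4 Cd) of
    the double is at most a quarter of B.\<close>
  have e4: "0 < 1 / (4 * Cd)" using Cd_ge_1 by simp
  have H1: "vol H1 \<le> ennreal (b / 4)"
  proof -
    have "vol H1 \<le> ennreal (1 / (4 * Cd)) * vol B2"
      unfolding H1_def using Ainf_weightD[OF W e4 Bl_qballs[OF y(1) r'(2)]] by (simp add: B2_def)
    also have "vol B2 \<le> ennreal Cd * ennreal b"
      using doubling[OF y(1) r'(1)] b(2) by (simp add: B_def B2_def i mult.assoc)
    also have "ennreal (1 / (4 * Cd)) * (ennreal Cd * ennreal b) = ennreal (b / 4)"
      using Cd_ge_1 b by (simp add: ennreal_mult[symmetric])
    finally show ?thesis by (simp add: mult_left_mono)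
  qed
  have H2: "vol H2 \<le> ennreal (b / 2)"
  proof -
    have "ennreal (2 * s) * vol H2 = (\<integral>\<^sup>+x. ennreal (2 * s) * indicator H2 x \<partial>\<nu>)"
      by (simp add: nn_integral_cmult_indicator)
    also have "\<dots> \<le> (\<integral>\<^sup>+x\<in>B. W x \<partial>\<nu>)"
      by (intro nn_integral_mono) (auto simp: H2_def split: split_indicator)
    also have "\<dots> = average \<nu> B W * ennreal b"
      unfolding b(2)[symmetric] B_def by (rule average_mult[OF y(1) r'(1), symmetric])
    also have "\<dots> \<le> ennreal s * ennreal b"
      using nQi by (intro mult_right_mono) (auto simp: Q_def B_def)
    finally have "vol H2 \<le> ennreal (1 / (2 * s)) * (ennreal s * ennreal b)"
      using s by (subst (asm) ennreal_mult_le_iff_le_inverse) auto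
    also have "\<dots> = ennreal (b / 2)" using s b by (simp add: ennreal_mult[symmetric])
    finally show ?thesis .
  qed
  define E where "E = {x \<in> \<S>. ennreal (c * s) \<le> W x \<and> W x < ennreal (2 * s)}"
  have Es [measurable]: "E \<in> sets \<nu>" unfolding E_def by measurable
  have "B \<subseteq> (E \<inter> B) \<union> (H1 \<union> H2)"
  proof
    fix x assume x: "x \<in> B"
    have "ennreal (c * s) = ennreal c * ennreal s" using s c by (simp add: ennreal_mult)
    also have "\<dots> \<le> ennreal (\<phi> (1 / (4 * Cd))) * average \<nu> B2 W"
      using c Qj by (intro mult_mono) (auto simp: Q_def B2_def)
    finally show "x \<in> (E \<inter> B) \<union> (H1 \<union> H2)"
      using x BB2 sets.sets_into_space[OF Bs] by (fastforce simp: E_def H1_def H2_def)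
  qed
  then have "ennreal b \<le> vol ((E \<inter> B) \<union> (H1 \<union> H2))"
    unfolding b(2)[symmetric] by (intro emeasure_mono) auto
  also have "\<dots> \<le> vol (E \<inter> B) + vol (H1 \<union> H2)" by (rule emeasure_subadditive) auto
  also have "\<dots> \<le> vol (E \<inter> B) + (vol H1 + vol H2)"
    by (intro add_left_mono emeasure_subadditive) auto
  also have "\<dots> \<le> vol (E \<inter> B) + (ennreal (b / 4) + ennreal (b / 2))"
    by (intro add_left_mono add_mono H1 H2)
  also have "ennreal (b / 4) + ennreal (b / 2) = ennreal (3 * b / 4)"
    using b by (subst ennreal_plus[symmetric]) auto
  also have "ennreal b = ennreal (3 * b / 4) + ennreal (b / 4)"
    using b by (subst ennreal_plus[symmetric]) auto
  finally have "ennreal (b / 4) \<le> vol (E \<inter> B)"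
    by (simp add: add.commute ennreal_add_left_cancel_le)
  also have "ennreal (b / 4) = ennreal (1 / 4) * ennreal b"
    using b by (subst ennreal_mult[symmetric]) auto
  finally have "ennreal (1 / 4) * vol B \<le> vol (E \<inter> B)" unfolding b(2) .
  moreover have "i \<le> J" using jJ i by simp
  ultimately show thesis using that unfolding E_def B_def by blast
qed

text \<open>The passage value is s = a l. The factor \<phi>(\<open>\<eta>\<^sub>0\<close> / 2)
  forces small balls chosen by the density theorem to have average below s, and a <= 1 /
  \<open>engulf_const\<close> ensures that the average transferred from the ball witnessing
  \<open>mxf W x > l\<close> reaches s.\<close>

lemma decay_level:
  assumes W: "Ainf_weight d \<nu> \<phi> W" and V: "Ainf_weight d \<nu> \<psi> V"
    and \<phi>: "\<And>\<eta>. 0 < \<eta> \<Longrightarrow> 0 < \<phi> \<eta>" and \<psi>: "\<And>\<eta>. 0 < \<eta> \<Longrightarrow> 0 < \<psi> \<eta>"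
    and c: "c \<le> \<phi> (1 / (4 * Cd))" "0 < c"
    and a: "0 < a" "a \<le> 1 / engulf_const" and l: "0 < l"
  shows "wvol V {x \<in> \<S>. ennreal l < mxf W x \<and> W x < ennreal (\<phi> (\<eta>\<^sub>0 / 2) * (a * l))}
    \<le> ennreal (cover_const \<psi> (1 / 4)) * wvol V
        {x \<in> \<S>. ennreal l \<le> ennreal engulf_const * mxf W x \<and>
           ennreal (c * (a * l)) \<le> W x \<and> W x < ennreal (2 * (a * l))}"
proof -
  have Wm [measurable]: "W \<in> borel_measurable \<nu>" and Vm [measurable]: "V \<in> borel_measurable \<nu>"
    using W V by (simp_all add: Ainf_weight_def)
  define s where "s = a * l"
  have s: "0 < s" using a l by (simp add: s_def)
  define t where "t = \<phi> (\<eta>\<^sub>0 / 2)"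
  have t: "0 < t" using \<phi> \<eta>\<^sub>0_pos by (simp add: t_def)
  define F where "F = {x \<in> \<S>. W x < ennreal (t * s)}"
  have Fs [measurable]: "F \<in> sets \<nu>" unfolding F_def by measurable
  define G where "G = {x \<in> \<S>. ennreal (c * s) \<le> W x \<and> W x < ennreal (2 * s)}"
  define E where "E = {x \<in> \<S>. ennreal l \<le> ennreal engulf_const * mxf W x \<and>
           ennreal (c * s) \<le> W x \<and> W x < ennreal (2 * s)}"
  have Es [measurable]: "E \<in> sets \<nu>" unfolding E_def by measurable
  define P where "P = {(y, r) \<in> I. ennreal (1 / 4) * vol (Bl y r) \<le> vol (E \<inter> Bl y r)}"
  have PI: "P \<subseteq> I" by (auto simp: P_def)
  have cP: "countable P" using PI countable_I by (rule countable_subset)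
  have US [measurable]: "balls P \<in> sets \<nu>"
    using cP PI I_sets by (intro sets.countable_UN'') (auto split: prod.splits)
  have in_P: "x \<in> balls P"
    if xF: "x \<in> F" and xl: "ennreal l < mxf W x"
      and dens: "\<forall>R>0. \<exists>y r. (y, r) \<in> I \<and> x \<in> Bl y r \<and> r < R \<and>
            ennreal \<eta>\<^sub>0 * vol (Bl y r) \<le> vol (F \<inter> Bl y r)" for x
  proof -
    obtain y0 r0 where y0: "(y0, r0) \<in> I" "x \<in> Bl y0 r0" "ennreal l < avg y0 r0 W"
      using xl by (rule less_mxfE)
    have "0 < r0" using I_space[OF y0(1)] by simp
    then obtain y r where y: "(y, r) \<in> I" "x \<in> Bl y r" "r < r0"
      "ennreal \<eta>\<^sub>0 * vol (Bl y r) \<le> vol (F \<inter> Bl y r)"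
      using dens by blast
    have yr: "y \<in> \<S>" "0 < r" using I_space[OF y(1)] by auto
    obtain b where b: "0 < b" "vol (Bl y r) = ennreal b" using yr by (rule ball_measure)
    \<comment> \<open>Otherwise W would be below \<phi>(\<open>\<eta>\<^sub>0\<close> / 2) times the
      average on a fraction \<open>\<eta>\<^sub>0\<close> of the ball, whereas the A-infinity
      condition allows at most \<open>\<eta>\<^sub>0\<close> / 2.\<close>
    have low: "avg y r W < ennreal s"
    proof (rule ccontr)
      assume "\<not> avg y r W < ennreal s"
      then have h: "ennreal s \<le> avg y r W" by simp
      have "ennreal (t * s) = ennreal t * ennreal s" using t s by (simp add: ennreal_mult)
      also have "\<dots> \<le> ennreal t * avg y r W" using h by (rule mult_left_mono) simp
      finally have ts: "ennreal (t * s) \<le> ennreal t * avg y r W" .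
      have "F \<inter> Bl y r \<subseteq> {x \<in> Bl y r. W x < ennreal t * avg y r W}"
        using ts by (auto simp: F_def)
      moreover have "{x \<in> Bl y r. W x < ennreal t * avg y r W}
          = {x \<in> \<S>. W x < ennreal t * avg y r W} \<inter> Bl y r" by (auto simp: Bl_iff)
      then have "{x \<in> Bl y r. W x < ennreal t * avg y r W} \<in> sets \<nu>"
        using I_sets[OF y(1)] by simp
      ultimately have "vol (F \<inter> Bl y r) \<le> vol {x \<in> Bl y r. W x < ennreal t * avg y r W}"
        by (rule emeasure_mono)
      also have "\<dots> \<le> ennreal (\<eta>\<^sub>0 / 2) * vol (Bl y r)"
        unfolding t_def using \<eta>\<^sub>0_pos by (intro Ainf_weightD[OF W] Bl_qballs yr) simp
      finally have "ennreal \<eta>\<^sub>0 * ennreal b \<le> ennreal (\<eta>\<^sub>0 / 2) * ennreal b" using y(4) b(2) by simp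
      then have "\<eta>\<^sub>0 * b \<le> \<eta>\<^sub>0 / 2 * b"
        using b \<eta>\<^sub>0_pos by (simp add: ennreal_mult[symmetric] ennreal_le_iff)
      then show False using b \<eta>\<^sub>0_pos by simp
    qed
    obtain J where J: "2 ^ J * r = 2 ^ engulf_exp * r0"
      "avg y0 r0 W \<le> ennreal engulf_const * avg y (2 ^ J * r) W"
      using average_dilate[OF y(1) y0(1) less_imp_le[OF y(3)] y(2) y0(2)] by blast
    have lJ: "ennreal l \<le> ennreal engulf_const * avg y (2 ^ J * r) W"
      using y0(3) J(2) by (meson less_imp_le order_trans)
    have "s \<le> 1 / engulf_const * l" unfolding s_def using a l by (intro mult_right_mono) auto
    then have "ennreal s \<le> ennreal (1 / engulf_const) * ennreal l"
      using l by (subst ennreal_mult''[symmetric]) (auto intro: ennreal_leI)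
    also have "\<dots> \<le> avg y (2 ^ J * r) W"
      using lJ engulf_const_ge_1 ennreal_mult_le_iff_le_inverse[of "1 / engulf_const" "ennreal l"] by auto
    finally obtain i where i: "i \<le> J"
      "ennreal (1 / 4) * vol (Bl y (2 ^ i * r)) \<le> vol (G \<inter> Bl y (2 ^ i * r))"
      unfolding G_def using intermediate_ball[OF W \<phi> c y(1) low s] by blast
    \<comment> \<open>The stopping ball lies in the large dilate, whose average is at least l /
      \<open>engulf_const\<close>; so the bound on \<open>mxf W\<close> required in E holds on the
      whole stopping ball.\<close>
    have "G \<inter> Bl y (2 ^ i * r) = E \<inter> Bl y (2 ^ i * r)"
    proof -
      have "ennreal l \<le> ennreal engulf_const * mxf W z" if z: "z \<in> Bl y (2 ^ i * r)" for z
      proof -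
        have "2 ^ i * r \<le> 2 ^ J * r" using i(1) yr by (intro mult_right_mono) auto
        then have "z \<in> Bl y (2 ^ J * r)" using z Bl_mono by blast
        then have "avg y (2 ^ J * r) W \<le> mxf W z" by (rule average_le_mxf[OF I_double[OF y(1)]])
        then show ?thesis using lJ by (meson mult_left_mono order_trans zero_le)
      qed
      then show ?thesis by (auto simp: G_def E_def)
    qed
    then have "(y, 2 ^ i * r) \<in> P" using i(2) I_double[OF y(1)] by (simp add: P_def)
    moreover have "x \<in> Bl y (2 ^ i * r)"
    proof -
      have "r \<le> 2 ^ i * r" using yr by simp
      then show ?thesis using y(2) Bl_mono by blast
    qed
    ultimately show ?thesis by blast
  qed
  have "AE x in \<nu>. x \<in> {x \<in> \<S>. ennreal l < mxf W x \<and> W x < ennreal (t * s)} \<longrightarrow> x \<in> balls P"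
    using density[OF Fs]
  proof eventually_elim
    case (elim x)
    show ?case
    proof
      assume "x \<in> {x \<in> \<S>. ennreal l < mxf W x \<and> W x < ennreal (t * s)}"
      then show "x \<in> balls P" using elim by (intro in_P) (auto simp: F_def)
    qed
  qed
  then have "AE x in density \<nu> V. x \<in> {x \<in> \<S>. ennreal l < mxf W x \<and> W x < ennreal (t * s)} \<longrightarrow> x \<in> balls P"
    by (subst AE_density) auto
  then have "wvol V {x \<in> \<S>. ennreal l < mxf W x \<and> W x < ennreal (t * s)}
     \<le> wvol V (balls P)"
    by (rule emeasure_mono_AE) simp
  also have "\<dots> \<le> ennreal (cover_const \<psi> (1 / 4)) * wvol V E"
    by (rule weighted_cover[OF V \<psi> _ PI Es]) (auto simp: P_def)
  finally show ?thesis by (simp add: E_def s_def t_def)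
qed

end


section \<open>Comparison with arbitrary balls, and the excess over multiples of a weight\<close>

context dyadic_space
begin

text \<open>Two engulfings account for \<open>2 * engulf_exp\<close>; rounding the radius up to a
  power of two costs one more doubling.\<close>

definition mxf_const :: real where "mxf_const = Cd ^ (2 * engulf_exp + 1)"

text \<open>Rounding up the radius, moving the centre to a nearby point of D and dilating gives a
  ball of I that contains the given ball and has comparable measure.\<close>

lemma average_le_mxf_ball:
  assumes x1: "x1 \<in> \<S>" and r: "0 < r" and x: "x \<in> Bl x1 r"
  shows "avg x1 r W \<le> ennreal mxf_const * mxf W x"
proof -
  define k where "k = \<lceil>log 2 r\<rceil>"
  have rp: "r = 2 powr (log 2 r)" using r by simp
  have kp: "(2::real) powi k = 2 powr (real_of_int k)" by (simp add: powr_real_of_int')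
  have k1: "r \<le> 2 powi k" unfolding kp by (subst rp) (auto simp: k_def intro!: powr_mono)
  have k2: "2 powi k \<le> 2 * r"
  proof -
    have "2 powr (real_of_int k) \<le> 2 powr (1 + log 2 r)" by (intro powr_mono) (auto simp: k_def, linarith)
    also have "\<dots> = 2 * r" using r by (simp add: powr_add)
    finally show ?thesis unfolding kp .
  qed
  define s where "s = (2::real) powi k"
  have s: "0 < s" "r \<le> s" "s \<le> 2 * r" using k1 k2 by (auto simp: s_def)
  obtain y where y: "y \<in> D" "d x1 y < r" using D_dense[OF x1 r] by blast
  have ys: "y \<in> \<S>" using y D_space by blast
  have yI: "(y, 2 ^ engulf_exp * s) \<in> I" using y by (intro I_double) (auto simp: I_def s_def)
  have x1y: "x1 \<in> Bl y s" using y s d_sym[OF x1 ys] x1 by (simp add: Bl_iff)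
  have "x1 \<in> Bl x1 r \<inter> Bl y s" using x1y center_Bl[OF x1 r] by blast
  then have "Bl x1 r \<inter> Bl y s \<noteq> {}" by blast
  then have sub1: "Bl x1 r \<subseteq> Bl y (2 ^ engulf_exp * s)" using engulf[OF x1 ys _ s(2)] by blast
  define R where "R = 2 ^ engulf_exp * s"
  have R: "0 < R" "s \<le> R" using s by (auto simp: R_def)
  have "x1 \<in> Bl y R \<inter> Bl x1 R" using x1y center_Bl[OF x1 R(1)] Bl_mono[OF R(2), of y] by blast
  then have "Bl y R \<inter> Bl x1 R \<noteq> {}" by blast
  then have "Bl y R \<subseteq> Bl x1 (2 ^ engulf_exp * R)" using engulf[OF ys x1, of R R] by simp
  also have "\<dots> \<subseteq> Bl x1 (2 ^ (2 * engulf_exp + 1) * r)"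
  proof (rule Bl_mono)
    have "2 ^ engulf_exp * R = 2 ^ (2 * engulf_exp) * s" by (simp add: R_def mult_2 power_add)
    also have "\<dots> \<le> 2 ^ (2 * engulf_exp) * (2 * r)" using s by (intro mult_left_mono) auto
    finally show "2 ^ engulf_exp * R \<le> 2 ^ (2 * engulf_exp + 1) * r" by simp
  qed
  finally have "vol (Bl y R) \<le> vol (Bl x1 (2 ^ (2 * engulf_exp + 1) * r))"
    using r by (intro emeasure_mono ball_sets x1) auto
  also have "\<dots> \<le> ennreal mxf_const * vol (Bl x1 r)"
    unfolding mxf_const_def by (rule doubling_pow[OF x1 r])
  finally have m: "vol (Bl y R) \<le> ennreal mxf_const * vol (Bl x1 r)" .
  obtain b where b: "0 < b" "vol (Bl x1 r) = ennreal b" using x1 r by (rule ball_measure)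
  have "avg x1 r W * ennreal b \<le> avg y R W * vol (Bl y R)"
    unfolding average_mult[OF ys R(1)] b(2)[symmetric] average_mult[OF x1 r]
    using sub1 by (intro nn_integral_mono) (auto simp: R_def split: split_indicator)
  also have "\<dots> \<le> avg y R W * (ennreal mxf_const * ennreal b)"
    using m b(2) by (intro mult_left_mono) auto
  also have "\<dots> = ennreal mxf_const * avg y R W * ennreal b" by (simp add: mult_ac)
  finally have "ennreal b * avg x1 r W \<le> ennreal b * (ennreal mxf_const * avg y R W)"
    by (simp add: mult_ac)
  then have "avg x1 r W \<le> ennreal mxf_const * avg y R W"
    using b(1) by (subst (asm) ennreal_mult_le_iff_le_inverse)
      (auto simp: mult.assoc[symmetric] ennreal_mult[symmetric])
  also have "\<dots> \<le> ennreal mxf_const * mxf W x"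
    using yI x sub1 by (intro mult_left_mono average_le_mxf) (auto simp: R_def)
  finally show ?thesis .
qed

text \<open>In a ball with nonzero average the zero set of W occupies at most a fraction \<eta> for
  every \<eta>, so it is null. This covers the points where no multiple of W can reach its maximal
  function.\<close>

lemma Ainf_weight_zero:
  assumes W: "Ainf_weight d \<nu> \<phi> W" and \<phi>: "\<And>\<eta>. 0 < \<eta> \<Longrightarrow> 0 < \<phi> \<eta>"
  shows "AE x in \<nu>. W x = 0 \<longrightarrow> mxf W x = 0"
proof -
  have Wm [measurable]: "W \<in> borel_measurable \<nu>" using W by (simp add: Ainf_weight_def)
  have "AE x in \<nu>. x \<in> Bl y r \<longrightarrow> W x = 0 \<longrightarrow> avg y r W = 0" if yI: "(y, r) \<in> I" for y r
  proof (cases "avg y r W = 0")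
    case False
    define Z where "Z = {x \<in> \<S>. W x = 0} \<inter> Bl y r"
    have Bs: "Bl y r \<in> sets \<nu>" using yI by (rule I_sets)
    then have Zs: "Z \<in> sets \<nu>" by (simp add: Z_def)
    have yr: "y \<in> \<S>" "0 < r" using I_space[OF yI] by auto
    obtain b where b: "0 < b" "vol (Bl y r) = ennreal b" using yr by (rule ball_measure)
    have "vol Z \<le> 0 + ennreal e" if e: "0 < e" for e
    proof -
      define \<eta> where "\<eta> = e / b"
      have \<eta>: "0 < \<eta>" using e b by (simp add: \<eta>_def)
      have eq: "{x \<in> Bl y r. W x < ennreal (\<phi> \<eta>) * avg y r W}
          = {x \<in> \<S>. W x < ennreal (\<phi> \<eta>) * avg y r W} \<inter> Bl y r"
        by (auto simp: Bl_iff)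
      have "0 < ennreal (\<phi> \<eta>) * avg y r W"
        using \<phi>[OF \<eta>] False by (simp add: ennreal_zero_less_mult_iff zero_less_iff_neq_zero)
      then have "Z \<subseteq> {x \<in> Bl y r. W x < ennreal (\<phi> \<eta>) * avg y r W}"
        by (auto simp: Z_def)
      then have "vol Z \<le> vol {x \<in> Bl y r. W x < ennreal (\<phi> \<eta>) * avg y r W}"
        using Bs by (intro emeasure_mono) (auto simp: eq)
      also have "\<dots> \<le> ennreal \<eta> * ennreal b"
        using Ainf_weightD[OF W \<eta> Bl_qballs[OF yr]] b(2) by simp
      also have "\<dots> = ennreal e" using b e by (simp add: \<eta>_def ennreal_mult[symmetric])
      finally show ?thesis by simp
    qed
    then have "vol Z \<le> 0" by (rule ennreal_le_epsilon)
    then have "Z \<in> null_sets \<nu>" using Zs by auto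
    then have "AE x in \<nu>. x \<notin> Z" by (rule AE_not_in)
    then show ?thesis by (rule AE_mp) (intro AE_I2, auto simp: Z_def)
  qed simp
  then have "AE x in \<nu>. \<forall>p\<in>I. x \<in> Bl (fst p) (snd p) \<longrightarrow> W x = 0 \<longrightarrow> average \<nu> (Bl (fst p) (snd p)) W = 0"
    by (subst AE_ball_countable[OF countable_I]) auto
  then show ?thesis
  proof eventually_elim
    case (elim x)
    show ?case
    proof
      assume "W x = 0"
      then have "mxf W x \<le> 0" unfolding mxf_def
        using elim by (intro SUP_least) (auto split: split_indicator)
      then show "mxf W x = 0" by simp
    qed
  qed
qed

text \<open>Fix x and count levels. For each of the n values of k the levels in \<open>T k\<close>
  have measure at least the excess. After integration against V they are controlled by
  \<open>T' k\<close>, and the levels in \<open>T' k\<close> are disjoint for different k and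
  bounded by \<open>engulf_const * mxf W x\<close>. So n excesses are paid for by a single integral
  of \<open>mxf W\<close>.\<close>

lemma mxf_excess_decay:
  assumes W: "Ainf_weight d \<nu> \<phi> W" and V: "Ainf_weight d \<nu> \<psi> V"
    and \<phi>: "\<And>\<eta>. 0 < \<eta> \<Longrightarrow> 0 < \<phi> \<eta>" and \<psi>: "\<And>\<eta>. 0 < \<eta> \<Longrightarrow> 0 < \<psi> \<eta>"
    and Wfin: "\<And>x. W x < top"
    and c: "c \<le> \<phi> (1 / (4 * Cd))" "0 < c" "c \<le> 1"
  shows "of_nat n * (\<integral>\<^sup>+x. V x * (mxf W x - ennreal (engulf_const / \<phi> (\<eta>\<^sub>0 / 2) * (2 / c) ^ n) * W x) \<partial>\<nu>)
    \<le> ennreal (cover_const \<psi> (1 / 4) * engulf_const) * (\<integral>\<^sup>+x. V x * mxf W x \<partial>\<nu>)"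
proof -
  have Wm [measurable]: "W \<in> borel_measurable \<nu>" and Vm [measurable]: "V \<in> borel_measurable \<nu>"
    using W V by (simp_all add: Ainf_weight_def)
  define t where "t = \<phi> (\<eta>\<^sub>0 / 2)"
  have t: "0 < t" using \<phi> \<eta>\<^sub>0_pos by (simp add: t_def)
  define C where "C = cover_const \<psi> (1 / 4)"
  have C: "0 \<le> C"
  proof -
    have "0 < \<psi> (1 / 4 / Cd ^ engulf_exp / 2)" using \<psi> Cd_ge_1 by simp
    then show ?thesis using Cd_ge_1 by (simp add: C_def cover_const_def)
  qed
  note A = engulf_const_ge_1
  \<comment> \<open>The ratio c / 2 makes the bands from c \<alpha>(k) l to 2 \<alpha>(k) l
    disjoint, and 1 / \<open>engulf_const\<close> is the largest factor that
    \<open>decay_level\<close> admits.\<close>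
  define \<alpha> where "\<alpha> k = (c / 2) ^ k / engulf_const" for k
  have \<alpha>: "0 < \<alpha> k" "\<alpha> k \<le> 1 / engulf_const" for k
    using c A by (auto simp: \<alpha>_def divide_right_mono power_le_one)
  have \<alpha>_step: "2 * \<alpha> k \<le> c * \<alpha> j" if "j < k" for j k
  proof -
    have "(c / 2) ^ k \<le> (c / 2) ^ Suc j" using that c by (intro power_decreasing) auto
    then have "(c / 2) ^ k / engulf_const \<le> (c / 2) ^ Suc j / engulf_const"
      using A by (intro divide_right_mono) auto
    then show ?thesis by (simp add: \<alpha>_def)
  qed
  \<comment> \<open>Chosen so that W x < t \<alpha>(k) l fails, for l > 0, exactly when l <=
    \<tau>(k) W x.\<close>
  define \<tau> where "\<tau> k = 1 / (t * \<alpha> k)" for k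
  have \<tau>: "0 < \<tau> k" for k using t \<alpha> by (simp add: \<tau>_def)
  have \<tau>_eq: "\<tau> n = engulf_const / t * (2 / c) ^ n"
    using c A by (simp add: \<tau>_def \<alpha>_def power_divide)
  have \<tau>_mono: "\<tau> k \<le> \<tau> n" if "k < n" for k
  proof -
    have "2 * \<alpha> n \<le> 1 * \<alpha> k" using \<alpha>_step[OF that] mult_right_mono[OF c(3), of "\<alpha> k"] \<alpha>(1)[of k] by linarith
    then have "\<alpha> n \<le> \<alpha> k" using \<alpha>(1)[of n] by linarith
    then show ?thesis unfolding \<tau>_def using t \<alpha> by (intro divide_left_mono mult_left_mono) auto
  qed
  define T where "T k = {z \<in> space (\<nu> \<Otimes>\<^sub>M lborel). 0 < snd z \<and> ennreal (snd z) < mxf W (fst z) \<and>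
    W (fst z) < ennreal (t * (\<alpha> k * snd z))}" for k
  define T' where "T' k = {z \<in> space (\<nu> \<Otimes>\<^sub>M lborel). 0 < snd z \<and>
    ennreal (snd z) \<le> ennreal engulf_const * mxf W (fst z) \<and>
    ennreal (c * (\<alpha> k * snd z)) \<le> W (fst z) \<and> W (fst z) < ennreal (2 * (\<alpha> k * snd z))}" for k
  have Ts [measurable]: "T k \<in> sets (\<nu> \<Otimes>\<^sub>M lborel)" "T' k \<in> sets (\<nu> \<Otimes>\<^sub>M lborel)" for k
    unfolding T_def T'_def by measurable
  have step: "(\<integral>\<^sup>+x. V x * emeasure lborel {l. (x, l) \<in> T k} \<partial>\<nu>)
       \<le> ennreal C * (\<integral>\<^sup>+x. V x * emeasure lborel {l. (x, l) \<in> T' k} \<partial>\<nu>)" for k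
  proof (rule Fubini_sections[OF Vm Ts])
    fix l :: real
    show "wvol V {x \<in> \<S>. (x, l) \<in> T k}
       \<le> ennreal C * wvol V {x \<in> \<S>. (x, l) \<in> T' k}"
    proof (cases "0 < l")
      case True
      then have "{x \<in> \<S>. (x, l) \<in> T k}
          = {x \<in> \<S>. ennreal l < mxf W x \<and> W x < ennreal (t * (\<alpha> k * l))}"
        "{x \<in> \<S>. (x, l) \<in> T' k} = {x \<in> \<S>. ennreal l \<le> ennreal engulf_const * mxf W x \<and>
           ennreal (c * (\<alpha> k * l)) \<le> W x \<and> W x < ennreal (2 * (\<alpha> k * l))}"
        by (auto simp: T_def T'_def space_pair_measure)
      then show ?thesis using decay_level[OF W V \<phi> \<psi> c(1,2) \<alpha> True] by (simp add: t_def C_def)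
    next
      case False
      then have "{x \<in> \<S>. (x, l) \<in> T k} = {}" by (auto simp: T_def)
      then show ?thesis by (simp only: emeasure_empty zero_le)
    qed
  qed
  have low: "mxf W x - ennreal (\<tau> n) * W x \<le> emeasure lborel {l. (x, l) \<in> T k}"
    if x: "x \<in> \<S>" and k: "k < n" for x k
  proof -
    have Tx: "{l. (x, l) \<in> T k} = {l. 0 < l \<and> ennreal l < mxf W x \<and> W x < ennreal (t * (\<alpha> k * l))}"
      using x by (auto simp: T_def space_pair_measure)
    have "mxf W x = emeasure lborel {l. 0 < l \<and> ennreal l < mxf W x}" by (simp add: emeasure_below)
    also have "\<dots> \<le> emeasure lborel ({l. 0 < l \<and> ennreal l \<le> ennreal (\<tau> k) * W x} \<union> {l. (x, l) \<in> T k})"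
    proof (rule emeasure_mono)
      show "{l. 0 < l \<and> ennreal l < mxf W x} \<subseteq> {l. 0 < l \<and> ennreal l \<le> ennreal (\<tau> k) * W x} \<union> {l. (x, l) \<in> T k}"
      proof
        fix l assume l: "l \<in> {l. 0 < l \<and> ennreal l < mxf W x}"
        show "l \<in> {l. 0 < l \<and> ennreal l \<le> ennreal (\<tau> k) * W x} \<union> {l. (x, l) \<in> T k}"
        proof (cases "W x < ennreal (t * (\<alpha> k * l))")
          case False
          then have "ennreal (t * \<alpha> k) * ennreal l \<le> W x"
            using l t \<alpha>(1)[of k] by (simp add: ennreal_mult[symmetric] mult.assoc)
          then have "ennreal l \<le> ennreal (\<tau> k) * W x"
            unfolding \<tau>_def by (subst (asm) ennreal_mult_le_iff_le_inverse) (use t \<alpha> in auto)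
          then show ?thesis using l by simp
        qed (use l Tx in auto)
      qed
      show "{l. 0 < l \<and> ennreal l \<le> ennreal (\<tau> k) * W x} \<union> {l. (x, l) \<in> T k} \<in> sets lborel"
        unfolding Tx by measurable
    qed
    also have "\<dots> \<le> emeasure lborel {l. 0 < l \<and> ennreal l \<le> ennreal (\<tau> k) * W x} + emeasure lborel {l. (x, l) \<in> T k}"
      unfolding Tx by (rule emeasure_subadditive) measurable
    also have "emeasure lborel {l. 0 < l \<and> ennreal l \<le> ennreal (\<tau> k) * W x} = ennreal (\<tau> k) * W x"
      by (rule emeasure_below_le)
    also have "\<dots> \<le> ennreal (\<tau> n) * W x" using \<tau>_mono[OF k] by (intro mult_right_mono ennreal_leI) auto
    finally have le: "mxf W x \<le> ennreal (\<tau> n) * W x + emeasure lborel {l. (x, l) \<in> T k}"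
      by (simp add: add_right_mono)
    \<comment> \<open>Finiteness excludes \<infinity> - \<infinity>, which is \<infinity> in
      \<open>ennreal\<close>.\<close>
    have "ennreal (\<tau> n) * W x < top" using Wfin[of x] by (simp add: ennreal_mult_less_top)
    then show ?thesis using le unfolding ennreal_minus_le_iff by fastforce
  qed
  have up: "(\<Sum>k<n. emeasure lborel {l. (x, l) \<in> T' k}) \<le> ennreal engulf_const * mxf W x"
    if x: "x \<in> \<S>" for x
  proof -
    have Tx: "{l. (x, l) \<in> T' k} = {l. 0 < l \<and> ennreal l \<le> ennreal engulf_const * mxf W x \<and>
       ennreal (c * (\<alpha> k * l)) \<le> W x \<and> W x < ennreal (2 * (\<alpha> k * l))}" for k
      using x by (auto simp: T'_def space_pair_measure)
    have m: "{l. (x, l) \<in> T' k} \<in> sets lborel" for k unfolding Tx by measurable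
    have disj: "{l. (x, l) \<in> T' j} \<inter> {l. (x, l) \<in> T' k} = {}" if "j < k" for j k
    proof (rule ccontr)
      assume "{l. (x, l) \<in> T' j} \<inter> {l. (x, l) \<in> T' k} \<noteq> {}"
      then obtain l where l: "0 < l" "ennreal (c * (\<alpha> j * l)) \<le> W x" "W x < ennreal (2 * (\<alpha> k * l))"
        unfolding Tx by auto
      have "2 * \<alpha> k * l \<le> c * \<alpha> j * l" using \<alpha>_step[OF that] l(1) by (intro mult_right_mono) auto
      then have "ennreal (2 * (\<alpha> k * l)) \<le> ennreal (c * (\<alpha> j * l))" by (intro ennreal_leI) (simp add: mult.assoc)
      then show False using l by (meson less_le_trans order_less_irrefl order_trans)
    qed
    have "disjoint_family_on (\<lambda>k. {l. (x, l) \<in> T' k}) {..<n}"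
      unfolding disjoint_family_on_def using disj by (metis Int_commute linorder_neqE_nat)
    then have "(\<Sum>k<n. emeasure lborel {l. (x, l) \<in> T' k}) = emeasure lborel (\<Union>k<n. {l. (x, l) \<in> T' k})"
      using m by (intro sum_emeasure) auto
    also have "\<dots> \<le> emeasure lborel {l. 0 < l \<and> ennreal l \<le> ennreal engulf_const * mxf W x}"
      unfolding Tx by (intro emeasure_mono) auto
    finally show ?thesis by (simp add: emeasure_below_le)
  qed
  have m': "(\<lambda>x. V x * emeasure lborel {l. (x, l) \<in> T' k}) \<in> borel_measurable \<nu>" for k
    using lborel.measurable_emeasure_Pair[OF Ts(2)[of k]] by (simp add: vimage_def)
  have "of_nat n * (\<integral>\<^sup>+x. V x * (mxf W x - ennreal (\<tau> n) * W x) \<partial>\<nu>)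
      = (\<Sum>k<n. (\<integral>\<^sup>+x. V x * (mxf W x - ennreal (\<tau> n) * W x) \<partial>\<nu>))" by simp
  also have "\<dots> \<le> (\<Sum>k<n. (\<integral>\<^sup>+x. V x * emeasure lborel {l. (x, l) \<in> T k} \<partial>\<nu>))"
    using low by (intro sum_mono nn_integral_mono mult_left_mono) auto
  also have "\<dots> \<le> (\<Sum>k<n. ennreal C * (\<integral>\<^sup>+x. V x * emeasure lborel {l. (x, l) \<in> T' k} \<partial>\<nu>))"
    by (intro sum_mono step)
  also have "\<dots> = ennreal C * (\<integral>\<^sup>+x. (\<Sum>k<n. V x * emeasure lborel {l. (x, l) \<in> T' k}) \<partial>\<nu>)"
    using m' by (simp add: sum_distrib_left nn_integral_sum)
  also have "\<dots> \<le> ennreal C * (\<integral>\<^sup>+x. ennreal engulf_const * (V x * mxf W x) \<partial>\<nu>)"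
  proof (intro mult_left_mono nn_integral_mono)
    fix x assume "x \<in> \<S>"
    then have "V x * (\<Sum>k<n. emeasure lborel {l. (x, l) \<in> T' k}) \<le> V x * (ennreal engulf_const * mxf W x)"
      by (intro mult_left_mono up) auto
    then show "(\<Sum>k<n. V x * emeasure lborel {l. (x, l) \<in> T' k}) \<le> ennreal engulf_const * (V x * mxf W x)"
      by (simp add: sum_distrib_left mult_ac)
  qed simp
  also have "\<dots> = ennreal C * (ennreal engulf_const * (\<integral>\<^sup>+x. V x * mxf W x \<partial>\<nu>))"
    by (subst nn_integral_cmult) auto
  also have "\<dots> = ennreal (C * engulf_const) * (\<integral>\<^sup>+x. V x * mxf W x \<partial>\<nu>)"
    using C A by (simp add: mult.assoc[symmetric] ennreal_mult[symmetric])
  finally show ?thesis unfolding \<tau>_eq t_def C_def .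
qed

text \<open>The order of the quantifiers is the point: C and \<tau> depend only on the two moduli,
  so the same constants serve almost all sections of all majorants.\<close>

lemma weight_estimates:
  assumes \<phi>: "\<And>\<eta>. 0 < \<eta> \<Longrightarrow> 0 < \<phi> \<eta>" and \<psi>: "\<And>\<eta>. 0 < \<eta> \<Longrightarrow> 0 < \<psi> \<eta>"
  obtains C :: real and \<tau> :: "nat \<Rightarrow> real" where "0 \<le> C" "mono \<tau>" "\<And>n. 0 < \<tau> n" "\<And>b. \<exists>n. b < \<tau> n"
    and "\<And>W V. Ainf_weight d \<nu> \<phi> W \<Longrightarrow> Ainf_weight d \<nu> \<psi> V \<Longrightarrow>
      (\<integral>\<^sup>+x. V x * mxf W x \<partial>\<nu>) \<le> ennreal C * (\<integral>\<^sup>+x. V x * W x \<partial>\<nu>)"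
    and "\<And>W V n. Ainf_weight d \<nu> \<phi> W \<Longrightarrow> Ainf_weight d \<nu> \<psi> V \<Longrightarrow> (\<And>x. W x < top) \<Longrightarrow>
      of_nat n * (\<integral>\<^sup>+x. V x * (mxf W x - ennreal (\<tau> n) * W x) \<partial>\<nu>) \<le> ennreal C * (\<integral>\<^sup>+x. V x * W x \<partial>\<nu>)"
proof -
  define C1 where "C1 = cover_const \<psi> (1 / 2) / \<phi> (1 / 2)"
  define C2 where "C2 = cover_const \<psi> (1 / 4) * engulf_const"
  have cc: "0 \<le> cover_const \<psi> \<theta>" if "0 < \<theta>" for \<theta>
  proof -
    have "0 < \<psi> (\<theta> / Cd ^ engulf_exp / 2)" using \<psi> Cd_ge_1 that by simp
    then show ?thesis using Cd_ge_1 that by (simp add: cover_const_def)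
  qed
  have C1: "0 \<le> C1" using cc[of "1/2"] \<phi>[of "1/2"] by (simp add: C1_def)
  have C2: "0 \<le> C2" using cc[of "1/4"] engulf_const_ge_1 by (simp add: C2_def)
  \<comment> \<open>The decay estimate has the integral of \<open>V x * mxf W x\<close> on its
    right; the first bound converts it into that of \<open>V x * W x\<close>, whence the product of
    the constants.\<close>
  define C where "C = max C1 (C2 * C1)"
  have C: "0 \<le> C" "ennreal C1 \<le> ennreal C" "ennreal C2 * ennreal C1 \<le> ennreal C"
    using C1 C2 by (auto simp: C_def ennreal_mult[symmetric] intro!: ennreal_leI)
  define c where "c = min 1 (\<phi> (1 / (4 * Cd)))"
  have c: "c \<le> \<phi> (1 / (4 * Cd))" "0 < c" "c \<le> 1" using \<phi>[of "1 / (4 * Cd)"] Cd_ge_1 by (auto simp: c_def)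
  define a where "a = engulf_const / \<phi> (\<eta>\<^sub>0 / 2)"
  have a: "0 < a" using engulf_const_ge_1 \<phi>[of "\<eta>\<^sub>0 / 2"] \<eta>\<^sub>0_pos by (simp add: a_def)
  define \<tau> where "\<tau> n = a * (2 / c) ^ n" for n
  have c2: "2 \<le> 2 / c" using c by (simp add: field_simps)
  show thesis
  proof
    show "0 \<le> C" by (rule C)
    show "mono \<tau>" unfolding mono_def \<tau>_def using a c2 by (auto intro!: mult_left_mono power_increasing)
    show "0 < \<tau> n" for n using a c by (simp add: \<tau>_def)
    show "\<exists>n. b < \<tau> n" for b
    proof -
      obtain n where "b / a < (2 / c) ^ n" using real_arch_pow[of "2 / c" "b / a"] c2 by auto
      then show ?thesis using a by (intro exI[of _ n]) (simp add: \<tau>_def field_simps)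
    qed
    show bound: "(\<integral>\<^sup>+x. V x * mxf W x \<partial>\<nu>) \<le> ennreal C * (\<integral>\<^sup>+x. V x * W x \<partial>\<nu>)"
      if "Ainf_weight d \<nu> \<phi> W" "Ainf_weight d \<nu> \<psi> V" for W V
    proof -
      have "(\<integral>\<^sup>+x. V x * mxf W x \<partial>\<nu>) \<le> ennreal C1 * (\<integral>\<^sup>+x. V x * W x \<partial>\<nu>)"
        unfolding C1_def by (rule mxf_weighted_bound[OF that \<phi> \<psi>])
      also have "\<dots> \<le> ennreal C * (\<integral>\<^sup>+x. V x * W x \<partial>\<nu>)" by (intro mult_right_mono C) simp
      finally show ?thesis .
    qed
    show "of_nat n * (\<integral>\<^sup>+x. V x * (mxf W x - ennreal (\<tau> n) * W x) \<partial>\<nu>) \<le> ennreal C * (\<integral>\<^sup>+x. V x * W x \<partial>\<nu>)"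
      if W: "Ainf_weight d \<nu> \<phi> W" and V: "Ainf_weight d \<nu> \<psi> V" and fin: "\<And>x. W x < top" for W V n
    proof -
      have "of_nat n * (\<integral>\<^sup>+x. V x * (mxf W x - ennreal (\<tau> n) * W x) \<partial>\<nu>)
          \<le> ennreal C2 * (\<integral>\<^sup>+x. V x * mxf W x \<partial>\<nu>)"
        using mxf_excess_decay[OF W V \<phi> \<psi> fin c, of n] by (simp add: C2_def \<tau>_def a_def)
      also have "\<dots> \<le> ennreal C2 * (ennreal C1 * (\<integral>\<^sup>+x. V x * W x \<partial>\<nu>))"
        using mxf_weighted_bound[OF W V \<phi> \<psi>] by (intro mult_left_mono) (auto simp: C1_def)
      also have "\<dots> \<le> ennreal C * (\<integral>\<^sup>+x. V x * W x \<partial>\<nu>)"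
        unfolding mult.assoc[symmetric] by (intro mult_right_mono C) simp
      finally show ?thesis .
    qed
  qed
qed

end


section \<open>Sections of functions on the product\<close>

context doubling_space
begin

text \<open>Let a and i be the averages of W and of its power with exponent -1 / (p - 1). Chebyshev
  for that power shows that W < \<phi> a holds on at most a fraction i (\<phi> a)^(1 / (p - 1)),
  whose power with exponent p - 1 is at most \<phi> C. The modulus is solved from this; C + 1
  instead of C avoids a division by zero.\<close>

lemma Ap_Ainf_weight:
  assumes Wm [measurable]: "W \<in> borel_measurable \<nu>" and fin: "\<And>x. W x < top" and p: "1 < p" and C: "0 \<le> C"
    and Ap: "\<And>B. B \<in> qballs d \<nu> \<Longrightarrow>
      average \<nu> B W * epowr (average \<nu> B (\<lambda>x. epowr (W x) (- 1 / (p - 1)))) (p - 1) \<le> ennreal C"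
  shows "Ainf_weight d \<nu> (\<lambda>\<eta>. \<eta> powr (p - 1) / (C + 1)) W"
  unfolding Ainf_weight_def
proof (intro conjI allI impI ballI Wm)
  fix \<eta> :: real and B assume \<eta>: "0 < \<eta>" and B: "B \<in> qballs d \<nu>"
  obtain x0 r where x0: "x0 \<in> \<S>" "0 < r" and B_eq: "B = Bl x0 r"
    using B by (auto simp: qballs_def)
  obtain b where b: "0 < b" "vol B = ennreal b" unfolding B_eq using x0 by (rule ball_measure)
  have Bs [measurable]: "B \<in> sets \<nu>" unfolding B_eq using x0 by (rule ball_sets)
  define \<epsilon> where "\<epsilon> = 1 / (p - 1)"
  have \<epsilon>: "0 < \<epsilon>" "- 1 / (p - 1) = - \<epsilon>" using p by (auto simp: \<epsilon>_def)
  define G where "G x = epowr (W x) (- \<epsilon>)" for x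
  have G_eq: "G x = (if W x = 0 then top else ennreal (enn2real (W x) powr (- \<epsilon>)))" for x
    using \<epsilon> fin[of x] by (auto simp: G_def epowr_def)
  have Gm [measurable]: "G \<in> borel_measurable \<nu>" unfolding G_eq[abs_def] by measurable
  define a where "a = average \<nu> B W"
  define i where "i = average \<nu> B G"
  have ap: "a * epowr i (p - 1) \<le> ennreal C"
    using Ap[OF B] unfolding a_def i_def G_def \<epsilon>(2) .
  define \<phi> where "\<phi> = \<eta> powr (p - 1) / (C + 1)"
  have \<phi>: "0 < \<phi>" using \<eta> C by (simp add: \<phi>_def)
  define H where "H = {x \<in> B. W x < ennreal \<phi> * a}"
  have "H = {x \<in> \<S>. W x < ennreal \<phi> * a} \<inter> B"
    using sets.sets_into_space[OF Bs] by (auto simp: H_def)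
  then have Hs [measurable]: "H \<in> sets \<nu>" by simp
  have i_int: "i * ennreal b = (\<integral>\<^sup>+x. G x * indicator B x \<partial>\<nu>)"
    unfolding i_def b(2)[symmetric] B_eq by (rule average_mult[OF x0])
  \<comment> \<open>As W is finite, its negative power is positive. Without i > 0 the convention 0 *
    \<infinity> = 0 would let the Ap bound hold with an infinite average of W.\<close>
  have ipos: "i \<noteq> 0"
  proof
    assume "i = 0"
    then have "(\<integral>\<^sup>+x. G x * indicator B x \<partial>\<nu>) = 0" using i_int by simp
    then have "AE x in \<nu>. G x * indicator B x = 0" by (subst (asm) nn_integral_0_iff_AE) auto
    moreover have "G x \<noteq> 0" for x
    proof -
      have "enn2real (W x) \<noteq> 0" if "W x \<noteq> 0" using that fin[of x] by (simp add: enn2real_eq_0_iff)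
      then show ?thesis by (auto simp: G_eq ennreal_eq_0_iff)
    qed
    ultimately have "AE x in \<nu>. x \<notin> B" by (auto split: split_indicator_asm elim: AE_mp)
    then have "vol B = 0"
      using sets.sets_into_space[OF Bs] by (subst (asm) AE_iff_measurable[OF Bs]) auto
    then show False using b by simp
  qed
  have "vol H \<le> ennreal \<eta> * ennreal b"
  proof (cases "a = 0")
    case True
    then have "H = {}" by (simp add: H_def)
    then show ?thesis by simp
  next
    case a0: False
    have atop: "a \<noteq> top"
    proof
      assume "a = top"
      moreover have "epowr i (p - 1) \<noteq> 0"
        using ipos p by (auto simp: epowr_def enn2real_eq_0_iff ennreal_eq_0_iff)
      ultimately have "a * epowr i (p - 1) = top" by (simp add: ennreal_top_mult)
      then show False using ap by (simp add: top_unique)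
    qed
    have itop: "i \<noteq> top"
    proof
      assume "i = top"
      then have "epowr i (p - 1) = top" using p by (simp add: epowr_def)
      then have "a * epowr i (p - 1) = top" using a0 by (simp add: ennreal_mult_top)
      then show False using ap by (simp add: top_unique)
    qed
    define a' where "a' = enn2real a"
    define i' where "i' = enn2real i"
    have a': "a = ennreal a'" "0 < a'" using a0 atop
      by (auto simp: a'_def ennreal_enn2real_if enn2real_positive_iff zero_less_iff_neq_zero less_top)
    have i': "i = ennreal i'" "0 < i'" using ipos itop
      by (auto simp: i'_def ennreal_enn2real_if enn2real_positive_iff zero_less_iff_neq_zero less_top)
    have "epowr i (p - 1) = ennreal (i' powr (p - 1))" using i' p by (simp add: epowr_def)
    then have ap': "a' * i' powr (p - 1) \<le> C"
      using ap a' C by (simp add: ennreal_mult[symmetric])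
    define g where "g = (\<phi> * a') powr (- \<epsilon>)"
    have g: "0 < g" using \<phi> a' by (simp add: g_def)
    have low: "ennreal g \<le> G x" if x: "x \<in> H" for x
    proof (cases "W x = 0")
      case False
      define y where "y = enn2real (W x)"
      have y: "W x = ennreal y" "0 < y" using False fin[of x]
        by (auto simp: y_def ennreal_enn2real_if enn2real_positive_iff zero_less_iff_neq_zero less_top)
      have "ennreal y < ennreal (\<phi> * a')" using x y a' \<phi> by (simp add: H_def ennreal_mult)
      then have "y < \<phi> * a'" using y by (simp add: ennreal_less_iff)
      then have "g \<le> y powr (- \<epsilon>)" unfolding g_def using y \<epsilon> by (intro powr_mono2') auto
      then show ?thesis using False by (simp add: G_eq y_def ennreal_leI)
    qed (simp add: G_eq)
    have "ennreal g * vol H = (\<integral>\<^sup>+x. ennreal g * indicator H x \<partial>\<nu>)"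
      by (simp add: nn_integral_cmult_indicator)
    also have "\<dots> \<le> (\<integral>\<^sup>+x. G x * indicator B x \<partial>\<nu>)"
      using low by (intro nn_integral_mono) (auto simp: H_def split: split_indicator)
    also have "\<dots> = ennreal i' * ennreal b" using i_int i' by simp
    finally have "vol H \<le> ennreal (1 / g) * (ennreal i' * ennreal b)"
      using g by (subst (asm) ennreal_mult_le_iff_le_inverse) auto
    also have "\<dots> = ennreal (i' / g) * ennreal b"
      using g i' b by (simp add: ennreal_mult[symmetric])
    also have "\<dots> \<le> ennreal \<eta> * ennreal b"
    proof (intro mult_right_mono ennreal_leI)
      have g': "1 / g = (\<phi> * a') powr \<epsilon>" using \<phi> a' by (simp add: g_def powr_minus_divide)
      have "((\<phi> * a') powr \<epsilon>) powr (p - 1) = \<phi> * a'"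
        using \<phi> a' p by (simp add: powr_powr \<epsilon>_def)
      moreover have "i' / g = i' * (\<phi> * a') powr \<epsilon>" unfolding g'[symmetric] by simp
      moreover have "(i' * (\<phi> * a') powr \<epsilon>) powr (p - 1) = i' powr (p - 1) * ((\<phi> * a') powr \<epsilon>) powr (p - 1)"
        using i' by (intro powr_mult)
      ultimately have "(i' / g) powr (p - 1) = \<phi> * (a' * i' powr (p - 1))" by (simp only: mult_ac)
      also have "\<dots> \<le> \<phi> * C" using ap' \<phi> by (intro mult_left_mono) auto
      also have "\<dots> \<le> \<phi> * (C + 1)" using \<phi> by (intro mult_left_mono) auto
      also have "\<dots> = \<eta> powr (p - 1)" using C by (simp add: \<phi>_def)
      finally have le: "(i' / g) powr (p - 1) \<le> \<eta> powr (p - 1)" .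
      show "i' / g \<le> \<eta>"
      proof (rule ccontr)
        assume "\<not> i' / g \<le> \<eta>"
        then have "\<eta> powr (p - 1) < (i' / g) powr (p - 1)" using \<eta> p by (intro powr_less_mono2) auto
        then show False using le by simp
      qed
    qed simp
    finally show ?thesis .
  qed
  then show "vol {x \<in> B. W x < ennreal (\<eta> powr (p - 1) / (C + 1)) * average \<nu> B W}
      \<le> ennreal \<eta> * vol B"
    unfolding H_def a_def \<phi>_def b(2) .
qed

text \<open>Almost everywhere on a ball the average is at most C times W, so the exceptional set is
  null for every \<eta>. Hence the modulus can be constant.\<close>

lemma A1_Ainf_weight:
  assumes Wm [measurable]: "W \<in> borel_measurable \<nu>" and fin: "\<And>x. W x < top" and C: "0 \<le> C"
    and A1: "AE x in \<nu>. \<forall>B\<in>qballs d \<nu>. x \<in> B \<longrightarrow> average \<nu> B W \<le> ennreal C * W x"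
  shows "Ainf_weight d \<nu> (\<lambda>\<eta>. 1 / (C + 1)) W"
  unfolding Ainf_weight_def
proof (intro conjI allI impI ballI Wm)
  fix \<eta> :: real and B assume \<eta>: "0 < \<eta>" and B: "B \<in> qballs d \<nu>"
  have Bs [measurable]: "B \<in> sets \<nu>" using B ball_sets by (auto simp: qballs_def)
  define a where "a = average \<nu> B W"
  define H where "H = {x \<in> B. W x < ennreal (1 / (C + 1)) * a}"
  have "H = {x \<in> \<S>. W x < ennreal (1 / (C + 1)) * a} \<inter> B"
    using sets.sets_into_space[OF Bs] by (auto simp: H_def)
  then have Hs: "H \<in> sets \<nu>" by simp
  have "AE x in \<nu>. x \<notin> H"
    using A1
  proof eventually_elim
    case (elim x)
    show "x \<notin> H"
    proof
      assume x: "x \<in> H"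
      then have "a \<le> ennreal C * W x" using elim B by (auto simp: H_def a_def)
      moreover have "W x < ennreal (1 / (C + 1)) * a" using x by (simp add: H_def)
      moreover have "ennreal (1 / (C + 1)) * a \<le> W x \<longleftrightarrow> a \<le> ennreal (C + 1) * W x"
        using ennreal_mult_le_iff_le_inverse[of "1 / (C + 1)" a "W x"] C by (simp del: ennreal_plus)
      ultimately have "\<not> a \<le> ennreal (C + 1) * W x" "a \<le> ennreal C * W x" by auto
      moreover have "ennreal C * W x \<le> ennreal (C + 1) * W x"
        by (intro mult_right_mono ennreal_leI) auto
      ultimately show False by (meson order_trans)
    qed
  qed
  then have "vol H = 0"
    using sets.sets_into_space[OF Hs] by (subst (asm) AE_iff_measurable[OF Hs]) auto
  then show "vol {x \<in> B. W x < ennreal (1 / (C + 1)) * average \<nu> B W} \<le> ennreal \<eta> * vol B"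
    by (simp add: H_def a_def)
qed

end

section \<open>Weights and the maximal function on the product space\<close>

locale product_space = dyadic_space d \<nu> K Cd D
  for d :: "'s \<Rightarrow> 's \<Rightarrow> real" and \<nu> :: "'s measure" and K Cd :: real and D :: "'s set" +
  fixes \<mu> :: "'o measure"
  assumes sigma_finite_mu: "sigma_finite_measure \<mu>"
begin

abbreviation P :: "('s \<times> 'o) measure" where "P \<equiv> \<nu> \<Otimes>\<^sub>M \<mu>"

sublocale \<nu>: sigma_finite_measure \<nu> by (rule sigma_finite_nu)
sublocale \<mu>: sigma_finite_measure \<mu> by (rule sigma_finite_mu)
sublocale pair_sigma_finite \<nu> \<mu> ..

lemma AE_sections:
  assumes "AE z in P. Q z"
  shows "AE \<omega> in \<mu>. AE x in \<nu>. Q (x, \<omega>)"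
proof -
  interpret s: pair_sigma_finite \<mu> \<nu> ..
  have "AE z in distr (\<mu> \<Otimes>\<^sub>M \<nu>) P (\<lambda>(x, y). (y, x)). Q z"
    unfolding distr_pair_swap[symmetric] by (rule assms)
  then have "AE z in \<mu> \<Otimes>\<^sub>M \<nu>. Q (case z of (x, y) \<Rightarrow> (y, x))"
    by (intro AE_distrD[where f = "\<lambda>(x, y). (y, x)"]) auto
  then show ?thesis using s.AE_pair by fastforce
qed

lemma AE_of_sections:
  assumes "{z \<in> space P. Q z} \<in> sets P" "AE \<omega> in \<mu>. AE x in \<nu>. Q (x, \<omega>)"
  shows "AE z in P. Q z"
proof (rule AE_pair_measure[OF assms(1)])
  have "{z \<in> space P. Q (fst z, snd z)} \<in> sets P" using assms(1) by simp
  from AE_commute[OF this] show "AE x in \<nu>. AE y in \<mu>. Q (x, y)" using assms(2) by simp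
qed

text \<open>The modulus is chosen before the weight and depends only on p and C.\<close>

lemma Ap_const_Ainf_weight:
  assumes p: "1 \<le> p"
  obtains \<phi> where "\<And>\<eta>. 0 < \<eta> \<Longrightarrow> 0 < \<phi> \<eta>"
    and "\<And>w. w \<in> borel_measurable P \<Longrightarrow> Ap_const d \<nu> \<mu> p w \<le> ennreal C \<Longrightarrow>
      AE \<omega> in \<mu>. Ainf_weight d \<nu> \<phi> (\<lambda>x. ennreal (w (x, \<omega>)))"
proof -
  \<comment> \<open>The Muckenhoupt constants are infima; passing to C' > C gives an actual almost
    everywhere bound with a constant below C'.\<close>
  define C' where "C' = \<bar>C\<bar> + 1"
  have "ennreal C \<le> ennreal \<bar>C\<bar>" by (intro ennreal_leI) simp
  also have "\<dots> < ennreal C'" unfolding C'_def by (intro ennreal_lessI) auto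
  finally have C': "0 \<le> C'" "ennreal C < ennreal C'" by (auto simp: C'_def)
  have sec: "(\<lambda>x. ennreal (w (x, \<omega>))) \<in> borel_measurable \<nu>"
    if "w \<in> borel_measurable P" "\<omega> \<in> space \<mu>" for w :: "'s \<times> 'o \<Rightarrow> real" and \<omega>
    using that by (auto intro!: measurable_compose[OF _ measurable_ennreal] measurable_Pair2)
  show thesis
  proof (cases "p = 1")
    case True
    show thesis
    proof (rule that)
      show "0 < (\<lambda>\<eta>::real. 1 / (C' + 1)) \<eta>" for \<eta> using C' by simp
      fix w :: "'s \<times> 'o \<Rightarrow> real"
      assume w: "w \<in> borel_measurable P" and "Ap_const d \<nu> \<mu> p w \<le> ennreal C"
      then have "A1_const d \<nu> \<mu> w < ennreal C'"
        using True C' by (auto simp: Ap_const_def)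
      then obtain c where c: "AE z in P. maximal_function d \<nu> w z \<le> c * ennreal (w z)" "c < ennreal C'"
        by (auto simp: A1_const_def Inf_less_iff)
      have "AE \<omega> in \<mu>. AE x in \<nu>. maximal_function d \<nu> w (x, \<omega>) \<le> c * ennreal (w (x, \<omega>))"
        using c(1) by (rule AE_sections)
      then show "AE \<omega> in \<mu>. Ainf_weight d \<nu> (\<lambda>\<eta>. 1 / (C' + 1)) (\<lambda>x. ennreal (w (x, \<omega>)))"
      proof (rule AE_mp, intro AE_I2 impI)
        fix \<omega> assume \<omega>: "\<omega> \<in> space \<mu>"
          and AE: "AE x in \<nu>. maximal_function d \<nu> w (x, \<omega>) \<le> c * ennreal (w (x, \<omega>))"
        show "Ainf_weight d \<nu> (\<lambda>\<eta>. 1 / (C' + 1)) (\<lambda>x. ennreal (w (x, \<omega>)))"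
        proof (rule A1_Ainf_weight[OF sec[OF w \<omega>] _ C'(1)])
          show "AE x in \<nu>. \<forall>B\<in>qballs d \<nu>. x \<in> B \<longrightarrow>
            average \<nu> B (\<lambda>x. ennreal (w (x, \<omega>))) \<le> ennreal C' * ennreal (w (x, \<omega>))"
            using AE
          proof eventually_elim
            case (elim x)
            show ?case
            proof (intro ballI impI)
              fix B assume B: "B \<in> qballs d \<nu>" "x \<in> B"
              have "average \<nu> B (\<lambda>x. ennreal (w (x, \<omega>))) \<le> average \<nu> B (\<lambda>y. ennreal \<bar>w (y, \<omega>)\<bar>)"
                unfolding average_def
                by (intro divide_right_mono_ennreal nn_integral_mono mult_right_mono ennreal_leI) auto
              also have "\<dots> \<le> maximal_function d \<nu> w (x, \<omega>)"
                unfolding maximal_function_def using B by (auto intro!: SUP_upper)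
              also have "\<dots> \<le> c * ennreal (w (x, \<omega>))" by (rule elim)
              also have "\<dots> \<le> ennreal C' * ennreal (w (x, \<omega>))"
                using c(2) by (intro mult_right_mono) auto
              finally show "average \<nu> B (\<lambda>x. ennreal (w (x, \<omega>))) \<le> ennreal C' * ennreal (w (x, \<omega>))" .
            qed
          qed
        qed simp
      qed
    qed
  next
    case False
    then have p1: "1 < p" using p by simp
    show thesis
    proof (rule that)
      show "0 < \<eta> powr (p - 1) / (C' + 1)" if "0 < \<eta>" for \<eta> using C' that by simp
      fix w :: "'s \<times> 'o \<Rightarrow> real"
      assume w: "w \<in> borel_measurable P" and "Ap_const d \<nu> \<mu> p w \<le> ennreal C"
      then have "Ap_const d \<nu> \<mu> p w < ennreal C'" using C' by auto
      then obtain c where c: "AE \<omega> in \<mu>. (SUP B\<in>qballs d \<nu>.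
           average \<nu> B (\<lambda>x. ennreal (w (x, \<omega>))) *
           epowr (average \<nu> B (\<lambda>x. epowr (ennreal (w (x, \<omega>))) (- 1 / (p - 1)))) (p - 1)) \<le> c" "c < ennreal C'"
        using False by (auto simp: Ap_const_def Inf_less_iff)
      show "AE \<omega> in \<mu>. Ainf_weight d \<nu> (\<lambda>\<eta>. \<eta> powr (p - 1) / (C' + 1)) (\<lambda>x. ennreal (w (x, \<omega>)))"
        using c(1)
      proof (rule AE_mp, intro AE_I2 impI)
        fix \<omega> assume \<omega>: "\<omega> \<in> space \<mu>" and le: "(SUP B\<in>qballs d \<nu>.
           average \<nu> B (\<lambda>x. ennreal (w (x, \<omega>))) *
           epowr (average \<nu> B (\<lambda>x. epowr (ennreal (w (x, \<omega>))) (- 1 / (p - 1)))) (p - 1)) \<le> c"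
        show "Ainf_weight d \<nu> (\<lambda>\<eta>. \<eta> powr (p - 1) / (C' + 1)) (\<lambda>x. ennreal (w (x, \<omega>)))"
        proof (rule Ap_Ainf_weight[OF sec[OF w \<omega>] _ p1 C'(1)])
          fix B assume B: "B \<in> qballs d \<nu>"
          show "average \<nu> B (\<lambda>x. ennreal (w (x, \<omega>))) *
            epowr (average \<nu> B (\<lambda>x. epowr (ennreal (w (x, \<omega>))) (- 1 / (p - 1)))) (p - 1) \<le> ennreal C'"
            using order_trans[OF SUP_upper[OF B] le] c(2) by (meson less_imp_le order_trans)
        qed simp
      qed
    qed
  qed
qed

text \<open>Arguments with values in [0,\<infinity>] allow M to be applied to the series of the
  iteration before passing to a real-valued function.\<close>

definition Mx :: "('s \<times> 'o \<Rightarrow> ennreal) \<Rightarrow> 's \<times> 'o \<Rightarrow> ennreal" where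
  "Mx f z = mxf (\<lambda>y. f (y, snd z)) (fst z)"

abbreviation Mr :: "('s \<times> 'o \<Rightarrow> real) \<Rightarrow> 's \<times> 'o \<Rightarrow> ennreal" where "Mr w \<equiv> Mx (\<lambda>z. ennreal (w z))"

abbreviation pairing :: "('s \<times> 'o \<Rightarrow> real) \<Rightarrow> ('s \<times> 'o \<Rightarrow> real) \<Rightarrow> ennreal" where
  "pairing v w \<equiv> (\<integral>\<^sup>+z. ennreal (v z) * ennreal (w z) \<partial>P)"

lemma Mx_measurable [measurable]:
  assumes [measurable]: "f \<in> borel_measurable P"
  shows "Mx f \<in> borel_measurable P"
proof -
  have "(\<lambda>z. indicator (Bl y r) (fst z) * avg y r (\<lambda>y. f (y, snd z))) \<in> borel_measurable P"
    if "(y, r) \<in> I" for y r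
  proof -
    have [measurable]: "Bl y r \<in> sets \<nu>" using that by (rule I_sets)
    have "(\<lambda>\<omega>. \<integral>\<^sup>+x. f (x, \<omega>) * indicator (Bl y r) x \<partial>\<nu>) \<in> borel_measurable \<mu>"
      by (rule \<nu>.borel_measurable_nn_integral) measurable
    then show ?thesis unfolding average_def by measurable
  qed
  then show ?thesis unfolding Mx_def[abs_def] mxf_def using countable_I
    by (intro borel_measurable_SUP) (auto split: prod.splits)
qed

lemma mxf_mono_AE:
  assumes "AE x in \<nu>. f x \<le> g x"
  shows "mxf f x \<le> mxf g x"
proof -
  have "average \<nu> B f \<le> average \<nu> B g" for B
    unfolding average_def
  proof (intro divide_right_mono_ennreal nn_integral_mono_AE)
    show "AE x in \<nu>. f x * indicator B x \<le> g x * indicator B x"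
      using assms by eventually_elim (rule mult_right_mono, simp_all)
  qed
  then show ?thesis unfolding mxf_def
    by (intro SUP_subset_mono[OF subset_refl]) (auto intro!: mult_left_mono split: prod.splits)
qed

lemma Mx_mono_AE:
  assumes [measurable]: "f \<in> borel_measurable P" "g \<in> borel_measurable P" and "AE z in P. f z \<le> g z"
  shows "AE z in P. Mx f z \<le> Mx g z"
proof (rule AE_of_sections)
  show "{z \<in> space P. Mx f z \<le> Mx g z} \<in> sets P" by measurable
  show "AE \<omega> in \<mu>. AE x in \<nu>. Mx f (x, \<omega>) \<le> Mx g (x, \<omega>)"
    using AE_sections[OF assms(3)]
  proof eventually_elim
    case (elim \<omega>)
    then have "mxf (\<lambda>y. f (y, \<omega>)) x \<le> mxf (\<lambda>y. g (y, \<omega>)) x" for x by (rule mxf_mono_AE)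
    then show ?case by (simp add: Mx_def)
  qed
qed

text \<open>Averages commute with the sum by monotone convergence, and the supremum is subadditive;
  the iteration of Rubio de Francia rests on this.\<close>

lemma Mx_suminf_le:
  assumes [measurable]: "\<And>k. f k \<in> borel_measurable P" and z: "z \<in> space P"
  shows "Mx (\<lambda>z. \<Sum>k. f k z) z \<le> (\<Sum>k. Mx (f k) z)"
proof -
  have \<omega>: "snd z \<in> space \<mu>" using z by (auto simp: space_pair_measure)
  have sec [measurable]: "(\<lambda>y. f k (y, snd z)) \<in> borel_measurable \<nu>" for k
    by (rule measurable_compose[OF measurable_Pair2'[OF \<omega>] assms(1)])
  show ?thesis unfolding Mx_def mxf_def
  proof (intro SUP_least, clarify)
    fix y r assume yr: "(y, r) \<in> I"
    have [measurable]: "Bl y r \<in> sets \<nu>" using yr by (rule I_sets)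
    have "avg y r (\<lambda>y. \<Sum>k. f k (y, snd z)) = (\<Sum>k. avg y r (\<lambda>y. f k (y, snd z)))"
    proof -
      have "(\<integral>\<^sup>+x\<in>Bl y r. (\<Sum>k. f k (x, snd z)) \<partial>\<nu>) = (\<integral>\<^sup>+x. (\<Sum>k. f k (x, snd z) * indicator (Bl y r) x) \<partial>\<nu>)"
        by (simp add: ennreal_suminf_multc)
      also have "\<dots> = (\<Sum>k. \<integral>\<^sup>+x\<in>Bl y r. f k (x, snd z) \<partial>\<nu>)"
        by (intro nn_integral_suminf) measurable
      finally show ?thesis by (simp add: average_def ennreal_suminf_divide)
    qed
    then have "indicator (Bl y r) (fst z) * avg y r (\<lambda>y. \<Sum>k. f k (y, snd z))
        = (\<Sum>k. indicator (Bl y r) (fst z) * avg y r (\<lambda>y. f k (y, snd z)))"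
      by simp
    also have "\<dots> \<le> (\<Sum>k. SUP (y, r)\<in>I. indicator (Bl y r) (fst z) * avg y r (\<lambda>y. f k (y, snd z)))"
      using yr by (intro suminf_le SUP_upper2[of "(y, r)"]) auto
    finally show "indicator (Bl y r) (fst z) * avg y r (\<lambda>y. \<Sum>k. f k (y, snd z))
      \<le> (\<Sum>k. SUP (y, r)\<in>I. indicator (Bl y r) (fst z) * avg y r (\<lambda>y. f k (y, snd z)))" .
  qed
qed

lemma maximal_function_le_Mx:
  assumes "z \<in> space P"
  shows "maximal_function d \<nu> f z \<le> ennreal mxf_const * Mx (\<lambda>z. ennreal \<bar>f z\<bar>) z"
proof (cases z)
  case (Pair x \<omega>)
  show ?thesis unfolding maximal_function_def Pair split_conv
  proof (rule SUP_least)
    fix B assume "B \<in> {B \<in> qballs d \<nu>. x \<in> B}"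
    then obtain x1 r where B: "B = Bl x1 r" "x1 \<in> \<S>" "0 < r" "x \<in> Bl x1 r"
      by (auto simp: qballs_def)
    show "average \<nu> B (\<lambda>y. ennreal \<bar>f (y, \<omega>)\<bar>) \<le> ennreal mxf_const * Mx (\<lambda>z. ennreal \<bar>f z\<bar>) (x, \<omega>)"
      unfolding Mx_def fst_conv snd_conv B(1) by (rule average_le_mxf_ball[OF B(2-4)])
  qed
qed

end


section \<open>Lattices and their order duals\<close>

locale function_lattice =
  fixes M :: "'a measure" and X :: "('a \<Rightarrow> real) set" and N :: "('a \<Rightarrow> real) \<Rightarrow> real"
  assumes normed_lattice: "normed_lattice M X N"
begin

lemmas lattice_axioms = normed_lattice[unfolded normed_lattice_def]

lemma X_measurable [measurable_dest]: "f \<in> X \<Longrightarrow> f \<in> borel_measurable M"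
  using lattice_axioms[THEN conjunct1] by blast

lemma X_zero: "(\<lambda>z. 0) \<in> X"
  using lattice_axioms[THEN conjunct2, THEN conjunct1] .

lemma
  assumes "f \<in> X" "g \<in> X"
  shows X_add: "(\<lambda>z. f z + g z) \<in> X" and N_add: "N (\<lambda>z. f z + g z) \<le> N f + N g"
  using lattice_axioms[THEN conjunct2, THEN conjunct2, THEN conjunct1] assms by simp_all

lemma
  assumes "f \<in> X"
  shows X_scale: "(\<lambda>z. c * f z) \<in> X" and N_scale: "N (\<lambda>z. c * f z) = \<bar>c\<bar> * N f"
  using lattice_axioms[THEN conjunct2, THEN conjunct2, THEN conjunct2, THEN conjunct1] assms by simp_all

lemma
  assumes "f \<in> X"
  shows N_nonneg: "0 \<le> N f" and N_eq_0_iff: "N f = 0 \<longleftrightarrow> (AE z in M. f z = 0)"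
  using lattice_axioms[THEN conjunct2, THEN conjunct2, THEN conjunct2, THEN conjunct2, THEN conjunct1]
    assms by simp_all

lemma
  assumes "g \<in> X" "f \<in> borel_measurable M" "AE z in M. \<bar>f z\<bar> \<le> \<bar>g z\<bar>"
  shows X_ideal: "f \<in> X" and N_mono: "N f \<le> N g"
  using lattice_axioms[THEN conjunct2, THEN conjunct2, THEN conjunct2, THEN conjunct2, THEN conjunct2,
      THEN conjunct1] assms by simp_all

lemma X_full_support:
  assumes "A \<in> sets M" "0 < emeasure M A"
  obtains f where "f \<in> X" "\<not> (AE z in M. z \<in> A \<longrightarrow> f z = 0)"
  using lattice_axioms[THEN conjunct2, THEN conjunct2, THEN conjunct2, THEN conjunct2, THEN conjunct2,
      THEN conjunct2] assms by blast

lemma X_diff: "f \<in> X \<Longrightarrow> g \<in> X \<Longrightarrow> (\<lambda>z. f z - g z) \<in> X"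
  using X_add[OF _ X_scale[of g "-1"]] by simp

lemma N_diff_commute:
  assumes "f \<in> X" "g \<in> X"
  shows "N (\<lambda>z. f z - g z) = N (\<lambda>z. g z - f z)"
  using N_scale[OF X_diff[OF assms], of "-1"] by simp

lemma N_triangle:
  assumes "f \<in> X" "g \<in> X"
  shows "N f \<le> N (\<lambda>z. f z - g z) + N g"
  using N_add[OF X_diff[OF assms] assms(2)] by simp

abbreviation X' :: "('a \<Rightarrow> real) set" where "X' \<equiv> order_dual M X N"
abbreviation N' :: "('a \<Rightarrow> real) \<Rightarrow> real" where "N' \<equiv> dual_norm M X N"

lemma dual_measurable [measurable_dest]: "g \<in> X' \<Longrightarrow> g \<in> borel_measurable M"
  by (simp add: order_dual_def)

lemma dual_norm_nonneg: "0 \<le> N' g"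
  by (simp add: dual_norm_def)

lemma ennreal_dual_norm: "g \<in> X' \<Longrightarrow> ennreal (N' g) = dual_enorm M X N g"
  by (simp add: order_dual_def dual_norm_def less_top)

text \<open>Homogeneity, for an F that may be infinite. If the norm is 0, then f vanishes almost
  everywhere and 0 * \<infinity> = 0 makes the integral vanish.\<close>

lemma nn_integral_scaled_bound:
  assumes F [measurable]: "F \<in> borel_measurable M" and "0 \<le> B"
    and bound: "\<And>f. f \<in> X \<Longrightarrow> N f \<le> 1 \<Longrightarrow> (\<integral>\<^sup>+z. ennreal \<bar>f z\<bar> * F z \<partial>M) \<le> ennreal B"
    and f: "f \<in> X"
  shows "(\<integral>\<^sup>+z. ennreal \<bar>f z\<bar> * F z \<partial>M) \<le> ennreal (N f * B)"
proof (cases "N f = 0")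
  case True
  then have "AE z in M. f z = 0" using N_eq_0_iff[OF f] by simp
  then have "(\<integral>\<^sup>+z. ennreal \<bar>f z\<bar> * F z \<partial>M) = (\<integral>\<^sup>+z. 0 \<partial>M)" by (intro nn_integral_cong_AE) auto
  then show ?thesis by simp
next
  case False
  then have pos: "0 < N f" using N_nonneg[OF f] by simp
  note [measurable] = X_measurable[OF f]
  define h where "h z = 1 / N f * f z" for z
  have h: "h \<in> X" unfolding h_def[abs_def] by (rule X_scale[OF f])
  have "N h \<le> 1" unfolding h_def[abs_def] N_scale[OF f] using pos by simp
  note h = h this
  have "(\<integral>\<^sup>+z. ennreal \<bar>f z\<bar> * F z \<partial>M) = (\<integral>\<^sup>+z. ennreal (N f) * (ennreal \<bar>h z\<bar> * F z) \<partial>M)"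
    using pos by (intro nn_integral_cong) (simp add: h_def mult.assoc[symmetric] ennreal_mult[symmetric] abs_mult)
  also have "\<dots> = ennreal (N f) * (\<integral>\<^sup>+z. ennreal \<bar>h z\<bar> * F z \<partial>M)"
    using X_measurable[OF h(1)] F by (intro nn_integral_cmult) simp
  also have "\<dots> \<le> ennreal (N f) * ennreal B" using bound[OF h] by (rule mult_left_mono) simp
  finally show ?thesis using pos \<open>0 \<le> B\<close> by (simp add: ennreal_mult)
qed

lemma Hoelder:
  assumes f: "f \<in> X" and g: "g \<in> X'"
  shows "(\<integral>\<^sup>+z. ennreal \<bar>f z\<bar> * ennreal \<bar>g z\<bar> \<partial>M) \<le> ennreal (N f * N' g)"
proof (rule nn_integral_scaled_bound[OF _ dual_norm_nonneg _ f])
  show "(\<lambda>z. ennreal \<bar>g z\<bar>) \<in> borel_measurable M" using g by measurable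
  fix f assume "f \<in> X" "N f \<le> 1"
  then have "(\<integral>\<^sup>+z. ennreal \<bar>f z * g z\<bar> \<partial>M) \<le> dual_enorm M X N g"
    unfolding dual_enorm_def by (intro SUP_upper) auto
  then show "(\<integral>\<^sup>+z. ennreal \<bar>f z\<bar> * ennreal \<bar>g z\<bar> \<partial>M) \<le> ennreal (N' g)"
    unfolding ennreal_dual_norm[OF g] by (simp add: abs_mult ennreal_mult)
qed

lemma dual_of_bound:
  assumes g: "g \<in> borel_measurable M" and "0 \<le> B"
    and bound: "\<And>f. f \<in> X \<Longrightarrow> N f \<le> 1 \<Longrightarrow> (\<integral>\<^sup>+z. ennreal \<bar>f z\<bar> * ennreal \<bar>g z\<bar> \<partial>M) \<le> ennreal B"
  shows "g \<in> X'" "N' g \<le> B"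
proof -
  have le: "dual_enorm M X N g \<le> ennreal B"
    unfolding dual_enorm_def using bound by (intro SUP_least) (auto simp: abs_mult ennreal_mult)
  then show g': "g \<in> X'" using g by (auto simp: order_dual_def intro: le_less_trans)
  show "N' g \<le> B" using le \<open>0 \<le> B\<close> unfolding ennreal_dual_norm[OF g', symmetric] by simp
qed

text \<open>Full support enters here: every f in X vanishes almost everywhere on the set where F is
  infinite, so that set is null. Thus bounded pairings alone give an element of the dual.\<close>

lemma dual_majorant:
  assumes F [measurable]: "F \<in> borel_measurable M" and "0 \<le> B"
    and bound: "\<And>f. f \<in> X \<Longrightarrow> N f \<le> 1 \<Longrightarrow> (\<integral>\<^sup>+z. ennreal \<bar>f z\<bar> * F z \<partial>M) \<le> ennreal B"
  obtains u where "u \<in> X'" "AE z in M. F z \<le> ennreal (u z)" "N' u \<le> B"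
proof -
  define A where "A = {z \<in> space M. F z = top}"
  have A: "A \<in> sets M" unfolding A_def by measurable
  have "emeasure M A = 0"
  proof (rule ccontr)
    assume "emeasure M A \<noteq> 0"
    then have "0 < emeasure M A" by (simp add: zero_less_iff_neq_zero)
    then obtain f where f: "f \<in> X" "\<not> (AE z in M. z \<in> A \<longrightarrow> f z = 0)" using X_full_support[OF A] by blast
    note [measurable] = X_measurable[OF f(1)]
    have "(\<integral>\<^sup>+z. ennreal \<bar>f z\<bar> * F z \<partial>M) \<le> ennreal (N f * B)"
      by (rule nn_integral_scaled_bound[OF F \<open>0 \<le> B\<close> bound f(1)])
    then have "(\<integral>\<^sup>+z. ennreal \<bar>f z\<bar> * F z \<partial>M) \<noteq> \<infinity>" by (auto simp: top_unique)
    then have "AE z in M. ennreal \<bar>f z\<bar> * F z \<noteq> \<infinity>" by (intro nn_integral_PInf_AE) auto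
    then have "AE z in M. z \<in> A \<longrightarrow> f z = 0"
      by eventually_elim (auto simp: A_def ennreal_mult_top split: if_splits)
    then show False using f(2) by simp
  qed
  then have fin: "AE z in M. F z \<noteq> top"
    using A by (intro AE_I[where N = A]) (auto simp: A_def)
  define u where "u z = enn2real (F z)" for z
  have u [measurable]: "u \<in> borel_measurable M" unfolding u_def[abs_def] by measurable
  have le: "(\<integral>\<^sup>+z. ennreal \<bar>f z\<bar> * ennreal \<bar>u z\<bar> \<partial>M) \<le> ennreal B" if "f \<in> X" "N f \<le> 1" for f
  proof -
    have "(\<integral>\<^sup>+z. ennreal \<bar>f z\<bar> * ennreal \<bar>u z\<bar> \<partial>M) \<le> (\<integral>\<^sup>+z. ennreal \<bar>f z\<bar> * F z \<partial>M)"
      by (intro nn_integral_mono mult_left_mono) (auto simp: u_def ennreal_enn2real_if)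
    then show ?thesis using bound[OF that] by simp
  qed
  show thesis
  proof (rule that)
    show "u \<in> X'" "N' u \<le> B" by (rule dual_of_bound[OF u \<open>0 \<le> B\<close> le], assumption+)+
    show "AE z in M. F z \<le> ennreal (u z)"
      using fin by eventually_elim (auto simp: u_def less_top)
  qed
qed

lemma
  assumes g: "g \<in> X'" and f: "f \<in> borel_measurable M" and le: "AE z in M. \<bar>f z\<bar> \<le> \<bar>g z\<bar>"
  shows dual_ideal: "f \<in> X'" and dual_norm_mono: "N' f \<le> N' g"
proof -
  have b: "(\<integral>\<^sup>+z. ennreal \<bar>h z\<bar> * ennreal \<bar>f z\<bar> \<partial>M) \<le> ennreal (N' g)" if h: "h \<in> X" "N h \<le> 1" for h
  proof -
    have "(\<integral>\<^sup>+z. ennreal \<bar>h z\<bar> * ennreal \<bar>f z\<bar> \<partial>M) \<le> (\<integral>\<^sup>+z. ennreal \<bar>h z\<bar> * ennreal \<bar>g z\<bar> \<partial>M)"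
    proof (rule nn_integral_mono_AE)
      show "AE z in M. ennreal \<bar>h z\<bar> * ennreal \<bar>f z\<bar> \<le> ennreal \<bar>h z\<bar> * ennreal \<bar>g z\<bar>"
        using le by eventually_elim (intro mult_left_mono ennreal_leI, simp_all)
    qed
    also have "\<dots> \<le> ennreal (N h * N' g)" by (rule Hoelder[OF h(1) g])
    also have "\<dots> \<le> ennreal (1 * N' g)" using h(2) dual_norm_nonneg by (intro ennreal_leI mult_right_mono)
    finally show ?thesis by simp
  qed
  show "f \<in> X'" "N' f \<le> N' g" by (rule dual_of_bound[OF f dual_norm_nonneg b], assumption+)+
qed

lemma
  assumes g: "g \<in> X'"
  shows dual_scale: "(\<lambda>z. c * g z) \<in> X'" and dual_norm_scale: "N' (\<lambda>z. c * g z) \<le> \<bar>c\<bar> * N' g"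
proof -
  note [measurable] = dual_measurable[OF g]
  have b: "(\<integral>\<^sup>+z. ennreal \<bar>h z\<bar> * ennreal \<bar>c * g z\<bar> \<partial>M) \<le> ennreal (\<bar>c\<bar> * N' g)"
    if h: "h \<in> X" "N h \<le> 1" for h
  proof -
    note [measurable] = X_measurable[OF h(1)]
    have "(\<integral>\<^sup>+z. ennreal \<bar>h z\<bar> * ennreal \<bar>c * g z\<bar> \<partial>M) = (\<integral>\<^sup>+z. ennreal \<bar>c\<bar> * (ennreal \<bar>h z\<bar> * ennreal \<bar>g z\<bar>) \<partial>M)"
      by (intro nn_integral_cong) (simp add: abs_mult ennreal_mult mult_ac)
    also have "\<dots> = ennreal \<bar>c\<bar> * (\<integral>\<^sup>+z. ennreal \<bar>h z\<bar> * ennreal \<bar>g z\<bar> \<partial>M)"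
      by (rule nn_integral_cmult) measurable
    also have "\<dots> \<le> ennreal \<bar>c\<bar> * ennreal (N h * N' g)" by (intro mult_left_mono Hoelder[OF h(1) g]) simp
    also have "\<dots> \<le> ennreal \<bar>c\<bar> * ennreal (1 * N' g)"
      using h(2) dual_norm_nonneg by (intro mult_left_mono ennreal_leI mult_right_mono) auto
    finally show ?thesis using dual_norm_nonneg by (simp add: ennreal_mult)
  qed
  have m: "(\<lambda>z. c * g z) \<in> borel_measurable M" by measurable
  show "(\<lambda>z. c * g z) \<in> X'" "N' (\<lambda>z. c * g z) \<le> \<bar>c\<bar> * N' g"
    by (rule dual_of_bound[OF m _ b], simp add: dual_norm_nonneg, assumption+)+
qed

lemma norming_bound:
  assumes norming: "norming M X' N' X N" and f: "f \<in> X" and "0 \<le> c"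
    and bound: "\<And>g. g \<in> X' \<Longrightarrow> N' g = 1 \<Longrightarrow> (\<integral>\<^sup>+z. ennreal \<bar>f z\<bar> * ennreal \<bar>g z\<bar> \<partial>M) \<le> ennreal c"
  shows "N f \<le> c"
proof -
  have "ennreal (N f) = (SUP g\<in>{g \<in> X'. N' g = 1}. \<integral>\<^sup>+z. ennreal \<bar>f z * g z\<bar> \<partial>M)"
    using norming f by (simp add: norming_def)
  also have "\<dots> \<le> ennreal c" using bound by (intro SUP_least) (auto simp: abs_mult ennreal_mult)
  finally show ?thesis using \<open>0 \<le> c\<close> by simp
qed

text \<open>Monotonicity replaces the passage to an almost everywhere convergent subsequence: the
  positive part of \<open>U n - h\<close> is dominated by the modulus of \<open>U k - h\<close> for
  every k >= n, and these norms tend to 0.\<close>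

lemma monotone_limit:
  assumes complete: "norm_complete X N" and U: "\<And>n. U n \<in> X" and mono: "\<And>z. incseq (\<lambda>n. U n z)"
    and Cauchy: "\<And>e. 0 < e \<Longrightarrow> \<exists>k. \<forall>m\<ge>k. \<forall>n\<ge>k. N (\<lambda>z. U m z - U n z) < e"
    and bound: "\<And>n. N (U n) \<le> B"
  obtains h where "h \<in> X" "\<And>n. AE z in M. U n z \<le> h z" "N h \<le> B"
proof -
  have "\<exists>h\<in>X. (\<lambda>n. N (\<lambda>z. U n z - h z)) \<longlonglongrightarrow> 0"
    by (rule complete[unfolded norm_complete_def, rule_format, OF U Cauchy])
  then obtain h where h: "h \<in> X" "(\<lambda>n. N (\<lambda>z. U n z - h z)) \<longlonglongrightarrow> 0" by (elim bexE)
  have le: "AE z in M. U n z \<le> h z" for n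
  proof -
    define p where "p z = max (U n z - h z) 0" for z
    have pm: "p \<in> borel_measurable M"
      unfolding p_def[abs_def] using X_measurable[OF U[of n]] X_measurable[OF h(1)] by measurable
    have ple: "AE z in M. \<bar>p z\<bar> \<le> \<bar>U k z - h z\<bar>" if "n \<le> k" for k
    proof (intro AE_I2)
      fix z
      have "U n z \<le> U k z" using mono[of z] that by (rule incseqD)
      then show "\<bar>p z\<bar> \<le> \<bar>U k z - h z\<bar>" by (auto simp: p_def max_def)
    qed
    have pX: "p \<in> X" using X_ideal[OF X_diff[OF U h(1)] pm ple[OF order_refl]] .
    have "N p \<le> N (\<lambda>z. U k z - h z)" if "n \<le> k" for k
      using N_mono[OF X_diff[OF U h(1)] pm ple[OF that]] .
    then have "N p \<le> 0" by (intro LIMSEQ_le_const[OF h(2)]) blast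
    then have "N p = 0" using N_nonneg[OF pX] by simp
    then have "AE z in M. p z = 0" using N_eq_0_iff[OF pX] by simp
    then show ?thesis by eventually_elim (auto simp: p_def max_def split: if_splits)
  qed
  have Nh: "N h \<le> B"
  proof (rule LIMSEQ_le_const)
    show "(\<lambda>n. N (\<lambda>z. U n z - h z) + B) \<longlonglongrightarrow> B" using tendsto_add[OF h(2) tendsto_const[of B]] by simp
    have "N h \<le> N (\<lambda>z. U n z - h z) + B" for n
      using N_triangle[OF h(1) U[of n]] N_diff_commute[OF h(1) U[of n]] bound[of n] by simp
    then show "\<exists>k. \<forall>n\<ge>k. N h \<le> N (\<lambda>z. U n z - h z) + B" by blast
  qed
  show thesis by (rule that[OF h(1) le Nh])
qed

text \<open>A Riesz-Fischer argument: the partial sums of the absolute values are increasing and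
  Cauchy, and their norm limit dominates the series.\<close>

lemma geometric_sum_majorant:
  assumes complete: "norm_complete X N" and F: "\<And>k. F k \<in> X" and small: "\<And>k. N (F k) \<le> c * (1 / 2) ^ k"
  shows "\<exists>h\<in>X. (AE z in M. (\<Sum>k. ennreal \<bar>F k z\<bar>) \<le> ennreal (h z)) \<and> N h \<le> 2 * c"
proof -
  have absX: "(\<lambda>z. \<bar>F k z\<bar>) \<in> X" "N (\<lambda>z. \<bar>F k z\<bar>) \<le> c * (1 / 2) ^ k" for k
  proof -
    have m: "(\<lambda>z. \<bar>F k z\<bar>) \<in> borel_measurable M" using X_measurable[OF F] by measurable
    show "(\<lambda>z. \<bar>F k z\<bar>) \<in> X" by (rule X_ideal[OF F[of k] m]) simp
    have "N (\<lambda>z. \<bar>F k z\<bar>) \<le> N (F k)" by (rule N_mono[OF F[of k] m]) simp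
    then show "N (\<lambda>z. \<bar>F k z\<bar>) \<le> c * (1 / 2) ^ k" using small[of k] by simp
  qed
  have c: "0 \<le> c" using N_nonneg[OF F[of 0]] small[of 0] by simp
  define U where "U n z = (\<Sum>k<n. \<bar>F k z\<bar>)" for n z
  have U: "U n \<in> X" for n
  proof (induction n)
    case 0
    then show ?case using X_zero by (simp add: U_def[abs_def])
  next
    case (Suc n)
    then show ?case using X_add[OF Suc absX(1)[of n]] by (simp add: U_def[abs_def])
  qed
  \<comment> \<open>The subtracted term makes the induction close: -2 c q + c q = -2 c (q / 2) with
    q = (1 / 2) ^ (n + j).\<close>
  have tail: "N (\<lambda>z. U (n + j) z - U n z) \<le> 2 * c * (1 / 2) ^ n - 2 * c * (1 / 2) ^ (n + j)" for n j
  proof (induction j)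
    case 0
    have "N (\<lambda>z. 0) = 0" using N_eq_0_iff[OF X_zero] by simp
    then show ?case by simp
  next
    case (Suc j)
    have "N (\<lambda>z. U (n + Suc j) z - U n z) = N (\<lambda>z. (U (n + j) z - U n z) + \<bar>F (n + j) z\<bar>)"
      by (simp add: U_def algebra_simps)
    also have "\<dots> \<le> N (\<lambda>z. U (n + j) z - U n z) + N (\<lambda>z. \<bar>F (n + j) z\<bar>)"
      by (rule N_add[OF X_diff[OF U U] absX(1)])
    also have "\<dots> \<le> (2 * c * (1 / 2) ^ n - 2 * c * (1 / 2) ^ (n + j)) + c * (1 / 2) ^ (n + j)"
      using Suc absX(2)[of "n + j"] by (rule add_mono)
    finally show ?case by (simp add: field_simps)
  qed
  have tail_le: "N (\<lambda>z. U m z - U n z) \<le> 2 * c * (1 / 2) ^ n" if "n \<le> m" for m n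
  proof -
    have "0 \<le> 2 * c * (1 / 2) ^ (n + (m - n))" using c by simp
    then show ?thesis using tail[of n "m - n"] that by simp
  qed
  obtain h where h: "h \<in> X" "\<And>n. AE z in M. U n z \<le> h z" "N h \<le> 2 * c"
  proof (rule monotone_limit[OF complete U])
    show "incseq (\<lambda>n. U n z)" for z by (rule incseq_SucI) (simp add: U_def)
    show "\<exists>k. \<forall>m\<ge>k. \<forall>n\<ge>k. N (\<lambda>z. U m z - U n z) < e" if e: "0 < e" for e
    proof -
      obtain k where k: "(1 / 2 :: real) ^ k < e / (2 * c + 1)"
        using real_arch_pow_inv[of "e / (2 * c + 1)" "1 / 2"] e c by auto
      have ke: "2 * c * (1 / 2) ^ k < e"
      proof -
        have "2 * c * (1 / 2) ^ k \<le> (2 * c + 1) * (1 / 2) ^ k" by (intro mult_right_mono) auto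
        also have "\<dots> < e" using k c by (simp add: field_simps)
        finally show ?thesis .
      qed
      have *: "N (\<lambda>z. U m z - U n z) < e" if "k \<le> n" "n \<le> m" for m n
      proof -
        have "2 * c * (1 / 2) ^ n \<le> 2 * c * (1 / 2) ^ k" using c that by (intro mult_left_mono power_decreasing) auto
        then show ?thesis using tail_le[OF that(2)] ke by linarith
      qed
      have "N (\<lambda>z. U m z - U n z) < e" if "k \<le> n" "k \<le> m" for m n
        using *[of n m] *[of m n] N_diff_commute[OF U[of m] U[of n]] that by (cases "n \<le> m") auto
      then show ?thesis by blast
    qed
    show "N (U n) \<le> 2 * c" for n using tail_le[of 0 n] by (simp add: U_def[abs_def])
  qed (rule that)
  have "AE z in M. \<forall>n. U n z \<le> h z" using h(2) by (simp add: AE_all_countable)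
  then have "AE z in M. (\<Sum>k. ennreal \<bar>F k z\<bar>) \<le> ennreal (h z)"
  proof eventually_elim
    case (elim z)
    have "(\<Sum>k<n. ennreal \<bar>F k z\<bar>) \<le> ennreal (h z)" for n
      using elim by (auto simp: U_def intro: ennreal_leI)
    then show ?case by (intro suminf_le_const) auto
  qed
  then show ?thesis using h by blast
qed

text \<open>In the dual, monotone convergence inside the pairing and \<open>dual_majorant\<close>
  take over the role of completeness.\<close>

lemma dual_geometric_sum_majorant:
  assumes F: "\<And>k. F k \<in> X'" and small: "\<And>k. N' (F k) \<le> c * (1 / 2) ^ k"
  shows "\<exists>h\<in>X'. (AE z in M. (\<Sum>k. ennreal \<bar>F k z\<bar>) \<le> ennreal (h z)) \<and> N' h \<le> 2 * c"
proof -
  note [measurable] = dual_measurable[OF F]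
  have c: "0 \<le> c" using dual_norm_nonneg[of "F 0"] small[of 0] by simp
  obtain h where h: "h \<in> X'" "AE z in M. (\<Sum>k. ennreal \<bar>F k z\<bar>) \<le> ennreal (h z)" "N' h \<le> 2 * c"
  proof (rule dual_majorant)
    show "(\<lambda>z. \<Sum>k. ennreal \<bar>F k z\<bar>) \<in> borel_measurable M" by measurable
    show "0 \<le> 2 * c" using c by simp
    fix f assume f: "f \<in> X" "N f \<le> 1"
    note [measurable] = X_measurable[OF f(1)]
    have "(\<integral>\<^sup>+z. ennreal \<bar>f z\<bar> * (\<Sum>k. ennreal \<bar>F k z\<bar>) \<partial>M)
        = (\<Sum>k. \<integral>\<^sup>+z. ennreal \<bar>f z\<bar> * ennreal \<bar>F k z\<bar> \<partial>M)"
      by (subst nn_integral_suminf[symmetric]) simp_all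
    also have "\<dots> \<le> (\<Sum>k. ennreal (c * (1 / 2) ^ k))"
    proof (intro suminf_le)
      fix k
      have "N f * N' (F k) \<le> 1 * (c * (1 / 2) ^ k)"
        using f small[of k] dual_norm_nonneg N_nonneg[OF f(1)] by (intro mult_mono) auto
      then have "ennreal (N f * N' (F k)) \<le> ennreal (c * (1 / 2) ^ k)" by (intro ennreal_leI) simp
      then show "(\<integral>\<^sup>+z. ennreal \<bar>f z\<bar> * ennreal \<bar>F k z\<bar> \<partial>M) \<le> ennreal (c * (1 / 2) ^ k)"
        using Hoelder[OF f(1) F[of k]] by (rule order_trans[rotated])
    qed auto
    also have "\<dots> = ennreal (2 * c)"
    proof (intro suminf_ennreal_eq)
      show "(\<lambda>k. c * (1 / 2) ^ k) sums (2 * c)" using sums_mult[OF geometric_sums[of "1/2::real"], of c] by (simp add: mult.commute)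
    qed (use c in auto)
    finally show "(\<integral>\<^sup>+z. ennreal \<bar>f z\<bar> * (\<Sum>k. ennreal \<bar>F k z\<bar>) \<partial>M) \<le> ennreal (2 * c)" .
  qed
  then show ?thesis by blast
qed

end


section \<open>Integrated estimates and the iteration of Rubio de Francia\<close>

context product_space
begin

lemma nn_integral_sections:
  assumes "f \<in> borel_measurable P"
  shows "(\<integral>\<^sup>+z. f z \<partial>P) = (\<integral>\<^sup>+\<omega>. (\<integral>\<^sup>+x. f (x, \<omega>) \<partial>\<nu>) \<partial>\<mu>)"
  by (rule nn_integral_snd[OF assms, symmetric])

lemma nn_integral_sections_le:
  assumes [measurable]: "f \<in> borel_measurable P" "g \<in> borel_measurable P"
    and le: "AE \<omega> in \<mu>. c * (\<integral>\<^sup>+x. f (x, \<omega>) \<partial>\<nu>) \<le> C * (\<integral>\<^sup>+x. g (x, \<omega>) \<partial>\<nu>)"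
  shows "c * (\<integral>\<^sup>+z. f z \<partial>P) \<le> C * (\<integral>\<^sup>+z. g z \<partial>P)"
proof -
  have m: "(\<lambda>\<omega>. \<integral>\<^sup>+x. h (x, \<omega>) \<partial>\<nu>) \<in> borel_measurable \<mu>"
    if [measurable]: "h \<in> borel_measurable P" for h :: "'s \<times> 'o \<Rightarrow> ennreal"
    by (rule \<nu>.borel_measurable_nn_integral) measurable
  have "c * (\<integral>\<^sup>+z. f z \<partial>P) = (\<integral>\<^sup>+\<omega>. c * (\<integral>\<^sup>+x. f (x, \<omega>) \<partial>\<nu>) \<partial>\<mu>)"
    unfolding nn_integral_sections[OF assms(1)] by (rule nn_integral_cmult[symmetric, OF m[OF assms(1)]])
  also have "\<dots> \<le> (\<integral>\<^sup>+\<omega>. C * (\<integral>\<^sup>+x. g (x, \<omega>) \<partial>\<nu>) \<partial>\<mu>)" by (rule nn_integral_mono_AE[OF le])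
  also have "\<dots> = C * (\<integral>\<^sup>+z. g z \<partial>P)"
    unfolding nn_integral_sections[OF assms(2)] by (rule nn_integral_cmult[OF m[OF assms(2)]])
  finally show ?thesis .
qed

text \<open>One modulus for almost all sections; this uniformity is what allows the estimates on
  sections to be integrated over \<omega>.\<close>

definition section_weight :: "(real \<Rightarrow> real) \<Rightarrow> ('s \<times> 'o \<Rightarrow> real) \<Rightarrow> bool" where
  "section_weight \<phi> w \<longleftrightarrow> w \<in> borel_measurable P \<and>
     (AE \<omega> in \<mu>. Ainf_weight d \<nu> \<phi> (\<lambda>x. ennreal (w (x, \<omega>))))"

lemma section_weight_zero:
  assumes w: "section_weight \<phi> w" and \<phi>: "\<And>\<eta>. 0 < \<eta> \<Longrightarrow> 0 < \<phi> \<eta>"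
  shows "AE z in P. ennreal (w z) = 0 \<longrightarrow> Mr w z = 0"
proof (rule AE_of_sections)
  have [measurable]: "w \<in> borel_measurable P" using w by (simp add: section_weight_def)
  show "{z \<in> space P. ennreal (w z) = 0 \<longrightarrow> Mr w z = 0} \<in> sets P" by measurable
  have "AE \<omega> in \<mu>. Ainf_weight d \<nu> \<phi> (\<lambda>x. ennreal (w (x, \<omega>)))" using w by (simp add: section_weight_def)
  then show "AE \<omega> in \<mu>. AE x in \<nu>. ennreal (w (x, \<omega>)) = 0 \<longrightarrow> Mr w (x, \<omega>) = 0"
    by eventually_elim (simp only: Mx_def fst_conv snd_conv, rule Ainf_weight_zero[OF _ \<phi>])
qed

lemma section_weight_estimates:
  assumes \<phi>: "\<And>\<eta>. 0 < \<eta> \<Longrightarrow> 0 < \<phi> \<eta>" and \<psi>: "\<And>\<eta>. 0 < \<eta> \<Longrightarrow> 0 < \<psi> \<eta>"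
  obtains C :: real and \<tau> :: "nat \<Rightarrow> real" where "0 \<le> C" "mono \<tau>" "\<And>n. 0 < \<tau> n" "\<And>b. \<exists>n. b < \<tau> n"
    and "\<And>w v. section_weight \<phi> w \<Longrightarrow> section_weight \<psi> v \<Longrightarrow>
      (\<integral>\<^sup>+z. ennreal (v z) * Mr w z \<partial>P) \<le> ennreal C * pairing v w"
    and "\<And>w v n. section_weight \<phi> w \<Longrightarrow> section_weight \<psi> v \<Longrightarrow>
      of_nat n * (\<integral>\<^sup>+z. ennreal (v z) * (Mr w z - ennreal (\<tau> n) * ennreal (w z)) \<partial>P)
        \<le> ennreal C * pairing v w"
proof (rule weight_estimates[of \<phi> \<psi>, OF \<phi> \<psi>])
  fix C :: real and \<tau> :: "nat \<Rightarrow> real"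
  assume C: "0 \<le> C" "mono \<tau>" "\<And>n. 0 < \<tau> n" "\<And>b. \<exists>n. b < \<tau> n"
    and bound: "\<And>W V. Ainf_weight d \<nu> \<phi> W \<Longrightarrow> Ainf_weight d \<nu> \<psi> V \<Longrightarrow>
      (\<integral>\<^sup>+x. V x * mxf W x \<partial>\<nu>) \<le> ennreal C * (\<integral>\<^sup>+x. V x * W x \<partial>\<nu>)"
    and decay: "\<And>W V n. Ainf_weight d \<nu> \<phi> W \<Longrightarrow> Ainf_weight d \<nu> \<psi> V \<Longrightarrow> (\<And>x. W x < top) \<Longrightarrow>
      of_nat n * (\<integral>\<^sup>+x. V x * (mxf W x - ennreal (\<tau> n) * W x) \<partial>\<nu>) \<le> ennreal C * (\<integral>\<^sup>+x. V x * W x \<partial>\<nu>)"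
  show thesis
  proof (rule that[OF C])
    fix w v assume w: "section_weight \<phi> w" and v: "section_weight \<psi> v"
    have [measurable]: "w \<in> borel_measurable P" "v \<in> borel_measurable P"
      using w v by (simp_all add: section_weight_def)
    have wa: "AE \<omega> in \<mu>. Ainf_weight d \<nu> \<phi> (\<lambda>x. ennreal (w (x, \<omega>)))"
      and va: "AE \<omega> in \<mu>. Ainf_weight d \<nu> \<psi> (\<lambda>x. ennreal (v (x, \<omega>)))"
      using w v by (simp_all add: section_weight_def)
    have "1 * (\<integral>\<^sup>+z. ennreal (v z) * Mr w z \<partial>P)
        \<le> ennreal C * pairing v w"
    proof (rule nn_integral_sections_le)
      show "AE \<omega> in \<mu>. 1 * (\<integral>\<^sup>+x. ennreal (v (x, \<omega>)) * Mr w (x, \<omega>) \<partial>\<nu>)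
         \<le> ennreal C * (\<integral>\<^sup>+x. ennreal (v (x, \<omega>)) * ennreal (w (x, \<omega>)) \<partial>\<nu>)"
        using wa va
        by eventually_elim (simp only: Mx_def fst_conv snd_conv mult_1, rule bound)
    qed measurable
    then show "(\<integral>\<^sup>+z. ennreal (v z) * Mr w z \<partial>P)
        \<le> ennreal C * pairing v w" by simp
    fix n
    show "of_nat n * (\<integral>\<^sup>+z. ennreal (v z) * (Mr w z - ennreal (\<tau> n) * ennreal (w z)) \<partial>P)
        \<le> ennreal C * pairing v w"
    proof (rule nn_integral_sections_le)
      show "AE \<omega> in \<mu>. of_nat n * (\<integral>\<^sup>+x. ennreal (v (x, \<omega>)) *
            (Mr w (x, \<omega>) - ennreal (\<tau> n) * ennreal (w (x, \<omega>))) \<partial>\<nu>)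
         \<le> ennreal C * (\<integral>\<^sup>+x. ennreal (v (x, \<omega>)) * ennreal (w (x, \<omega>)) \<partial>\<nu>)"
        using wa va
        by eventually_elim (simp only: Mx_def fst_conv snd_conv, rule decay, simp_all)
    qed measurable
  qed
qed

lemma Ainf_regular_weights:
  assumes reg: "Ainf_regular d \<nu> \<mu> Y NY" and meas: "\<And>f. f \<in> Y \<Longrightarrow> f \<in> borel_measurable P"
    and nonneg: "\<And>f. f \<in> Y \<Longrightarrow> 0 \<le> NY f"
  obtains \<phi> m where "\<And>\<eta>. 0 < \<eta> \<Longrightarrow> 0 < \<phi> \<eta>" "0 \<le> m"
    "\<And>f. f \<in> Y \<Longrightarrow> \<exists>w\<in>Y. (AE z in P. \<bar>f z\<bar> \<le> w z) \<and> NY w \<le> m * NY f \<and> section_weight \<phi> w"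
proof -
  obtain p C m where p: "1 \<le> p" and r: "Ap_regular_with d \<nu> \<mu> p C m Y NY"
    using reg by (auto simp: Ainf_regular_def Ap_regular_def)
  show thesis
  proof (rule Ap_const_Ainf_weight[OF p, of C])
    fix \<phi> :: "real \<Rightarrow> real"
    assume \<phi>: "\<And>\<eta>. 0 < \<eta> \<Longrightarrow> 0 < \<phi> \<eta>"
      and weight: "\<And>w. w \<in> borel_measurable P \<Longrightarrow> Ap_const d \<nu> \<mu> p w \<le> ennreal C \<Longrightarrow>
        AE \<omega> in \<mu>. Ainf_weight d \<nu> \<phi> (\<lambda>x. ennreal (w (x, \<omega>)))"
    show thesis
    \<comment> \<open>Regularity does not prescribe the sign of m. Norms are nonnegative, so the
      absolute value of m still gives a bound.\<close>
    proof (rule that[of \<phi> "\<bar>m\<bar>", OF \<phi>])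
      fix f assume f: "f \<in> Y"
      obtain w where w: "w \<in> Y" "AE z in P. \<bar>f z\<bar> \<le> w z" "NY w \<le> m * NY f" "Ap_const d \<nu> \<mu> p w \<le> ennreal C"
        using r[unfolded Ap_regular_with_def, rule_format, OF f] by blast
      have "m * NY f \<le> \<bar>m\<bar> * NY f" using nonneg[OF f] by (intro mult_right_mono) auto
      then have "NY w \<le> \<bar>m\<bar> * NY f" using w(3) by simp
      moreover have "section_weight \<phi> w"
        using weight[OF meas[OF w(1)] w(4)] meas[OF w(1)] by (simp add: section_weight_def)
      ultimately show "\<exists>w\<in>Y. (AE z in P. \<bar>f z\<bar> \<le> w z) \<and> NY w \<le> \<bar>m\<bar> * NY f \<and> section_weight \<phi> w"
        using w(1,2) by blast
    qed simp_all
  qed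
qed

text \<open>Stated for an abstract pair so that it serves both X and its dual. Only a majorant of M
  f is known to belong to Y, so the iteration runs over chosen majorants: M of \<open>F k\<close> is
  at most 2 L times the modulus of \<open>F (k + 1)\<close>, whose norm is at most half that of
  \<open>F k\<close>. Summing gives M h <= 2 L h for the sum h.\<close>

lemma Rubio_de_Francia:
  assumes meas: "\<And>f. f \<in> Y \<Longrightarrow> f \<in> borel_measurable P"
    and ideal: "\<And>f g. g \<in> Y \<Longrightarrow> f \<in> borel_measurable P \<Longrightarrow> (AE z in P. \<bar>f z\<bar> \<le> \<bar>g z\<bar>) \<Longrightarrow> f \<in> Y \<and> NY f \<le> NY g"
    and scale: "\<And>f c. f \<in> Y \<Longrightarrow> (\<lambda>z. c * f z) \<in> Y \<and> NY (\<lambda>z. c * f z) \<le> \<bar>c\<bar> * NY f"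
    and sum: "\<And>F c. (\<And>k. F k \<in> Y) \<Longrightarrow> (\<And>k. NY (F k) \<le> c * (1 / 2) ^ k) \<Longrightarrow>
       \<exists>h\<in>Y. (AE z in P. (\<Sum>k. ennreal \<bar>F k z\<bar>) \<le> ennreal (h z)) \<and> NY h \<le> 2 * c"
    and K: "0 < L"
    and maj: "\<And>f. f \<in> Y \<Longrightarrow> \<exists>u\<in>Y. (AE z in P. Mx (\<lambda>z. ennreal \<bar>f z\<bar>) z \<le> ennreal (u z)) \<and> NY u \<le> L * NY f"
  shows "Ap_regular d \<nu> \<mu> 1 Y NY"
proof -
  have "Ap_regular_with d \<nu> \<mu> 1 (mxf_const * (2 * L)) 2 Y NY"
    unfolding Ap_regular_with_def
  proof (intro ballI)
    fix f assume f: "f \<in> Y"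
    \<comment> \<open>Here u is a majorant divided by 2 L: the norm is halved at the cost of the
      factor 2 L.\<close>
    define Q where "Q g u \<longleftrightarrow> u \<in> Y \<and> (AE z in P. Mx (\<lambda>z. ennreal \<bar>g z\<bar>) z \<le> ennreal (2 * L) * ennreal \<bar>u z\<bar>) \<and>
      NY u \<le> 1 / 2 * NY g" for g u
    have ex: "\<exists>u. Q g u" if g: "g \<in> Y" for g
    proof -
      obtain u where u: "u \<in> Y" "AE z in P. Mx (\<lambda>z. ennreal \<bar>g z\<bar>) z \<le> ennreal (u z)" "NY u \<le> L * NY g"
        using maj[OF g] by blast
      define u' where "u' z = 1 / (2 * L) * u z" for z
      have "u' \<in> Y" "NY u' \<le> \<bar>1 / (2 * L)\<bar> * NY u" using scale[OF u(1)] unfolding u'_def[abs_def] by blast+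
      moreover have "\<bar>1 / (2 * L)\<bar> * NY u \<le> \<bar>1 / (2 * L)\<bar> * (L * NY g)" using u(3) by (rule mult_left_mono) simp
      moreover have "\<bar>1 / (2 * L)\<bar> * (L * NY g) = 1 / 2 * NY g" using K by simp
      moreover have "AE z in P. Mx (\<lambda>z. ennreal \<bar>g z\<bar>) z \<le> ennreal (2 * L) * ennreal \<bar>u' z\<bar>"
        using u(2)
      proof eventually_elim
        case (elim z)
        have "ennreal (u z) \<le> ennreal (2 * L) * ennreal \<bar>u' z\<bar>"
          using K by (simp add: u'_def ennreal_mult''[symmetric] abs_mult ennreal_leI)
        then show ?case using elim by (rule order_trans[rotated])
      qed
      ultimately show ?thesis by (intro exI[of _ u']) (simp add: Q_def)
    qed
    define S where "S g = (SOME u. Q g u)" for g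
    have "Q g (S g)" if "g \<in> Y" for g unfolding S_def by (rule someI_ex[OF ex[OF that]])
    then have S: "\<And>g. g \<in> Y \<Longrightarrow> S g \<in> Y"
      "\<And>g. g \<in> Y \<Longrightarrow> AE z in P. Mx (\<lambda>z. ennreal \<bar>g z\<bar>) z \<le> ennreal (2 * L) * ennreal \<bar>S g z\<bar>"
      "\<And>g. g \<in> Y \<Longrightarrow> NY (S g) \<le> 1 / 2 * NY g"
      unfolding Q_def by simp_all
    define F where "F k = (S ^^ k) f" for k
    have F_Suc: "F (Suc k) = S (F k)" for k by (simp add: F_def)
    have FY: "F k \<in> Y" for k by (induction k) (use f S(1) in \<open>simp_all add: F_def\<close>)
    have FN: "NY (F k) \<le> NY f * (1 / 2) ^ k" for k
    proof (induction k)
      case (Suc k)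
      then show ?case using S(3)[OF FY[of k]] by (simp add: F_Suc)
    qed (simp add: F_def)
    have Fm [measurable]: "F k \<in> borel_measurable P" for k using FY by (rule meas)
    define H where "H z = (\<Sum>k. ennreal \<bar>F k z\<bar>)" for z
    have Hm [measurable]: "H \<in> borel_measurable P" unfolding H_def[abs_def] by measurable
    obtain g where g: "g \<in> Y" "AE z in P. H z \<le> ennreal (g z)" "NY g \<le> 2 * NY f"
      using sum[OF FY FN] unfolding H_def by blast
    define h where "h z = enn2real (H z)" for z
    have hm [measurable]: "h \<in> borel_measurable P" unfolding h_def[abs_def] by measurable
    have hH: "AE z in P. ennreal (h z) = H z"
      using g(2) by eventually_elim (auto simp: h_def ennreal_enn2real_if top_unique)
    have "AE z in P. \<bar>h z\<bar> \<le> \<bar>g z\<bar>"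
      using g(2)
    proof eventually_elim
      case (elim z)
      have "enn2real (H z) \<le> enn2real (ennreal (g z))" using elim by (intro enn2real_mono) auto
      then show ?case by (cases "0 \<le> g z") (simp_all add: h_def ennreal_neg)
    qed
    then have hY: "h \<in> Y" "NY h \<le> NY g" using ideal[OF g(1) hm] by auto
    have fh: "AE z in P. \<bar>f z\<bar> \<le> h z"
      using hH
    proof eventually_elim
      case (elim z)
      have "(\<Sum>k\<in>{0}. ennreal \<bar>F k z\<bar>) \<le> H z" unfolding H_def by (intro sum_le_suminf) auto
      then have "ennreal \<bar>f z\<bar> \<le> ennreal (h z)" unfolding elim by (simp add: F_def)
      then show ?case by (simp add: h_def)
    qed
    have "AE z in P. \<forall>k. Mx (\<lambda>z. ennreal \<bar>F k z\<bar>) z \<le> ennreal (2 * L) * ennreal \<bar>F (Suc k) z\<bar>"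
      unfolding AE_all_countable F_Suc by (intro allI S(2) FY)
    moreover have "AE z in P. Mx (\<lambda>z. ennreal \<bar>h z\<bar>) z \<le> Mx H z"
    proof (rule Mx_mono_AE)
      show "AE z in P. ennreal \<bar>h z\<bar> \<le> H z"
        using hH by eventually_elim (simp add: h_def)
    qed measurable
    ultimately have "AE z in P. maximal_function d \<nu> h z \<le> ennreal (mxf_const * (2 * L)) * ennreal (h z)"
      using hH AE_space
    proof eventually_elim
      case (elim z)
      have "maximal_function d \<nu> h z \<le> ennreal mxf_const * Mx (\<lambda>z. ennreal \<bar>h z\<bar>) z"
        using elim(4) by (rule maximal_function_le_Mx)
      also have "\<dots> \<le> ennreal mxf_const * (\<Sum>k. Mx (\<lambda>z. ennreal \<bar>F k z\<bar>) z)"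
      proof (rule mult_left_mono)
        have "Mx H z \<le> (\<Sum>k. Mx (\<lambda>z. ennreal \<bar>F k z\<bar>) z)"
          unfolding H_def[abs_def] using elim(4) by (intro Mx_suminf_le) auto
        then show "Mx (\<lambda>z. ennreal \<bar>h z\<bar>) z \<le> (\<Sum>k. Mx (\<lambda>z. ennreal \<bar>F k z\<bar>) z)"
          using elim(2) by (rule order_trans[rotated])
      qed simp
      also have "\<dots> \<le> ennreal mxf_const * (\<Sum>k. ennreal (2 * L) * ennreal \<bar>F (Suc k) z\<bar>)"
        using elim(1) by (intro mult_left_mono suminf_le) auto
      also have "\<dots> = ennreal mxf_const * (ennreal (2 * L) * (\<Sum>k. ennreal \<bar>F (Suc k) z\<bar>))" by simp
      also have "\<dots> \<le> ennreal mxf_const * (ennreal (2 * L) * H z)"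
      proof (intro mult_left_mono)
        have "H z = (\<Sum>k. ennreal \<bar>F (k + 1) z\<bar>) + (\<Sum>k<1. ennreal \<bar>F k z\<bar>)"
          unfolding H_def by (rule suminf_offset) simp
        then show "(\<Sum>k. ennreal \<bar>F (Suc k) z\<bar>) \<le> H z" by simp
      qed auto
      also have "\<dots> = ennreal (mxf_const * (2 * L)) * ennreal (h z)"
        using K Cd_ge_1 elim(3) by (simp add: mxf_const_def ennreal_mult mult.assoc)
      finally show ?case .
    qed
    then have "A1_const d \<nu> \<mu> h \<le> ennreal (mxf_const * (2 * L))"
      unfolding A1_const_def by (intro Inf_lower CollectI)
    then have "Ap_const d \<nu> \<mu> 1 h \<le> ennreal (mxf_const * (2 * L))" by (simp add: Ap_const_def)
    then show "\<exists>w\<in>Y. (AE z in P. \<bar>f z\<bar> \<le> w z) \<and> NY w \<le> 2 * NY f \<and> Ap_const d \<nu> \<mu> 1 w \<le> ennreal (mxf_const * (2 * L))"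
      using hY fh g(3) by (intro bexI[of _ h]) auto
  qed
  then show ?thesis unfolding Ap_regular_def by blast
qed

end

section \<open>A1-regularity of the dual and of the lattice\<close>

locale product_lattice = product_space d \<nu> K Cd D \<mu> + function_lattice "\<nu> \<Otimes>\<^sub>M \<mu>" X N
  for d :: "'s \<Rightarrow> 's \<Rightarrow> real" and \<nu> :: "'s measure" and K Cd :: real and D :: "'s set"
    and \<mu> :: "'o measure" and X :: "('s \<times> 'o \<Rightarrow> real) set" and N :: "('s \<times> 'o \<Rightarrow> real) \<Rightarrow> real"
begin

lemma majorized_Hoelder:
  assumes "w \<in> X" "v \<in> X'"
  shows "pairing v w \<le> ennreal (N w * N' v)"
proof -
  have "pairing v w \<le> (\<integral>\<^sup>+z. ennreal \<bar>w z\<bar> * ennreal \<bar>v z\<bar> \<partial>P)"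
    by (intro nn_integral_mono) (subst mult.commute, intro mult_mono ennreal_leI, auto)
  then show ?thesis using Hoelder[OF assms] by simp
qed

text \<open>The weighted bound is used with exchanged roles: M acts on a weight in the dual, and
  weights in X test it. Then \<open>dual_majorant\<close> places a majorant of the maximal function
  in the dual.\<close>

lemma dual_A1_regular:
  assumes regX: "Ainf_regular d \<nu> \<mu> X N" and regX': "Ainf_regular d \<nu> \<mu> X' N'"
  shows "Ap_regular d \<nu> \<mu> 1 X' N'"
proof -
  obtain \<phi> m where \<phi>: "\<And>\<eta>. 0 < \<eta> \<Longrightarrow> 0 < \<phi> \<eta>" and m: "0 \<le> m" and
    wX: "\<And>f. f \<in> X \<Longrightarrow> \<exists>w\<in>X. (AE z in P. \<bar>f z\<bar> \<le> w z) \<and> N w \<le> m * N f \<and> section_weight \<phi> w"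
    by (rule Ainf_regular_weights[OF regX X_measurable N_nonneg]; (assumption | (rule that, assumption+)))
  obtain \<psi> m' where \<psi>: "\<And>\<eta>. 0 < \<eta> \<Longrightarrow> 0 < \<psi> \<eta>" and m': "0 \<le> m'" and
    vX: "\<And>g. g \<in> X' \<Longrightarrow> \<exists>v\<in>X'. (AE z in P. \<bar>g z\<bar> \<le> v z) \<and> N' v \<le> m' * N' g \<and> section_weight \<psi> v"
    by (rule Ainf_regular_weights[OF regX' dual_measurable dual_norm_nonneg]; (assumption | (rule that, assumption+)))
  obtain C :: real where C: "0 \<le> C" and bound: "\<And>w v. section_weight \<psi> w \<Longrightarrow> section_weight \<phi> v \<Longrightarrow>
      (\<integral>\<^sup>+z. ennreal (v z) * Mr w z \<partial>P) \<le> ennreal C * pairing v w"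
    by (rule section_weight_estimates[of \<psi> \<phi>, OF \<psi> \<phi>]; (assumption | (rule that, assumption+)))
  \<comment> \<open>The summand 1 only ensures L > 0, since the iteration divides by 2 L.\<close>
  define L where "L = C * m * m' + 1"
  have L: "0 < L" using C m m' by (simp add: L_def add_nonneg_pos)
  show ?thesis
  proof (rule Rubio_de_Francia[OF dual_measurable _ _ dual_geometric_sum_majorant L])
    show "f \<in> X' \<and> N' f \<le> N' g"
      if "g \<in> X'" "f \<in> borel_measurable P" "AE z in P. \<bar>f z\<bar> \<le> \<bar>g z\<bar>" for f g
      using dual_ideal[OF that] dual_norm_mono[OF that] by simp
    show "(\<lambda>z. c * f z) \<in> X' \<and> N' (\<lambda>z. c * f z) \<le> \<bar>c\<bar> * N' f" if "f \<in> X'" for f c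
      using dual_scale[OF that] dual_norm_scale[OF that] by simp
    show "\<exists>u\<in>X'. (AE z in P. Mx (\<lambda>z. ennreal \<bar>g z\<bar>) z \<le> ennreal (u z)) \<and> N' u \<le> L * N' g" if g: "g \<in> X'" for g
    proof -
      obtain v where v: "v \<in> X'" "AE z in P. \<bar>g z\<bar> \<le> v z" "N' v \<le> m' * N' g" "section_weight \<psi> v"
        using vX[OF g] by blast
      note [measurable] = dual_measurable[OF g] dual_measurable[OF v(1)]
      have B: "0 \<le> L * N' g" using L dual_norm_nonneg by simp
      obtain u where u: "u \<in> X'" "AE z in P. Mr v z \<le> ennreal (u z)" "N' u \<le> L * N' g"
      proof (rule dual_majorant[OF _ B])
        show "Mr v \<in> borel_measurable P" by measurable
        fix f assume f: "f \<in> X" "N f \<le> 1"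
        obtain w where w: "w \<in> X" "AE z in P. \<bar>f z\<bar> \<le> w z" "N w \<le> m * N f" "section_weight \<phi> w"
          using wX[OF f(1)] by blast
        have "(\<integral>\<^sup>+z. ennreal \<bar>f z\<bar> * Mr v z \<partial>P)
            \<le> (\<integral>\<^sup>+z. ennreal (w z) * Mr v z \<partial>P)"
        proof (rule nn_integral_mono_AE)
          show "AE z in P. ennreal \<bar>f z\<bar> * Mr v z \<le> ennreal (w z) * Mr v z"
            using w(2) by eventually_elim (intro mult_right_mono ennreal_leI, simp_all)
        qed
        also have "\<dots> \<le> ennreal C * pairing w v" by (rule bound[OF v(4) w(4)])
        also have "\<dots> \<le> ennreal C * ennreal (N w * N' v)"
          using majorized_Hoelder[OF w(1) v(1)] by (intro mult_left_mono) (simp_all add: mult.commute)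
        also have "\<dots> \<le> ennreal (L * N' g)"
        proof -
          have "N w \<le> m * 1" using w(3) mult_left_mono[OF f(2) m] by simp
          then have "N w * N' v \<le> m * (m' * N' g)"
            using v(3) m dual_norm_nonneg N_nonneg[OF w(1)] by (intro mult_mono) auto
          then have "C * (N w * N' v) \<le> C * (m * (m' * N' g))" using C by (rule mult_left_mono)
          also have "\<dots> \<le> L * N' g" using dual_norm_nonneg[of g] by (simp add: L_def algebra_simps)
          finally show ?thesis using C by (simp add: ennreal_mult'[symmetric] ennreal_leI)
        qed
        finally show "(\<integral>\<^sup>+z. ennreal \<bar>f z\<bar> * Mr v z \<partial>P) \<le> ennreal (L * N' g)" .
      qed (rule that)
      have "AE z in P. Mx (\<lambda>z. ennreal \<bar>g z\<bar>) z \<le> Mr v z"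
      proof (rule Mx_mono_AE)
        show "AE z in P. ennreal \<bar>g z\<bar> \<le> ennreal (v z)" using v(2) by eventually_elim (rule ennreal_leI)
      qed measurable
      then have "AE z in P. Mx (\<lambda>z. ennreal \<bar>g z\<bar>) z \<le> ennreal (u z)"
        using u(2) by eventually_elim (rule order_trans)
      then show ?thesis using u(1,3) by blast
    qed
  qed
qed

text \<open>Norms of the truncations are computed by duality after each test function g is replaced
  by a weight v dominating its modulus. Then \<open>bound\<close> gives norms at most B = C m' N(w),
  and \<open>decay\<close> gives at most B / n for differences with the n-th truncation.\<close>

lemma maximal_majorant:
  assumes complete: "norm_complete X N" and norming: "norming P X' N' X N"
    and \<phi>: "\<And>\<eta>. 0 < \<eta> \<Longrightarrow> 0 < \<phi> \<eta>" and w: "w \<in> X" "section_weight \<phi> w"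
    and m': "0 \<le> m'" and vX: "\<And>g. g \<in> X' \<Longrightarrow> \<exists>v\<in>X'. (AE z in P. \<bar>g z\<bar> \<le> v z) \<and> N' v \<le> m' * N' g \<and> section_weight \<psi> v"
    and C: "0 \<le> C" "mono \<tau>" "\<And>n::nat. 0 < \<tau> n" "\<And>b. \<exists>n. b < \<tau> n"
    and bound: "\<And>v. section_weight \<psi> v \<Longrightarrow>
      (\<integral>\<^sup>+z. ennreal (v z) * Mr w z \<partial>P) \<le> ennreal C * pairing v w"
    and decay: "\<And>v n. section_weight \<psi> v \<Longrightarrow>
      of_nat n * (\<integral>\<^sup>+z. ennreal (v z) * (Mr w z - ennreal (\<tau> n) * ennreal (w z)) \<partial>P)
        \<le> ennreal C * pairing v w"
  obtains u where "u \<in> X" "AE z in P. Mr w z \<le> ennreal (u z)" "N u \<le> C * m' * N w"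
proof -
  note wm [measurable] = X_measurable[OF w(1)]
  define F where "F = Mr w"
  have Fm [measurable]: "F \<in> borel_measurable P" unfolding F_def by measurable
  define B where "B = C * m' * N w"
  have B: "0 \<le> B" using C m' N_nonneg[OF w(1)] by (simp add: B_def)
  \<comment> \<open>The minimum is finite even where the maximal function is not, so
    \<open>enn2real\<close> loses nothing.\<close>
  define U where "U n z = enn2real (min (F z) (ennreal (\<tau> n) * ennreal (w z)))" for n z
  have eU: "ennreal (U n z) = min (F z) (ennreal (\<tau> n) * ennreal (w z))" for n z
    unfolding U_def by (rule ennreal_enn2real) (simp add: ennreal_mult_less_top min_less_iff_disj)
  have U0: "0 \<le> U n z" for n z by (simp add: U_def)
  have Um [measurable]: "U n \<in> borel_measurable P" for n unfolding U_def[abs_def] by measurable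
  have U: "U n \<in> X" for n
  proof (rule X_ideal[OF X_scale[OF w(1)] Um])
    have "U n z \<le> \<bar>\<tau> n * w z\<bar>" for z
    proof -
      have "ennreal (U n z) \<le> ennreal (\<tau> n) * ennreal \<bar>w z\<bar>"
        unfolding eU by (intro min.coboundedI2 mult_left_mono ennreal_leI) auto
      also have "\<dots> = ennreal \<bar>\<tau> n * w z\<bar>" using C(3)[of n] by (simp add: ennreal_mult abs_mult)
      finally show ?thesis by simp
    qed
    then show "AE z in P. \<bar>U n z\<bar> \<le> \<bar>\<tau> n * w z\<bar>" using U0 by simp
  qed
  have inc: "incseq (\<lambda>n. U n z)" for z
  proof (rule incseq_SucI)
    fix n
    have "ennreal (U n z) \<le> ennreal (U (Suc n) z)"
      unfolding eU using monoD[OF C(2), of n "Suc n"] by (intro min.mono mult_right_mono ennreal_leI) simp_all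
    then show "U n z \<le> U (Suc n) z" using U0 by simp
  qed
  have weight: "\<exists>v. (AE z in P. \<bar>g z\<bar> \<le> v z) \<and> section_weight \<psi> v \<and>
      ennreal C * pairing v w \<le> ennreal B"
    if g: "g \<in> X'" "N' g = 1" for g
  proof -
    obtain v where v: "v \<in> X'" "AE z in P. \<bar>g z\<bar> \<le> v z" "N' v \<le> m' * N' g" "section_weight \<psi> v"
      using vX[OF g(1)] by blast
    have "ennreal C * pairing v w \<le> ennreal C * ennreal (N w * N' v)"
      by (intro mult_left_mono majorized_Hoelder w v) simp
    also have "\<dots> = ennreal (C * (N w * N' v))" using C by (simp add: ennreal_mult')
    also have "\<dots> \<le> ennreal (C * (N w * m'))"
      using C v(3) g(2) N_nonneg[OF w(1)] by (intro ennreal_leI mult_left_mono) auto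
    finally show ?thesis using v by (auto simp: B_def mult_ac)
  qed
  have norm_U: "N (U n) \<le> B" for n
  proof (rule norming_bound[OF norming U B])
    fix g assume g: "g \<in> X'" "N' g = 1"
    obtain v where v: "AE z in P. \<bar>g z\<bar> \<le> v z" "section_weight \<psi> v"
      "ennreal C * pairing v w \<le> ennreal B" using weight[OF g] by blast
    have "(\<integral>\<^sup>+z. ennreal \<bar>U n z\<bar> * ennreal \<bar>g z\<bar> \<partial>P) \<le> (\<integral>\<^sup>+z. ennreal (v z) * F z \<partial>P)"
    proof (rule nn_integral_mono_AE)
      show "AE z in P. ennreal \<bar>U n z\<bar> * ennreal \<bar>g z\<bar> \<le> ennreal (v z) * F z"
        using v(1)
      proof eventually_elim
        case (elim z)
        have "ennreal \<bar>U n z\<bar> \<le> F z" using U0 eU by simp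
        moreover have "ennreal \<bar>g z\<bar> \<le> ennreal (v z)" using elim by (rule ennreal_leI)
        ultimately show ?case by (subst mult.commute) (intro mult_mono, auto)
      qed
    qed
    also have "\<dots> \<le> ennreal B" using bound[OF v(2)] v(3) unfolding F_def by (rule order_trans)
    finally show "(\<integral>\<^sup>+z. ennreal \<bar>U n z\<bar> * ennreal \<bar>g z\<bar> \<partial>P) \<le> ennreal B" .
  qed
  have diff: "N (\<lambda>z. U k z - U n z) \<le> B / real n" if "n \<le> k" "0 < n" for k n
  proof (rule norming_bound[OF norming X_diff[OF U U]])
    show "0 \<le> B / real n" using B by simp
    fix g assume g: "g \<in> X'" "N' g = 1"
    obtain v where v: "AE z in P. \<bar>g z\<bar> \<le> v z" "section_weight \<psi> v"
      "ennreal C * pairing v w \<le> ennreal B" using weight[OF g] by blast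
    have "(\<integral>\<^sup>+z. ennreal \<bar>U k z - U n z\<bar> * ennreal \<bar>g z\<bar> \<partial>P)
        \<le> (\<integral>\<^sup>+z. ennreal (v z) * (F z - ennreal (\<tau> n) * ennreal (w z)) \<partial>P)" (is "?I \<le> ?J")
    proof (rule nn_integral_mono_AE)
      show "AE z in P. ennreal \<bar>U k z - U n z\<bar> * ennreal \<bar>g z\<bar>
          \<le> ennreal (v z) * (F z - ennreal (\<tau> n) * ennreal (w z))"
        using v(1)
      proof eventually_elim
        case (elim z)
        have le: "U n z \<le> U k z" using inc[of z] that(1) by (rule incseqD)
        then have "ennreal \<bar>U k z - U n z\<bar> = ennreal (U k z) - ennreal (U n z)"
          using U0 by (simp add: ennreal_minus)
        \<comment> \<open>Where M w is at most \<tau>(n) w the two truncations coincide; elsewhere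
          the n-th one equals \<tau>(n) w.\<close>
        also have "\<dots> \<le> F z - ennreal (\<tau> n) * ennreal (w z)"
        proof (cases "F z \<le> ennreal (\<tau> n) * ennreal (w z)")
          case True
          have "ennreal (\<tau> n) * ennreal (w z) \<le> ennreal (\<tau> k) * ennreal (w z)"
            using monoD[OF C(2) that(1)] by (intro mult_right_mono ennreal_leI) simp_all
          then have "F z \<le> ennreal (\<tau> k) * ennreal (w z)" using True by (rule order_trans[rotated])
          then have "ennreal (U k z) \<le> ennreal (U n z)" using True unfolding eU by (simp add: min_absorb1)
          then show ?thesis by (simp add: diff_eq_0_ennreal)
        next
          case False
          then have "ennreal (U n z) = ennreal (\<tau> n) * ennreal (w z)" unfolding eU by (simp add: min_def)
          moreover have "ennreal (U k z) \<le> F z" unfolding eU by simp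
          ultimately show ?thesis by (simp add: ennreal_minus_mono)
        qed
        finally have "ennreal \<bar>U k z - U n z\<bar> \<le> F z - ennreal (\<tau> n) * ennreal (w z)" .
        moreover have "ennreal \<bar>g z\<bar> \<le> ennreal (v z)" using elim by (rule ennreal_leI)
        ultimately show ?case by (subst mult.commute) (intro mult_mono, auto)
      qed
    qed
    moreover have "ennreal (real n) * ?J \<le> ennreal B"
      using order_trans[OF decay[OF v(2), of n] v(3)] unfolding F_def by (simp add: ennreal_of_nat_eq_real_of_nat)
    then have "?J \<le> ennreal (1 / real n) * ennreal B"
      using that(2) by (subst (asm) ennreal_mult_le_iff_le_inverse) auto
    moreover have "ennreal (1 / real n) * ennreal B = ennreal (B / real n)"
      using B by (simp add: ennreal_mult[symmetric])
    ultimately show "?I \<le> ennreal (B / real n)" by simp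
  qed
  obtain u where u: "u \<in> X" "\<And>n. AE z in P. U n z \<le> u z" "N u \<le> B"
  proof (rule monotone_limit[OF complete U inc _ norm_U])
    show "\<exists>k. \<forall>m\<ge>k. \<forall>n\<ge>k. N (\<lambda>z. U m z - U n z) < e" if e: "0 < e" for e
    proof -
      obtain k :: nat where k: "B / e < real k" using reals_Archimedean2 by blast
      have "0 \<le> B / e" using B e by simp
      then have "0 < real k" using k by linarith
      then have k0: "0 < k" by simp
      have *: "N (\<lambda>z. U m z - U n z) < e" if n: "k \<le> n" "n \<le> m" for m n
      proof -
        have "B / real n \<le> B / real k" using B k0 n by (intro divide_left_mono) auto
        also have "\<dots> < e" using k k0 e by (simp add: field_simps)
        finally show ?thesis using diff[OF n(2)] k0 n(1) by fastforce
      qed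
      have "N (\<lambda>z. U m z - U n z) < e" if "k \<le> n" "k \<le> m" for m n
        using *[of n m] *[of m n] N_diff_commute[OF U[of m] U[of n]] that by (cases "n \<le> m") auto
      then show ?thesis by blast
    qed
  qed (rule that)
  \<comment> \<open>Where w vanishes all truncations vanish, so the limit carries no information
    there; M w is zero at almost every such point.\<close>
  have zero: "AE z in P. ennreal (w z) = 0 \<longrightarrow> Mr w z = 0"
    using w(2) by (rule section_weight_zero) (rule \<phi>)
  have "AE z in P. \<forall>n. U n z \<le> u z" unfolding AE_all_countable by (intro allI u(2))
  then have "AE z in P. F z \<le> ennreal (u z)"
    using zero
  proof eventually_elim
    case (elim z)
    show ?case
    proof (cases "ennreal (w z) = 0")
      case True
      then show ?thesis using elim(2) by (simp add: F_def)
    next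
      case False
      then have wz: "0 < w z" by (simp add: ennreal_eq_0_iff)
      \<comment> \<open>For this n the multiple \<tau>(n) w exceeds u at z, so the minimum, being at
        most u, must be attained by M w.\<close>
      obtain n where n: "u z / w z < \<tau> n" using C(4) by blast
      then have n': "u z < \<tau> n * w z" using wz by (simp add: field_simps)
      have "0 < \<tau> n * w z" using C(3)[of n] wz by simp
      then have "ennreal (u z) < ennreal (\<tau> n) * ennreal (w z)"
        using n' wz C(3)[of n] by (simp add: ennreal_mult[symmetric] ennreal_lessI)
      moreover have "min (F z) (ennreal (\<tau> n) * ennreal (w z)) \<le> ennreal (u z)"
        unfolding eU[symmetric] using elim(1) by (intro ennreal_leI) simp
      ultimately show ?thesis by (auto simp: min_def split: if_splits)
    qed
  qed
  then show thesis unfolding F_def by (rule that[OF u(1) _ u(3)[unfolded B_def]])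
qed

lemma A1_regular:
  assumes complete: "norm_complete X N" and norming: "norming P X' N' X N"
    and regX: "Ainf_regular d \<nu> \<mu> X N" and regX': "Ainf_regular d \<nu> \<mu> X' N'"
  shows "Ap_regular d \<nu> \<mu> 1 X N"
proof -
  obtain \<phi> m where \<phi>: "\<And>\<eta>. 0 < \<eta> \<Longrightarrow> 0 < \<phi> \<eta>" and m: "0 \<le> m" and
    wX: "\<And>f. f \<in> X \<Longrightarrow> \<exists>w\<in>X. (AE z in P. \<bar>f z\<bar> \<le> w z) \<and> N w \<le> m * N f \<and> section_weight \<phi> w"
    by (rule Ainf_regular_weights[OF regX X_measurable N_nonneg]; (assumption | (rule that, assumption+)))
  obtain \<psi> m' where \<psi>: "\<And>\<eta>. 0 < \<eta> \<Longrightarrow> 0 < \<psi> \<eta>" and m': "0 \<le> m'" and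
    vX: "\<And>g. g \<in> X' \<Longrightarrow> \<exists>v\<in>X'. (AE z in P. \<bar>g z\<bar> \<le> v z) \<and> N' v \<le> m' * N' g \<and> section_weight \<psi> v"
    by (rule Ainf_regular_weights[OF regX' dual_measurable dual_norm_nonneg]; (assumption | (rule that, assumption+)))
  show ?thesis
  proof (rule section_weight_estimates[of \<phi> \<psi>, OF \<phi> \<psi>])
    fix C :: real and \<tau> :: "nat \<Rightarrow> real"
    assume C: "0 \<le> C" "mono \<tau>" "\<And>n. 0 < \<tau> n" "\<And>b. \<exists>n. b < \<tau> n"
      and bound: "\<And>w v. section_weight \<phi> w \<Longrightarrow> section_weight \<psi> v \<Longrightarrow>
      (\<integral>\<^sup>+z. ennreal (v z) * Mr w z \<partial>P) \<le> ennreal C * pairing v w"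
      and decay: "\<And>w v n. section_weight \<phi> w \<Longrightarrow> section_weight \<psi> v \<Longrightarrow>
      of_nat n * (\<integral>\<^sup>+z. ennreal (v z) * (Mr w z - ennreal (\<tau> n) * ennreal (w z)) \<partial>P)
        \<le> ennreal C * pairing v w"
    define L where "L = C * m' * m + 1"
    have L: "0 < L" using C m m' by (simp add: L_def add_nonneg_pos)
    show ?thesis
    proof (rule Rubio_de_Francia[OF X_measurable _ _ geometric_sum_majorant[OF complete] L])
      show "f \<in> X \<and> N f \<le> N g"
        if "g \<in> X" "f \<in> borel_measurable P" "AE z in P. \<bar>f z\<bar> \<le> \<bar>g z\<bar>" for f g
        using X_ideal[OF that] N_mono[OF that] by simp
      show "(\<lambda>z. c * f z) \<in> X \<and> N (\<lambda>z. c * f z) \<le> \<bar>c\<bar> * N f" if "f \<in> X" for f c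
        using X_scale[OF that] N_scale[OF that] by simp
      show "\<exists>u\<in>X. (AE z in P. Mx (\<lambda>z. ennreal \<bar>f z\<bar>) z \<le> ennreal (u z)) \<and> N u \<le> L * N f" if f: "f \<in> X" for f
      proof -
        obtain w where w: "w \<in> X" "AE z in P. \<bar>f z\<bar> \<le> w z" "N w \<le> m * N f" "section_weight \<phi> w"
          using wX[OF f] by blast
        note [measurable] = X_measurable[OF f] X_measurable[OF w(1)]
        obtain u where u: "u \<in> X" "AE z in P. Mr w z \<le> ennreal (u z)" "N u \<le> C * m' * N w"
          by (rule maximal_majorant[OF complete norming \<phi> w(1,4) m' vX C bound[OF w(4)] decay[OF w(4)]])
        have "AE z in P. Mx (\<lambda>z. ennreal \<bar>f z\<bar>) z \<le> Mr w z"
        proof (rule Mx_mono_AE)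
          show "AE z in P. ennreal \<bar>f z\<bar> \<le> ennreal (w z)" using w(2) by eventually_elim (rule ennreal_leI)
        qed measurable
        then have "AE z in P. Mx (\<lambda>z. ennreal \<bar>f z\<bar>) z \<le> ennreal (u z)"
          using u(2) by eventually_elim (rule order_trans)
        moreover have "N u \<le> L * N f"
        proof -
          have "C * m' * N w \<le> C * m' * (m * N f)" using w(3) C m' by (intro mult_left_mono) auto
          also have "\<dots> \<le> L * N f" using N_nonneg[OF f] by (simp add: L_def algebra_simps)
          finally show ?thesis using u(3) by simp
        qed
        ultimately show ?thesis using u(1) by blast
      qed
    qed
  qed
qed

end

theorem proposition8:
  fixes d :: "'s \<Rightarrow> 's \<Rightarrow> real" and \<nu> :: "'s measure" and \<mu> :: "'o measure"
    and X :: "('s \<times> 'o \<Rightarrow> real) set" and N :: "('s \<times> 'o \<Rightarrow> real) \<Rightarrow> real"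
  defines "X' \<equiv> order_dual (\<nu> \<Otimes>\<^sub>M \<mu>) X N" and "N' \<equiv> dual_norm (\<nu> \<Otimes>\<^sub>M \<mu>) X N"
  assumes "homogeneous_type_space d \<nu>"
    and "sigma_finite_measure \<mu>"
    and "normed_lattice (\<nu> \<Otimes>\<^sub>M \<mu>) X N"
    and "norm_complete X N"
    and "norming (\<nu> \<Otimes>\<^sub>M \<mu>) X' N' X N"
    and "Ainf_regular d \<nu> \<mu> X N"
    and "Ainf_regular d \<nu> \<mu> X' N'"
  shows "Ap_regular d \<nu> \<mu> 1 X N \<and> Ap_regular d \<nu> \<mu> 1 X' N'"
proof -
  obtain K Cd where "doubling_space d \<nu> K Cd"
    using assms(3) by (rule homogeneous_type_space_doubling)
  then interpret S: doubling_space d \<nu> K Cd .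
  obtain D where D: "countable D" "D \<subseteq> space \<nu>" "\<forall>x\<in>space \<nu>. \<forall>r>0. \<exists>y\<in>D. d x y < r"
    using S.countable_dense by (elim exE conjE)
  interpret \<mu>: sigma_finite_measure \<mu> by (rule assms(4))
  interpret product_lattice d \<nu> K Cd D \<mu> X N
    using assms(5) D by unfold_locales simp_all
  show ?thesis
    using A1_regular dual_A1_regular assms(6-9) unfolding X'_def N'_def by simp
qed

end
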